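(* Let $\alpha\in(0,2)$, $\eta\ge0$ and $u_0\in BUC(\mathbb{R})$. Then there exists a unique bounded continuous viscosity solution $u$ of the initial value problem $$u_t=\eta\,u_{xx}-|u_x|\,\Lambda^\alpha u\ \text{ on }\mathbb{R}\times(0,+\infty),\qquad u(x,0)=u_0(x)\ \text{ for }x\in\mathbb{R}.$$
   Context: $BUC(\mathbb{R})$ is the space of bounded uniformly continuous functions on $\mathbb{R}$. Operator. For $\alpha\in(0,2)$, $\Lambda^\alpha$ is given on Schwartz functions by $\widehat{(\Lambda^\alpha w)}(\xi)=|\xi|^\alpha\widehat w(\xi)$, and on bounded sufficiently smooth functions by the Lévy–Khintchine formula $$-\Lambda^\alpha w(x)=C(\alpha)\int_{\mathbb{R}}\left\{w(x+z)-w(x)-z\,w'(x)\mathbf 1_{\{|z|\le 1\}}\right\}\frac{dz}{|z|^{1+\alpha}},$$ with the constant $C(\alpha)>0$ for which the two definitions agree. Envelopes. For a locally bounded function $u$, $u^*(x,t)=\limsup_{y\to x,\,s\to t}u(y,s)$ and $u_*(x,t)=\liminf_{y\to x,\,s\to t}u(y,s)$ are its upper and lower semicontinuous envelopes (over $(y,s)\in\mathbb{R}\times[0,+\infty)$, including $(x,t)$ itself); similarly for functions of $x$ only. Viscosity solutions. A bounded upper (resp. lower) semicontinuous function $u:\mathbb{R}\times[0,+\infty)\to\mathbb{R}$ is a viscosity subsolution (resp. supersolution) of $u_t=\eta u_{xx}-|u_x|\Lambda^\alpha u$ on $\mathbb{R}\times(0,+\infty)$ if for every $(x_0,t_0)$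 with $t_0>0$, every $\tau\in(0,t_0)$ and every test function $\phi\in C^2(\mathbb{R}\times(0,+\infty))\cap L^\infty(\mathbb{R}\times(0,+\infty))$ such that $u-\phi$ attains a maximum (resp. minimum) over $\mathbb{R}\times(t_0-\tau,t_0+\tau)$ at $(x_0,t_0)$, one has $$\partial_t\phi(x_0,t_0)-\eta\,\phi_{xx}(x_0,t_0)+|\phi_x(x_0,t_0)|\,(\Lambda^\alpha\phi(\cdot,t_0))(x_0)\le 0\quad(\text{resp. }\ge0),$$ with $\Lambda^\alpha\phi$ given by the Lévy–Khintchine formula. It is a subsolution (resp. supersolution) of the initial value problem with datum $u_0$ on $\mathbb{R}\times[0,+\infty)$ if moreover $u(\cdot,0)\le u_0^*$ (resp. $u(\cdot,0)\ge(u_0)_*$). A function $u$ is a viscosity solution of the equation (resp. of the initial value problem) if $u^*$ is a viscosity subsolution and $u_*$ is a viscosity supersolution. *)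

theory Defs
  imports "HOL-Probability.Probability"
begin

section \<open>The operator\<close>

text \<open>Real-valued Schwartz functions and their Fourier transform, with the convention
  that $-w''$ has transform $\xi^2 \hat w$.\<close>

definition schwartz :: "(real \<Rightarrow> real) \<Rightarrow> bool" where
  "schwartz w \<longleftrightarrow>
     (\<forall>n x. (deriv ^^ n) w differentiable at x) \<and>
     (\<forall>m n. bounded (range (\<lambda>x. x ^ m * (deriv ^^ n) w x)))"

definition fourier :: "(real \<Rightarrow> real) \<Rightarrow> real \<Rightarrow> complex" where
  "fourier w \<xi> = (LINT x|lborel. iexp (- (x * \<xi>)) * complex_of_real (w x))"

definition levy_integral :: "real \<Rightarrow> (real \<Rightarrow> real) \<Rightarrow> real \<Rightarrow> real" where
  "levy_integral \<alpha> w x =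
     (LINT z|lborel. (w (x + z) - w x - z * deriv w x * indicator {z. \<bar>z\<bar> \<le> 1} z)
        / \<bar>z\<bar> powr (1 + \<alpha>))"

text \<open>The constant for which the Levy--Khintchine and the Fourier definitions of the operator
  agree; \<open>levy_const_well_defined\<close> below shows that the description denotes.\<close>

definition levy_const :: "real \<Rightarrow> real" where
  "levy_const \<alpha> = (THE c. 0 < c \<and>
     (\<forall>w. schwartz w \<longrightarrow>
        (\<forall>\<xi>. fourier (\<lambda>x. - (c * levy_integral \<alpha> w x)) \<xi> = of_real (\<bar>\<xi>\<bar> powr \<alpha>) * fourier w \<xi>)))"

definition frac_lap :: "real \<Rightarrow> (real \<Rightarrow> real) \<Rightarrow> real \<Rightarrow> real" where
  "frac_lap \<alpha> w x = - (levy_const \<alpha> * levy_integral \<alpha> w x)"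


section \<open>Semicontinuity and envelopes\<close>

definition usc_on :: "'a::topological_space set \<Rightarrow> ('a \<Rightarrow> real) \<Rightarrow> bool" where
  "usc_on S u \<longleftrightarrow> (\<forall>p\<in>S. \<forall>a>u p. \<forall>\<^sub>F q in at p within S. u q < a)"

definition lsc_on :: "'a::topological_space set \<Rightarrow> ('a \<Rightarrow> real) \<Rightarrow> bool" where
  "lsc_on S u \<longleftrightarrow> (\<forall>p\<in>S. \<forall>a<u p. \<forall>\<^sub>F q in at p within S. a < u q)"

text \<open>The filter below does not remove \<open>p\<close>, unlike \<open>at p within S\<close>. The upper and lower
  limits are taken in the extended reals; they are finite when \<open>u\<close> is locally bounded
  and \<open>p \<in> S\<close>.\<close>

definition upper_env :: "'a::topological_space set \<Rightarrow> ('a \<Rightarrow> real) \<Rightarrow> 'a \<Rightarrow> real" where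
  "upper_env S u p = real_of_ereal (Limsup (inf (nhds p) (principal S)) (\<lambda>q. ereal (u q)))"

definition lower_env :: "'a::topological_space set \<Rightarrow> ('a \<Rightarrow> real) \<Rightarrow> 'a \<Rightarrow> real" where
  "lower_env S u p = real_of_ereal (Liminf (inf (nhds p) (principal S)) (\<lambda>q. ereal (u q)))"


section \<open>Viscosity solutions\<close>

text \<open>Functions on $\mathbb{R}\times[0,+\infty)$ are total functions of the pair \<open>(x, t)\<close>
  whose values for \<open>t < 0\<close> are never used.\<close>

definition closed_domain :: "(real \<times> real) set" where
  "closed_domain = UNIV \<times> {0..}"

definition open_domain :: "(real \<times> real) set" where
  "open_domain = UNIV \<times> {0<..}"

definition C2_on :: "'a::real_normed_vector set \<Rightarrow> ('a \<Rightarrow> real) \<Rightarrow> bool" where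
  "C2_on S f \<longleftrightarrow>
     (\<exists>(f' :: 'a \<Rightarrow> 'a \<Rightarrow>\<^sub>L real) (f'' :: 'a \<Rightarrow> 'a \<Rightarrow>\<^sub>L 'a \<Rightarrow>\<^sub>L real).
        (\<forall>p\<in>S. (f has_derivative blinfun_apply (f' p)) (at p)) \<and>
        (\<forall>p\<in>S. (f' has_derivative blinfun_apply (f'' p)) (at p)) \<and>
        continuous_on S f'')"

text \<open>For continuous functions on an open set, being in $L^\infty$ means being bounded.\<close>

definition test_function :: "(real \<times> real \<Rightarrow> real) \<Rightarrow> bool" where
  "test_function \<phi> \<longleftrightarrow> C2_on open_domain \<phi> \<and> bounded (\<phi> ` open_domain)"

text \<open>The expression $\phi_t - \eta\,\phi_{xx} + |\phi_x|\,\Lambda^\alpha\phi$ at the point \<open>(x, t)\<close>.\<close>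

definition visc_op :: "real \<Rightarrow> real \<Rightarrow> (real \<times> real \<Rightarrow> real) \<Rightarrow> real \<Rightarrow> real \<Rightarrow> real" where
  "visc_op \<alpha> \<eta> \<phi> x t =
     deriv (\<lambda>s. \<phi> (x, s)) t
     - \<eta> * deriv (deriv (\<lambda>y. \<phi> (y, t))) x
     + \<bar>deriv (\<lambda>y. \<phi> (y, t)) x\<bar> * frac_lap \<alpha> (\<lambda>y. \<phi> (y, t)) x"

definition visc_subsolution :: "real \<Rightarrow> real \<Rightarrow> (real \<times> real \<Rightarrow> real) \<Rightarrow> bool" where
  "visc_subsolution \<alpha> \<eta> u \<longleftrightarrow>
     bounded (u ` closed_domain) \<and> usc_on closed_domain u \<and>
     (\<forall>x\<^sub>0 t\<^sub>0 \<tau> \<phi>. 0 < \<tau> \<and> \<tau> < t\<^sub>0 \<and> test_function \<phi> \<and>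
        (\<forall>x. \<forall>t\<in>{t\<^sub>0 - \<tau><..<t\<^sub>0 + \<tau>}. u (x, t) - \<phi> (x, t) \<le> u (x\<^sub>0, t\<^sub>0) - \<phi> (x\<^sub>0, t\<^sub>0))
        \<longrightarrow> visc_op \<alpha> \<eta> \<phi> x\<^sub>0 t\<^sub>0 \<le> 0)"

definition visc_supersolution :: "real \<Rightarrow> real \<Rightarrow> (real \<times> real \<Rightarrow> real) \<Rightarrow> bool" where
  "visc_supersolution \<alpha> \<eta> u \<longleftrightarrow>
     bounded (u ` closed_domain) \<and> lsc_on closed_domain u \<and>
     (\<forall>x\<^sub>0 t\<^sub>0 \<tau> \<phi>. 0 < \<tau> \<and> \<tau> < t\<^sub>0 \<and> test_function \<phi> \<and>
        (\<forall>x. \<forall>t\<in>{t\<^sub>0 - \<tau><..<t\<^sub>0 + \<tau>}. u (x\<^sub>0, t\<^sub>0) - \<phi> (x\<^sub>0, t\<^sub>0) \<le> u (x, t) - \<phi> (x, t))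
        \<longrightarrow> 0 \<le> visc_op \<alpha> \<eta> \<phi> x\<^sub>0 t\<^sub>0)"

definition ivp_subsolution ::
  "real \<Rightarrow> real \<Rightarrow> (real \<Rightarrow> real) \<Rightarrow> (real \<times> real \<Rightarrow> real) \<Rightarrow> bool" where
  "ivp_subsolution \<alpha> \<eta> u\<^sub>0 u \<longleftrightarrow>
     visc_subsolution \<alpha> \<eta> u \<and> (\<forall>x. u (x, 0) \<le> upper_env UNIV u\<^sub>0 x)"

definition ivp_supersolution ::
  "real \<Rightarrow> real \<Rightarrow> (real \<Rightarrow> real) \<Rightarrow> (real \<times> real \<Rightarrow> real) \<Rightarrow> bool" where
  "ivp_supersolution \<alpha> \<eta> u\<^sub>0 u \<longleftrightarrow>
     visc_supersolution \<alpha> \<eta> u \<and> (\<forall>x. lower_env UNIV u\<^sub>0 x \<le> u (x, 0))"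

definition ivp_solution ::
  "real \<Rightarrow> real \<Rightarrow> (real \<Rightarrow> real) \<Rightarrow> (real \<times> real \<Rightarrow> real) \<Rightarrow> bool" where
  "ivp_solution \<alpha> \<eta> u\<^sub>0 u \<longleftrightarrow>
     ivp_subsolution \<alpha> \<eta> u\<^sub>0 (upper_env closed_domain u) \<and>
     ivp_supersolution \<alpha> \<eta> u\<^sub>0 (lower_env closed_domain u)"

definition bounded_cont_solution ::
  "real \<Rightarrow> real \<Rightarrow> (real \<Rightarrow> real) \<Rightarrow> (real \<times> real \<Rightarrow> real) \<Rightarrow> bool" where
  "bounded_cont_solution \<alpha> \<eta> u\<^sub>0 u \<longleftrightarrow>
     bounded (u ` closed_domain) \<and> continuous_on closed_domain u \<and> ivp_solution \<alpha> \<eta> u\<^sub>0 u"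

definition BUC :: "(real \<Rightarrow> real) set" where
  "BUC = {f. bounded (range f) \<and> uniformly_continuous_on UNIV f}"


section \<open>Well-definedness of the constant\<close>

lemma schwartz_deriv:
  assumes "schwartz w"
  shows "((deriv ^^ n) w has_real_derivative (deriv ^^ Suc n) w x) (at x)"
proof -
  have "(deriv ^^ n) w differentiable at x" using assms by (simp add: schwartz_def)
  then show ?thesis by (simp add: DERIV_deriv_iff_real_differentiable)
qed

lemma schwartz_continuous:
  assumes "schwartz w" shows "continuous_on UNIV ((deriv ^^ n) w)"
  by (meson assms schwartz_deriv DERIV_isCont continuous_at_imp_continuous_on)

lemma schwartz_bound:
  assumes "schwartz w"
  obtains M where "0 < M" "\<And>x. \<bar>(deriv ^^ n) w x\<bar> \<le> M / (1 + x\<^sup>2)"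
proof -
  have "bounded (range (\<lambda>x. x ^ m * (deriv ^^ n) w x))" for m
    using assms by (simp add: schwartz_def)
  then have "\<exists>B>0. \<forall>x. \<bar>x ^ m * (deriv ^^ n) w x\<bar> \<le> B" for m
    unfolding bounded_pos by (auto simp: image_iff)
  then obtain A B where A: "A > 0" "\<And>x. \<bar>x ^ 0 * (deriv ^^ n) w x\<bar> \<le> A"
    and B: "B > 0" "\<And>x. \<bar>x ^ 2 * (deriv ^^ n) w x\<bar> \<le> B" by metis
  have "\<bar>(deriv ^^ n) w x\<bar> \<le> (A + B) / (1 + x\<^sup>2)" for x
  proof -
    have "\<bar>(deriv ^^ n) w x\<bar> * (1 + x\<^sup>2) \<le> A + B"
      using A(2)[of x] B(2)[of x] by (simp add: abs_mult algebra_simps)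
    then show ?thesis by (simp add: field_simps add_pos_nonneg)
  qed
  with A(1) B(1) show ?thesis by (intro that[of "A + B"]) auto
qed

lemma cauchy_density_integrable: "integrable lborel (\<lambda>x::real. 1 / (1 + x\<^sup>2))"
  using integrable_inverse_1_plus_square
  by (simp add: set_integrable_def einterval_def inverse_eq_divide)

lemma levy_weight_integrable:
  fixes \<alpha> :: real
  assumes "0 < \<alpha>" "\<alpha> < 2"
  shows "integrable lborel (\<lambda>z::real. (if \<bar>z\<bar> \<le> 1 then z\<^sup>2 else 1) / \<bar>z\<bar> powr (1 + \<alpha>))"
proof -
  define g where "g z = indicator {0..1::real} z * z powr (1 - \<alpha>) + indicator {1..} z * z powr (-1-\<alpha>)" for z
  have "(\<lambda>x. x powr (1 - \<alpha>)) absolutely_integrable_on {0..1::real}"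
    using has_integral_powr_from_0[of "1-\<alpha>" 1] assms
    by (intro nonnegative_absolutely_integrable_1) auto
  then have 1: "integrable lborel (\<lambda>z. indicator {0..1::real} z * z powr (1 - \<alpha>))"
    unfolding set_integrable_def by (subst (asm) integrable_completion) auto
  have "(\<lambda>x. x powr (-1 - \<alpha>)) absolutely_integrable_on {1..}"
    using has_integral_powr_to_inf[of "-1-\<alpha>" 1] assms
    by (intro nonnegative_absolutely_integrable_1) auto
  then have 2: "integrable lborel (\<lambda>z. indicator {1..} z * z powr (-1 - \<alpha>))"
    unfolding set_integrable_def by (subst (asm) integrable_completion) auto
  have g: "integrable lborel g" unfolding g_def using 1 2 by (rule Bochner_Integration.integrable_add)
  have g': "integrable lborel (\<lambda>z. g (- z))"
    using lborel_integrable_real_affine[OF g, of "-1" 0] by simp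
  have g0: "0 \<le> g z" for z by (simp add: g_def)
  have *: "(if z \<le> 1 then z\<^sup>2 else 1) / z powr (1 + \<alpha>) \<le> g z" if "z > 0" for z
  proof -
    have "z powr (1 - \<alpha>) = z\<^sup>2 / z powr (1 + \<alpha>)" 
      using that powr_diff[of z 2 "1+\<alpha>"] by (simp add: powr_numeral)
    moreover have "z powr (-1 - \<alpha>) = 1 / z powr (1 + \<alpha>)"
      using powr_minus[of z "1+\<alpha>"] by (simp add: inverse_eq_divide)
    ultimately show ?thesis using that by (auto simp: g_def indicator_def)
  qed
  show ?thesis
  proof (rule Bochner_Integration.integrable_bound[OF Bochner_Integration.integrable_add[OF g g']])
    have "norm ((if \<bar>z\<bar> \<le> 1 then z\<^sup>2 else 1) / \<bar>z\<bar> powr (1 + \<alpha>)) \<le> norm (g z + g (- z))" for z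
      using *[of z] *[of "-z"] g0[of z] g0[of "-z"]
      by (cases "z = 0"; cases "z > 0") (auto split: if_splits)
    then show "AE z in lborel. norm ((if \<bar>z\<bar> \<le> 1 then z\<^sup>2 else 1) / \<bar>z\<bar> powr (1 + \<alpha>)) \<le> norm (g z + g (- z))"
      by simp
  qed simp
qed

lemma schwartz_increment_bound:
  assumes "schwartz w"
  obtains M where "0 < M"
    "\<And>x z. \<bar>w (x + z) - w x - z * deriv w x * indicator {z. \<bar>z\<bar> \<le> 1} z\<bar>
       \<le> M * (1 / (1 + x\<^sup>2) + 1 / (1 + (x + z)\<^sup>2)) * (if \<bar>z\<bar> \<le> 1 then z\<^sup>2 else 1)"
proof -
  obtain A where A: "A > 0" "\<And>x. \<bar>(deriv ^^ 0) w x\<bar> \<le> A / (1 + x\<^sup>2)"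
    by (rule schwartz_bound[OF assms, of 0]) blast
  obtain B where B: "B > 0" "\<And>x. \<bar>(deriv ^^ 2) w x\<bar> \<le> B / (1 + x\<^sup>2)"
    by (rule schwartz_bound[OF assms, of 2]) blast
  let ?D = "\<lambda>x z. w (x + z) - w x - z * deriv w x * indicator {z. \<bar>z\<bar> \<le> 1} z"
  show ?thesis
  proof (rule that[of "A + 3 * B"])
    show "0 < A + 3 * B" using A B by simp
    fix x z :: real
    let ?p = "1 / (1 + x\<^sup>2)" and ?q = "1 / (1 + (x + z)\<^sup>2)"
    have pq: "0 \<le> ?p" "0 \<le> ?q" by (simp_all add: add_nonneg_nonneg)
    show "\<bar>?D x z\<bar> \<le> (A + 3 * B) * (?p + ?q) * (if \<bar>z\<bar> \<le> 1 then z\<^sup>2 else 1)"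
    proof (cases "\<bar>z\<bar> \<le> 1")
      case False
      then have "\<bar>?D x z\<bar> \<le> \<bar>w (x + z)\<bar> + \<bar>w x\<bar>" by simp
      also have "\<dots> \<le> A * (?p + ?q)" using A(2)[of x] A(2)[of "x + z"] by (simp add: distrib_left)
      also have "\<dots> \<le> (A + 3 * B) * (?p + ?q)" using pq B by (intro mult_right_mono) auto
      finally show ?thesis using False by simp
    next
      case True
      have "\<exists>t. \<bar>t - x\<bar> \<le> 1 \<and> w (x + z) = w x + deriv w x * z + (deriv ^^ 2) w t / 2 * z\<^sup>2"
      proof (cases z "0::real" rule: linorder_cases)
        case equal then show ?thesis by (intro exI[of _ x]) auto
      next
        case greater
        have "\<exists>t. x < t \<and> t < x + z \<and> w (x + z) =
           (\<Sum>m<2. ((deriv ^^ m) w x / fact m) * (x + z - x)^m) + ((deriv ^^ 2) w t / fact 2) * (x + z - x)^2"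
          using greater schwartz_deriv[OF assms]
          by (intro Taylor_up[where a = x]) auto
        then obtain t where "x < t" "t < x + z" "w (x + z) = w x + deriv w x * z + (deriv ^^ 2) w t / 2 * z\<^sup>2"
          by (auto simp: numeral_2_eq_2)
        then show ?thesis using True by (intro exI[of _ t]) auto
      next
        case less
        have "\<exists>t. x + z < t \<and> t < x \<and> w (x + z) =
           (\<Sum>m<2. ((deriv ^^ m) w x / fact m) * (x + z - x)^m) + ((deriv ^^ 2) w t / fact 2) * (x + z - x)^2"
          using less schwartz_deriv[OF assms]
          by (intro Taylor_down[where b = x]) auto
        then obtain t where "x + z < t" "t < x" "w (x + z) = w x + deriv w x * z + (deriv ^^ 2) w t / 2 * z\<^sup>2"
          by (auto simp: numeral_2_eq_2)
        then show ?thesis using True by (intro exI[of _ t]) auto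
      qed
      then obtain t where t: "\<bar>t - x\<bar> \<le> 1" "w (x + z) = w x + deriv w x * z + (deriv ^^ 2) w t / 2 * z\<^sup>2"
        by blast
      have "1 + x\<^sup>2 \<le> 3 * (1 + t\<^sup>2)"
      proof -
        have "(t - x)\<^sup>2 \<le> 1" using t(1) by (simp add: abs_square_le_1)
        moreover have "0 \<le> (2 * t - x)\<^sup>2" by simp
        ultimately have "x\<^sup>2 \<le> 2 + 2 * t\<^sup>2" by (simp add: power2_eq_square algebra_simps)
        then show ?thesis using zero_le_power2[of t] by (simp only: distrib_left)
      qed
      then have "1 / (1 + t\<^sup>2) \<le> 3 * ?p"
        by (simp add: field_simps add_pos_nonneg)
      then have "B * (1 / (1 + t\<^sup>2)) \<le> B * (3 * ?p)" using B by (intro mult_left_mono) auto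
      then have D2: "\<bar>(deriv ^^ 2) w t\<bar> \<le> 3 * B * ?p" using B(2)[of t] by (simp add: mult.commute)
      have "\<bar>?D x z\<bar> = \<bar>(deriv ^^ 2) w t\<bar> / 2 * z\<^sup>2" using True t(2) by (simp add: abs_mult)
      also have "\<dots> \<le> (A + 3 * B) * (?p + ?q) * z\<^sup>2"
      proof (intro mult_right_mono)
        have "\<bar>(deriv ^^ 2) w t\<bar> / 2 \<le> 3 * B * ?p" using D2 by linarith
        also have "\<dots> \<le> (A + 3 * B) * (?p + ?q)" using A B pq by (intro mult_mono) auto
        finally show "\<bar>(deriv ^^ 2) w t\<bar> / 2 \<le> (A + 3 * B) * (?p + ?q)" .
      qed simp
      finally show ?thesis using True by simp
    qed
  qed
qed

lemma schwartz_integrable_iexp: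
  assumes "schwartz w"
  shows "integrable lborel (\<lambda>x. iexp (- (x * \<xi>)) * complex_of_real ((deriv ^^ n) w x))"
proof -
  obtain M where M: "M > 0" "\<And>x. \<bar>(deriv ^^ n) w x\<bar> \<le> M / (1 + x\<^sup>2)"
    by (rule schwartz_bound[OF assms]) blast
  have [measurable]: "(deriv ^^ n) w \<in> borel_measurable borel"
    by (intro borel_measurable_continuous_onI schwartz_continuous assms)
  show ?thesis
    using M by (intro Bochner_Integration.integrable_bound[OF integrable_mult_right[OF cauchy_density_integrable, of M]])
       (auto simp: norm_mult add_pos_nonneg abs_of_pos)
qed

lemma iexp_bound_tendsto:
  assumes "schwartz w" "F = at_top \<or> F = at_bot"
  shows "((\<lambda>x. iexp (- (x * \<xi>)) * complex_of_real (w x)) \<longlongrightarrow> 0) F"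
proof -
  obtain M where M: "M > 0" "\<And>x. \<bar>(deriv ^^ 0) w x\<bar> \<le> M / (1 + x\<^sup>2)"
    by (rule schwartz_bound[OF assms(1)]) blast
  have "((\<lambda>x. M / (1 + x\<^sup>2)) \<longlongrightarrow> 0) at_top" "((\<lambda>x. M / (1 + x\<^sup>2)) \<longlongrightarrow> 0) at_bot" by real_asymp+
  then have "((\<lambda>x. M / (1 + x\<^sup>2)) \<longlongrightarrow> 0) F" using assms(2) by auto
  then show ?thesis
    by (rule Lim_null_comparison[rotated]) (use M in \<open>auto simp: norm_mult\<close>)
qed

lemma fourier_deriv:
  assumes "schwartz w"
  shows "fourier (deriv w) \<xi> = \<i> * \<xi> * fourier w \<xi>"
proof -
  let ?F = "\<lambda>x. iexp (- (x * \<xi>)) * complex_of_real (w x)"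
  let ?f = "\<lambda>x. - (\<i> * \<xi>) * (iexp (- (x * \<xi>)) * complex_of_real (w x)) + iexp (- (x * \<xi>)) * complex_of_real (deriv w x)"
  have i0: "integrable lborel ?F" using schwartz_integrable_iexp[OF assms, of \<xi> 0] by simp
  have i1: "integrable lborel (\<lambda>x. iexp (- (x * \<xi>)) * complex_of_real (deriv w x))"
    using schwartz_integrable_iexp[OF assms, of \<xi> 1] by simp
  have c0: "isCont w x" and c1: "isCont (deriv w) x" for x
    using schwartz_continuous[OF assms, of 0] schwartz_continuous[OF assms, of 1]
    by (auto simp: continuous_on_eq_continuous_at)
  have "(LBINT x=-\<infinity>..\<infinity>. ?f x) = 0 - 0"
  proof (rule interval_integral_FTC_integrable[where F = ?F])
    fix x :: real
    have "(w has_vector_derivative deriv w x) (at x)"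
      using schwartz_deriv[OF assms, of 0] by (simp add: has_real_derivative_iff_has_vector_derivative)
    then have w: "((\<lambda>x. complex_of_real (w x)) has_vector_derivative complex_of_real (deriv w x)) (at x)"
      by (rule bounded_linear.has_vector_derivative[OF bounded_linear_of_real])
    have e: "((\<lambda>x. iexp (- (x * \<xi>))) has_vector_derivative - (\<i> * \<xi>) * iexp (- (x * \<xi>))) (at x)"
      by (rule derivative_eq_intros has_vector_derivative_real_field | simp add: field_simps)+
    show "(?F has_vector_derivative ?f x) (at x)"
      by (rule has_vector_derivative_eq_rhs, rule has_vector_derivative_mult[OF e w]) (simp add: algebra_simps)
    show "isCont ?f x" using c0 c1 by (intro continuous_intros) auto
  next
    show "set_integrable lborel (einterval (-\<infinity>) \<infinity>) ?f"
      unfolding set_integrable_def einterval_def using i0 i1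
      by (simp add: Bochner_Integration.integrable_add)
    show "((?F \<circ> real_of_ereal) \<longlongrightarrow> 0) (at_right (-\<infinity>))"
      using iexp_bound_tendsto[OF assms, of at_bot \<xi>] unfolding ereal_tendsto_simps by simp
    show "((?F \<circ> real_of_ereal) \<longlongrightarrow> 0) (at_left \<infinity>)"
      using iexp_bound_tendsto[OF assms, of at_top \<xi>] unfolding ereal_tendsto_simps by simp
  qed simp
  then have "(LINT x|lborel. ?f x) = 0"
    by (simp add: interval_lebesgue_integral_def set_lebesgue_integral_def einterval_def)
  also have "(LINT x|lborel. ?f x) = - (\<i> * \<xi>) * fourier w \<xi> + fourier (deriv w) \<xi>"
    unfolding fourier_def using i0 i1 by (subst Bochner_Integration.integral_add) simp_all
  finally show ?thesis by (simp add: algebra_simps add_eq_0_iff)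
qed

lemma fourier_shift:
  assumes "schwartz w"
  shows "(LINT x|lborel. iexp (- (x * \<xi>)) * complex_of_real (w (x + z))) = iexp (z * \<xi>) * fourier w \<xi>"
    and "integrable lborel (\<lambda>x. iexp (- (x * \<xi>)) * complex_of_real (w (x + z)))"
proof -
  have i0: "integrable lborel (\<lambda>x. iexp (- (x * \<xi>)) * complex_of_real (w x))"
    using schwartz_integrable_iexp[OF assms, of \<xi> 0] by simp
  have eq: "iexp (- (x * \<xi>)) * complex_of_real (w (x + z)) =
     iexp (z * \<xi>) * (iexp (- ((z + 1 * x) * \<xi>)) * complex_of_real (w (z + 1 * x)))" for x
  proof -
    have "iexp (- (x * \<xi>)) = iexp (z * \<xi>) * iexp (- ((z + 1 * x) * \<xi>))"
      by (simp add: mult_exp_exp algebra_simps)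
    then show ?thesis by (simp only: mult.assoc mult_1 add.commute)
  qed
  show "integrable lborel (\<lambda>x. iexp (- (x * \<xi>)) * complex_of_real (w (x + z)))"
    unfolding eq by (intro integrable_mult_right lborel_integrable_real_affine i0) simp
  show "(LINT x|lborel. iexp (- (x * \<xi>)) * complex_of_real (w (x + z))) = iexp (z * \<xi>) * fourier w \<xi>"
    unfolding eq fourier_def
    using lborel_integral_real_affine[of 1 "\<lambda>x. iexp (- (x * \<xi>)) * complex_of_real (w x)" z]
    by simp
qed

definition levy_symbol :: "real \<Rightarrow> real \<Rightarrow> real \<Rightarrow> complex" where
  "levy_symbol \<alpha> \<xi> z =
     (iexp (z * \<xi>) - 1 - z * (\<i> * \<xi>) * of_real (indicator {z. \<bar>z\<bar> \<le> 1} z)) / of_real (\<bar>z\<bar> powr (1 + \<alpha>))"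

lemma fourier_levy_integral:
  assumes w: "schwartz w" and \<alpha>: "0 < \<alpha>" "\<alpha> < 2"
  shows "fourier (levy_integral \<alpha> w) \<xi> = (LINT z|lborel. levy_symbol \<alpha> \<xi> z * fourier w \<xi>)"
    and "integrable lborel (\<lambda>z. levy_symbol \<alpha> \<xi> z * fourier w \<xi>)"
proof -
  obtain M where M: "0 < M"
    "\<And>x z. \<bar>w (x + z) - w x - z * deriv w x * indicator {z. \<bar>z\<bar> \<le> 1} z\<bar>
       \<le> M * (1 / (1 + x\<^sup>2) + 1 / (1 + (x + z)\<^sup>2)) * (if \<bar>z\<bar> \<le> 1 then z\<^sup>2 else 1)"
    by (rule schwartz_increment_bound[OF w]) blast
  have mw: "(deriv ^^ n) w \<in> borel_measurable borel" for n
    by (intro borel_measurable_continuous_onI schwartz_continuous w)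
  have [measurable]: "w \<in> borel_measurable borel" "deriv w \<in> borel_measurable borel"
    using mw[of 0] mw[of 1] by simp_all
  define h where "h z = (if \<bar>z\<bar> \<le> 1 then z\<^sup>2 else 1) / \<bar>z\<bar> powr (1 + \<alpha>)" for z :: real
  have h: "integrable lborel h" unfolding h_def by (rule levy_weight_integrable[OF \<alpha>])
  have h0: "0 \<le> h z" for z by (simp add: h_def)
  define d where "d z x = w (x + z) - w x - z * deriv w x * indicator {z. \<bar>z\<bar> \<le> 1} z" for z x
  define f where "f z x = iexp (- (x * \<xi>)) * complex_of_real (d z x / \<bar>z\<bar> powr (1 + \<alpha>))" for z x
  have f_meas: "case_prod f \<in> borel_measurable (lborel \<Otimes>\<^sub>M lborel)"
    unfolding f_def d_def by measurable
  let ?c = "\<lambda>x::real. 1 / (1 + x\<^sup>2)"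
  have c_shift: "integrable lborel (\<lambda>x. ?c (x + z))" "(LINT x|lborel. ?c (x + z)) = (LINT x|lborel. ?c x)" for z
    using lborel_integrable_real_affine[OF cauchy_density_integrable, of 1 z]
      lborel_integral_real_affine[of 1 ?c z] by (simp_all add: add.commute)
  have nf: "norm (f z x) \<le> M * h z * (?c x + ?c (x + z))" for z x
  proof -
    have "norm (f z x) = \<bar>d z x\<bar> / \<bar>z\<bar> powr (1 + \<alpha>)" by (simp add: f_def norm_mult norm_divide)
    also have "\<dots> \<le> M * (?c x + ?c (x + z)) * (if \<bar>z\<bar> \<le> 1 then z\<^sup>2 else 1) / \<bar>z\<bar> powr (1 + \<alpha>)"
      unfolding d_def by (intro divide_right_mono M) simp
    finally show ?thesis by (simp only: h_def times_divide_eq_right times_divide_eq_left mult.assoc mult.commute mult.left_commute)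
  qed
  have dom: "integrable lborel (\<lambda>x. M * h z * (?c x + ?c (x + z)))" for z
    by (intro integrable_mult_right Bochner_Integration.integrable_add cauchy_density_integrable c_shift)
  have f_int: "integrable lborel (f z)" for z
  proof (rule Bochner_Integration.integrable_bound[OF dom[of z]])
    show "f z \<in> borel_measurable lborel" unfolding f_def d_def by measurable
    have "norm (f z x) \<le> norm (M * h z * (?c x + ?c (x + z)))" for x
      using nf[of z x] abs_ge_self order_trans unfolding real_norm_def by blast
    then show "AE x in lborel. norm (f z x) \<le> norm (M * h z * (?c x + ?c (x + z)))" by simp
  qed
  have bound: "(LINT x|lborel. norm (f z x)) \<le> 2 * M * (LINT x|lborel. ?c x) * h z" for z
  proof -
    have "(LINT x|lborel. norm (f z x)) \<le> (LINT x|lborel. M * h z * (?c x + ?c (x + z)))"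
      by (intro integral_mono nf dom integrable_norm f_int)
    also have "\<dots> = 2 * M * (LINT x|lborel. ?c x) * h z"
      using c_shift[of z] cauchy_density_integrable by simp
    finally show ?thesis .
  qed
  interpret lborel_pair: pair_sigma_finite lborel lborel ..
  have "integrable lborel (\<lambda>z. LINT x|lborel. norm (f z x))"
  proof (rule Bochner_Integration.integrable_bound[OF integrable_mult_right[OF h, of "2 * M * (LINT x|lborel. ?c x)"]])
    have "(\<lambda>(z, x). norm (f z x)) \<in> borel_measurable (lborel \<Otimes>\<^sub>M lborel)"
      using f_meas by (simp add: case_prod_beta')
    then show "(\<lambda>z. LINT x|lborel. norm (f z x)) \<in> borel_measurable lborel"
      by (rule lborel.borel_measurable_lebesgue_integral)
    have "norm (LINT x|lborel. norm (f z x)) \<le> norm (2 * M * (LINT x|lborel. ?c x) * h z)" for z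
      using order_trans[OF bound[of z] abs_ge_self] by (simp add: Bochner_Integration.integral_nonneg)
    then show "AE z in lborel. norm (LINT x|lborel. norm (f z x)) \<le> norm (2 * M * (LINT x|lborel. ?c x) * h z)"
      by simp
  qed
  then have F: "integrable (lborel \<Otimes>\<^sub>M lborel) (case_prod f)"
    by (intro lborel_pair.Fubini_integrable f_meas) (simp_all add: f_int)
  have inner: "(LINT x|lborel. f z x) = levy_symbol \<alpha> \<xi> z * fourier w \<xi>" for z
  proof -
    let ?e = "\<lambda>x. iexp (- (x * \<xi>))"
    have i0: "integrable lborel (\<lambda>x. ?e x * of_real (w x))"
      and i1: "integrable lborel (\<lambda>x. ?e x * of_real (deriv w x))"
      using schwartz_integrable_iexp[OF w, of \<xi> 0] schwartz_integrable_iexp[OF w, of \<xi> 1] by simp_all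
    have "f z x = (?e x * of_real (w (x + z)) - ?e x * of_real (w x)
        - of_real (z * indicator {z. \<bar>z\<bar> \<le> 1} z) * (?e x * of_real (deriv w x))) / of_real (\<bar>z\<bar> powr (1 + \<alpha>))" for x
      by (simp add: f_def d_def diff_divide_distrib algebra_simps)
    then have "(LINT x|lborel. f z x) = ((LINT x|lborel. ?e x * of_real (w (x + z))) - (LINT x|lborel. ?e x * of_real (w x))
        - of_real (z * indicator {z. \<bar>z\<bar> \<le> 1} z) * (LINT x|lborel. ?e x * of_real (deriv w x))) / of_real (\<bar>z\<bar> powr (1 + \<alpha>))"
      using i0 i1 fourier_shift(2)[OF w, of \<xi> z]
      by (simp only: integral_divide_zero integral_mult_right_zero Bochner_Integration.integral_diff
          Bochner_Integration.integrable_diff integrable_mult_right)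
    then have "(LINT x|lborel. f z x) = (iexp (z * \<xi>) * fourier w \<xi> - fourier w \<xi>
        - of_real (z * indicator {z. \<bar>z\<bar> \<le> 1} z) * fourier (deriv w) \<xi>) / of_real (\<bar>z\<bar> powr (1 + \<alpha>))"
      by (simp only: fourier_shift(1)[OF w] fourier_def[symmetric])
    then show ?thesis by (simp add: levy_symbol_def fourier_deriv[OF w] algebra_simps)
  qed
  have "fourier (levy_integral \<alpha> w) \<xi> = (LINT x|lborel. LINT z|lborel. f z x)"
    unfolding f_def integral_mult_right_zero integral_complex_of_real
    by (simp only: fourier_def levy_integral_def d_def)
  also have "\<dots> = (LINT z|lborel. LINT x|lborel. f z x)"
    by (rule lborel_pair.Fubini_integral[OF F])
  also have "\<dots> = (LINT z|lborel. levy_symbol \<alpha> \<xi> z * fourier w \<xi>)" by (simp add: inner)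
  finally show "fourier (levy_integral \<alpha> w) \<xi> = (LINT z|lborel. levy_symbol \<alpha> \<xi> z * fourier w \<xi>)" .
  show "integrable lborel (\<lambda>z. levy_symbol \<alpha> \<xi> z * fourier w \<xi>)"
    using lborel_pair.integrable_fst'[OF F] by (simp add: inner)
qed

lemma levy_symbol_integral:
  assumes "integrable lborel (levy_symbol \<alpha> \<xi>)"
  shows "integrable lborel (\<lambda>z. (1 - cos (z * \<xi>)) / \<bar>z\<bar> powr (1 + \<alpha>))"
    and "(LINT z|lborel. levy_symbol \<alpha> \<xi> z) =
       - of_real (\<bar>\<xi>\<bar> powr \<alpha> * (LINT z|lborel. (1 - cos z) / \<bar>z\<bar> powr (1 + \<alpha>)))"
proof -
  let ?k = "\<lambda>z. (1 - cos (z * \<xi>)) / \<bar>z\<bar> powr (1 + \<alpha>)"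
  let ?k1 = "\<lambda>z. (1 - cos z) / \<bar>z\<bar> powr (1 + \<alpha>)"
  have Re: "Re (levy_symbol \<alpha> \<xi> z) = - ?k z" for z
    by (simp add: levy_symbol_def Re_exp diff_divide_distrib)
  have "integrable lborel (\<lambda>z. - Re (levy_symbol \<alpha> \<xi> z))" using assms by simp
  then show "integrable lborel ?k" by (simp add: Re)
  have flip: "(LINT z|lborel. levy_symbol \<alpha> \<xi> z) = (LINT z|lborel. levy_symbol \<alpha> \<xi> (- z))"
    using lborel_integral_real_affine[of "-1" "levy_symbol \<alpha> \<xi>" 0] by simp
  have iflip: "integrable lborel (\<lambda>z. levy_symbol \<alpha> \<xi> (- z))"
    using lborel_integrable_real_affine[OF assms, of "-1" 0] by simp
  have sum: "levy_symbol \<alpha> \<xi> z + levy_symbol \<alpha> \<xi> (- z) = of_real (- 2 * ?k z)" for z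
    by (rule complex_eqI) (auto simp: levy_symbol_def Re_exp Im_exp add_divide_distrib diff_divide_distrib indicator_def)
  have "2 * (LINT z|lborel. levy_symbol \<alpha> \<xi> z) = (LINT z|lborel. levy_symbol \<alpha> \<xi> z + levy_symbol \<alpha> \<xi> (- z))"
    using Bochner_Integration.integral_add[OF assms iflip] flip by simp
  also have "\<dots> = of_real (- 2 * (LINT z|lborel. ?k z))"
    unfolding sum integral_complex_of_real by (simp only: integral_mult_right_zero)
  also have "(LINT z|lborel. ?k z) = \<bar>\<xi>\<bar> powr \<alpha> * (LINT z|lborel. ?k1 z)"
  proof (cases "\<xi> = 0")
    case False
    have "?k1 (0 + \<xi> * z) = \<bar>\<xi>\<bar> powr (- 1 - \<alpha>) * ?k z" for z
    proof -
      have "\<bar>\<xi> * z\<bar> powr (1 + \<alpha>) = \<bar>\<xi>\<bar> powr (1 + \<alpha>) * \<bar>z\<bar> powr (1 + \<alpha>)"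
        by (simp add: abs_mult powr_mult)
      moreover have "\<bar>\<xi>\<bar> powr (- 1 - \<alpha>) = 1 / \<bar>\<xi>\<bar> powr (1 + \<alpha>)"
        using powr_minus[of "\<bar>\<xi>\<bar>" "1 + \<alpha>"] by (simp add: inverse_eq_divide)
      ultimately show ?thesis by (simp add: mult.commute)
    qed
    then have "(LINT z|lborel. ?k1 z) = \<bar>\<xi>\<bar> * (\<bar>\<xi>\<bar> powr (- 1 - \<alpha>) * (LINT z|lborel. ?k z))"
      using lborel_integral_real_affine[OF False, of ?k1 0] by (simp only: integral_mult_right_zero real_scaleR_def)
    also have "\<dots> = \<bar>\<xi>\<bar> powr (- \<alpha>) * (LINT z|lborel. ?k z)"
      using False powr_mult_base[of "\<bar>\<xi>\<bar>" "- 1 - \<alpha>"] by (simp add: mult.assoc[symmetric])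
    finally show ?thesis using False by (simp add: powr_minus field_simps)
  qed simp
  finally show "(LINT z|lborel. levy_symbol \<alpha> \<xi> z) = - of_real (\<bar>\<xi>\<bar> powr \<alpha> * (LINT z|lborel. ?k1 z))"
    by (simp add: mult.commute)
qed

lemma schwartz_gauss: "schwartz std_normal_density"
proof -
  let ?g = std_normal_density
  have d: "(?g has_real_derivative - x * ?g x) (at x)" for x
    unfolding normal_density_def by (auto intro!: derivative_eq_intros simp: field_simps power2_eq_square)
  have *: "\<exists>p. (deriv ^^ n) ?g = (\<lambda>x. poly p x * ?g x)" for n
  proof (induction n)
    case 0 show ?case by (intro exI[of _ 1]) (simp add: fun_eq_iff)
  next
    case (Suc n)
    then obtain p where p: "(deriv ^^ n) ?g = (\<lambda>x. poly p x * ?g x)" by blast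
    have "((\<lambda>x. poly p x * ?g x) has_real_derivative poly (pderiv p - [:0, 1:] * p) x * ?g x) (at x)" for x
      by (rule DERIV_cong[OF DERIV_mult[OF poly_DERIV d]]) (simp add: algebra_simps)
    then have "(deriv ^^ Suc n) ?g = (\<lambda>x. poly (pderiv p - [:0, 1:] * p) x * ?g x)"
      by (simp add: p fun_eq_iff DERIV_imp_deriv)
    then show ?case by blast
  qed
  have bp: "bounded (range (\<lambda>x. poly p x * ?g x))" for p
  proof -
    have m: "bounded (range (\<lambda>x. x ^ k * ?g x))" for k
    proof -
      have "\<bar>x ^ k * ?g x\<bar> \<le> ?g 0 * (1 + 2 ^ k * fact k)" for x
      proof -
        have "(x\<^sup>2 / 2) ^ k / fact k \<le> exp (x\<^sup>2 / 2)"
        proof -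
          have "(x\<^sup>2 / 2) ^ k / fact k \<le> (\<Sum>n. (x\<^sup>2 / 2) ^ n /\<^sub>R fact n)"
            using sum_le_suminf[OF summable_exp_generic[of "x\<^sup>2 / 2"], of "{k}"]
            by (simp add: field_simps)
          then show ?thesis by (simp add: exp_def)
        qed
        then have a: "x ^ (2 * k) * exp (- (x\<^sup>2 / 2)) \<le> 2 ^ k * fact k"
          by (simp add: exp_minus field_simps power_mult[symmetric])
        have "\<bar>x\<bar> ^ k \<le> 1 + x ^ (2 * k)"
        proof (cases "\<bar>x\<bar> \<le> 1")
          case True
          then have "\<bar>x\<bar> ^ k \<le> 1" by (simp add: power_le_one)
          moreover have "0 \<le> x ^ (2 * k)" by simp
          ultimately show ?thesis by linarith
        next
          case False
          then have "\<bar>x\<bar> ^ k \<le> \<bar>x\<bar> ^ (2 * k)" by (intro power_increasing) auto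
          then show ?thesis by (simp add: power_even_abs)
        qed
        then have "\<bar>x\<bar> ^ k * exp (- (x\<^sup>2 / 2)) \<le> (1 + x ^ (2 * k)) * exp (- (x\<^sup>2 / 2))"
          by (intro mult_right_mono) auto
        also have "\<dots> \<le> 1 + 2 ^ k * fact k" using a by (simp add: distrib_right add_mono)
        finally have "?g 0 * (\<bar>x\<bar> ^ k * exp (- (x\<^sup>2 / 2))) \<le> ?g 0 * (1 + 2 ^ k * fact k)"
          by (intro mult_left_mono) auto
        then show ?thesis by (simp add: normal_density_def abs_mult power_abs)
      qed
      then show ?thesis unfolding bounded_iff by (intro exI) (auto simp del: abs_mult)
    qed
    have c: "bounded (range (\<lambda>x. coeff p i *\<^sub>R (x ^ i * ?g x)))" for i
      using bounded_scaling[OF m[of i], of "coeff p i"] by (simp add: image_image)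
    have "bounded (range (\<lambda>x. \<Sum>i\<in>I. coeff p i *\<^sub>R (x ^ i * ?g x)))" if "finite I" for I
      using that by (induction I rule: finite_induct) (auto intro!: bounded_plus_comp c simp del: real_scaleR_def)
    then have "bounded (range (\<lambda>x. \<Sum>i\<le>degree p. coeff p i *\<^sub>R (x ^ i * ?g x)))" by simp
    then show ?thesis by (simp add: poly_altdef sum_distrib_right mult.assoc)
  qed
  show ?thesis
    unfolding schwartz_def
  proof (intro conjI allI)
    fix n m :: nat and x :: real
    obtain p where p: "(deriv ^^ n) ?g = (\<lambda>x. poly p x * ?g x)" using * by blast
    show "(deriv ^^ n) ?g differentiable at x"
      unfolding p using DERIV_mult[OF poly_DERIV d] real_differentiable_def by blast
    show "bounded (range (\<lambda>x. x ^ m * (deriv ^^ n) ?g x))"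
      using bp[of "monom 1 m * p"] by (simp add: p poly_monom mult.assoc)
  qed
qed

lemma fourier_gauss: "fourier std_normal_density \<xi> \<noteq> 0"
proof -
  have "fourier std_normal_density \<xi> = char std_normal_distribution (- \<xi>)"
    unfolding fourier_def char_def by (subst integral_density) (auto simp: scaleR_conv_of_real mult.commute)
  then show ?thesis by (simp add: char_std_normal_distribution)
qed

lemma levy_mass_pos:
  fixes \<alpha> :: real
  assumes "0 < \<alpha>" "\<alpha> < 2"
  shows "0 < (LINT z|lborel. (1 - cos z) / \<bar>z\<bar> powr (1 + \<alpha>))"
proof -
  let ?k = "\<lambda>z::real. (1 - cos z) / \<bar>z\<bar> powr (1 + \<alpha>)"
  have "integrable lborel (levy_symbol \<alpha> 1)"
    using fourier_levy_integral(2)[OF schwartz_gauss assms, of 1, THEN integrable_divide_zero[where c = "fourier std_normal_density 1"]]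
      fourier_gauss[of 1] by simp
  from levy_symbol_integral(1)[OF this] have k: "integrable lborel ?k" by simp
  have k0: "0 \<le> ?k z" for z by simp
  have "(LINT z|lborel. ?k z) \<noteq> 0"
  proof
    assume "(LINT z|lborel. ?k z) = 0"
    then have "AE z in lborel. ?k z = 0" using integral_nonneg_eq_0_iff_AE[OF k] k0 by simp
    then have "AE z in lborel. z \<notin> {0<..<1::real}"
    proof eventually_elim
      case (elim z)
      show ?case
      proof
        assume z: "z \<in> {0<..<1::real}"
        then have "cos z < cos 0" using pi_gt3 by (intro cos_monotone_0_pi) auto
        with elim z show False by simp
      qed
    qed
    then have "emeasure lborel {0<..<1::real} = 0"
      by (subst (asm) AE_iff_measurable[of "{0<..<1::real}"]) auto
    then show False by simp
  qed
  then show ?thesis using Bochner_Integration.integral_nonneg[of lborel ?k] k0 by (simp add: order_less_le)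
qed

theorem levy_const_well_defined:
  assumes "0 < \<alpha>" "\<alpha> < 2"
  shows "levy_const \<alpha> = 1 / (LINT z|lborel. (1 - cos z) / \<bar>z\<bar> powr (1 + \<alpha>))"
    and "0 < levy_const \<alpha>"
    and "schwartz w \<Longrightarrow> fourier (frac_lap \<alpha> w) \<xi> = of_real (\<bar>\<xi>\<bar> powr \<alpha>) * fourier w \<xi>"
proof -
  define K where "K = (LINT z|lborel. (1 - cos z) / \<bar>z\<bar> powr (1 + \<alpha>))"
  have K: "0 < K" unfolding K_def by (rule levy_mass_pos[OF assms])
  have L: "fourier (\<lambda>x. - (c * levy_integral \<alpha> w x)) \<xi> = of_real (c * K) * (of_real (\<bar>\<xi>\<bar> powr \<alpha>) * fourier w \<xi>)"
    if w: "schwartz w" for c w \<xi>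
  proof -
    have "fourier (\<lambda>x. - (c * levy_integral \<alpha> w x)) \<xi> =
       (LINT x|lborel. of_real (- c) * (iexp (- (x * \<xi>)) * of_real (levy_integral \<alpha> w x)))"
      unfolding fourier_def by (simp add: algebra_simps)
    also have "\<dots> = of_real (- c) * fourier (levy_integral \<alpha> w) \<xi>"
      unfolding fourier_def by (rule integral_mult_right_zero)
    also have "fourier (levy_integral \<alpha> w) \<xi> = - of_real (\<bar>\<xi>\<bar> powr \<alpha> * K) * fourier w \<xi>"
    proof (cases "fourier w \<xi> = 0")
      case True
      then show ?thesis using fourier_levy_integral(1)[OF w assms, of \<xi>] by simp
    next
      case False
      then have "integrable lborel (levy_symbol \<alpha> \<xi>)"
        using fourier_levy_integral(2)[OF w assms, of \<xi>, THEN integrable_divide_zero[where c = "fourier w \<xi>"]] by simp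
      then show ?thesis
        using fourier_levy_integral(1)[OF w assms, of \<xi>] levy_symbol_integral(2) by (simp add: K_def)
    qed
    finally show ?thesis by simp
  qed
  have eq: "levy_const \<alpha> = 1 / K"
    unfolding levy_const_def
  proof (rule the_equality)
    show "0 < 1 / K \<and> (\<forall>w. schwartz w \<longrightarrow>
        (\<forall>\<xi>. fourier (\<lambda>x. - (1 / K * levy_integral \<alpha> w x)) \<xi> = of_real (\<bar>\<xi>\<bar> powr \<alpha>) * fourier w \<xi>))"
      using K L[where c = "1 / K"] by simp
  next
    fix c assume "0 < c \<and> (\<forall>w. schwartz w \<longrightarrow>
        (\<forall>\<xi>. fourier (\<lambda>x. - (c * levy_integral \<alpha> w x)) \<xi> = of_real (\<bar>\<xi>\<bar> powr \<alpha>) * fourier w \<xi>))"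
    then have "of_real (c * K) * (of_real (\<bar>1\<bar> powr \<alpha>) * fourier std_normal_density 1) = of_real (\<bar>1\<bar> powr \<alpha>) * fourier std_normal_density 1"
      using L[OF schwartz_gauss, of c 1] schwartz_gauss by simp
    then have "complex_of_real (c * K) = 1" using fourier_gauss[of 1] by simp
    then have "c * K = 1" by (metis of_real_eq_1_iff)
    then show "c = 1 / K" using K by (simp add: field_simps)
  qed
  then show "levy_const \<alpha> = 1 / (LINT z|lborel. (1 - cos z) / \<bar>z\<bar> powr (1 + \<alpha>))" by (simp add: K_def)
  show "0 < levy_const \<alpha>" using eq K by simp
  show "fourier (frac_lap \<alpha> w) \<xi> = of_real (\<bar>\<xi>\<bar> powr \<alpha>) * fourier w \<xi>" if "schwartz w"
    using L[OF that, of "1 / K" \<xi>] K by (simp add: frac_lap_def[abs_def] eq)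
qed

end

theory Submission
  imports Defs
begin

text \<open>
  The proof avoids the Crandall--Ishii lemma and Perron's method. The nonlinearity
  \<open>- \<bar>u\<^sub>x\<bar> \<Lambda>\<^sup>\<alpha> u\<close> is discretised by an upwind scheme in which the Levy measure is truncated near \<open>0\<close>;
  explicit Euler steps for it are monotone, commute with translations and constants, and hence are
  contractions for the supremum norm that preserve the modulus of continuity of \<open>u\<^sub>0\<close>. A double local average of
  the scheme is \<open>C\<^sup>2\<close> in space and solves the discretised equation up to an arbitrarily small error.

  Such an approximation \<open>W\<close> is compared with a viscosity subsolution \<open>u\<close> by doubling variables. Moving \<open>x\<close> and \<open>y\<close>
  together keeps \<open>(x - y)\<^sup>2\<close> constant, so at a maximum of \<open>u(x,t) - W(y,s) - a (x - y)\<^sup>2 - g (t - s)\<^sup>2 - \<dots>\<close> a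
  translate of \<open>W\<close> touches \<open>u\<close> from above, which settles the second order term; moving \<open>x\<close> alone bounds
  \<open>u\<close> by a parabola that does not depend on the scheme, which controls the singular part of the Levy integral.
  Testing with the minimum of the two gives \<open>u \<le> W + error\<close>. As the approximations are themselves
  subsolutions up to small errors, they form a Cauchy family. Their limit is a solution by stability, and every
  other solution lies below and above it.
\<close>

text \<open>The obstacle is that no regularity of the approximations is uniform in \<delta>: neither
  their second space derivative nor their Lipschitz constant in time is controlled as \<delta> tends
  to 0. Neither survives in the comparison. The second derivative enters the inequality for u and
  the one for W with the same coefficient and cancels; so does the time slope 2 g (t - s), hence g
  may depend on the Lipschitz constant. What remains is the nonlocal term, and there the test
  function lies between two parabolas with coefficient \<open>a\<close>: the upper one from moving x
  alone, the lower one from moving y alone. Since \<open>a\<close> is fixed by the bound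
  \<open>M\<close>, the tolerated error and the modulus of \<open>u\<^sub>0\<close>, the consistency
  error of the scheme is small on a class of functions known before \<delta> is chosen. The size
  \<open>k\<close> of the penalty that localises in space is fitted to those same constants. The
  nonlinearity is odd under negation of u, so every statement on supersolutions is the one on
  subsolutions for the negated function.\<close>

section \<open>Upwind flux and auxiliary functions\<close>

text \<open>Upwind discretisation of \<open>c \<bar>p\<bar>\<close>, where \<open>a\<close> and \<open>b\<close> stand for the difference quotients approximating \<open>p\<close> and \<open>- p\<close>.\<close>

definition flux :: "real \<Rightarrow> real \<Rightarrow> real \<Rightarrow> real" where
  "flux c a b = max c 0 * max (max a b) 0 - max (- c) 0 * max (max (- a) (- b)) 0"

lemma flux_mono:
  assumes "c \<le> c'" "a \<le> a'" "b \<le> b'"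
  shows "flux c a b \<le> flux c' a' b'"
  unfolding flux_def using assms by (intro diff_mono mult_mono) auto

text \<open>Negation swaps the two branches of the upwind switch. This oddness passes to
  \<open>nonlin\<close> and later turns supersolutions into negated subsolutions.\<close>

lemma flux_uminus: "flux (- c) (- a) (- b) = - flux c a b"
  by (simp add: flux_def)

lemma flux_zero [simp]: "flux c 0 0 = 0"
  by (simp add: flux_def)

lemma abs_mult_diff_le:
  fixes a b c d :: real
  assumes "\<bar>a - c\<bar> \<le> k" "\<bar>b - d\<bar> \<le> l" "\<bar>b\<bar> \<le> S" "\<bar>c\<bar> \<le> R"
  shows "\<bar>a * b - c * d\<bar> \<le> k * S + R * l"
proof -
  have "a * b - c * d = (a - c) * b + c * (b - d)" by (simp add: algebra_simps)
  then have "\<bar>a * b - c * d\<bar> \<le> \<bar>a - c\<bar> * \<bar>b\<bar> + \<bar>c\<bar> * \<bar>b - d\<bar>"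
    by (metis abs_mult abs_triangle_ineq)
  also have "\<dots> \<le> k * S + R * l"
    using assms abs_ge_zero[of "a - c"] abs_ge_zero[of c]
    by (intro add_mono mult_mono) (auto intro: order_trans[OF abs_ge_zero])
  finally show ?thesis .
qed

text \<open>Positive parts and maxima are 1-Lipschitz, so each product changes by at most
  \<open>k * S + R * l\<close>; the second product is the first one at negated arguments.\<close>

lemma flux_lipschitz:
  assumes "\<bar>c\<bar> \<le> R" "\<bar>c'\<bar> \<le> R" "\<bar>a\<bar> \<le> S" "\<bar>b\<bar> \<le> S" "\<bar>a'\<bar> \<le> S" "\<bar>b'\<bar> \<le> S"
    and "\<bar>c - c'\<bar> \<le> k" "\<bar>a - a'\<bar> \<le> l" "\<bar>b - b'\<bar> \<le> l"
  shows "\<bar>flux c a b - flux c' a' b'\<bar> \<le> 2 * (k * S + R * l)"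
proof -
  have pos: "\<bar>max x 0 - max y 0\<bar> \<le> \<bar>x - y\<bar>" "\<bar>max x 0\<bar> \<le> \<bar>x\<bar>" for x y :: real by linarith+
  have mx: "\<bar>max x y - max x' y'\<bar> \<le> r" if "\<bar>x - x'\<bar> \<le> r" "\<bar>y - y'\<bar> \<le> r" for x y x' y' r :: real
    using that by linarith
  have mb: "\<bar>max x y\<bar> \<le> r" if "\<bar>x\<bar> \<le> r" "\<bar>y\<bar> \<le> r" for x y r :: real using that by linarith
  have *: "\<bar>max c 0 * max (max a b) 0 - max c' 0 * max (max a' b') 0\<bar> \<le> k * S + R * l"
    if "\<bar>c - c'\<bar> \<le> k" "\<bar>a - a'\<bar> \<le> l" "\<bar>b - b'\<bar> \<le> l" "\<bar>c'\<bar> \<le> R" "\<bar>a\<bar> \<le> S" "\<bar>b\<bar> \<le> S" for c c' a a' b b'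
  proof (rule abs_mult_diff_le)
    show "\<bar>max c 0 - max c' 0\<bar> \<le> k" using pos(1)[of c c'] that(1) by (rule order_trans)
    show "\<bar>max (max a b) 0 - max (max a' b') 0\<bar> \<le> l"
      using order_trans[OF pos(1) mx[OF that(2,3)]] .
    show "\<bar>max (max a b) 0\<bar> \<le> S" using order_trans[OF pos(2) mb[OF that(5,6)]] .
    show "\<bar>max c' 0\<bar> \<le> R" using order_trans[OF pos(2) that(4)] .
  qed
  from *[of c c' a a' b b'] *[of "-c" "-c'" "-a" "-a'" "-b" "-b'"]
  have "\<bar>max c 0 * max (max a b) 0 - max c' 0 * max (max a' b') 0\<bar> \<le> k * S + R * l"
    "\<bar>max (- c) 0 * max (max (- a) (- b)) 0 - max (- c') 0 * max (max (- a') (- b')) 0\<bar> \<le> k * S + R * l"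
    using assms by (simp_all only: abs_minus_cancel minus_diff_minus)
  moreover have "\<bar>(x - y) - (x' - y')\<bar> \<le> 2 * r" if "\<bar>x - x'\<bar> \<le> r" "\<bar>y - y'\<bar> \<le> r" for x y x' y' r :: real
    using that by linarith
  ultimately show ?thesis unfolding flux_def by blast
qed

text \<open>The sign of \<open>c\<close> selects one branch, and in either branch the active maximum
  is close to |p|, because \<open>a\<close> is close to p and \<open>b\<close> to -p.\<close>

lemma flux_consistent:
  assumes "\<bar>a - p\<bar> \<le> l" "\<bar>b + p\<bar> \<le> l"
  shows "\<bar>flux c a b - \<bar>p\<bar> * c\<bar> \<le> \<bar>c\<bar> * l"
proof (cases "0 \<le> c")
  case True
  have "\<bar>max (max a b) 0 - \<bar>p\<bar>\<bar> \<le> l" using assms by linarith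
  then have "\<bar>c * (max (max a b) 0 - \<bar>p\<bar>)\<bar> \<le> \<bar>c\<bar> * l" by (simp add: abs_mult mult_left_mono)
  then show ?thesis using True by (simp add: flux_def algebra_simps)
next
  case False
  have "\<bar>max (max (-a) (-b)) 0 - \<bar>p\<bar>\<bar> \<le> l" using assms by linarith
  then have "\<bar>c * (max (max (-a) (-b)) 0 - \<bar>p\<bar>)\<bar> \<le> \<bar>c\<bar> * l" by (simp add: abs_mult mult_left_mono)
  then show ?thesis using False by (simp add: flux_def algebra_simps)
qed

section \<open>Taylor bounds, interior maxima and a bounded substitute for x^2\<close>

lemma taylor2_bound:
  fixes f f' f'' :: "real \<Rightarrow> real"
  assumes f: "\<And>y. \<bar>y - x\<bar> \<le> \<bar>z\<bar> \<Longrightarrow> (f has_real_derivative f' y) (at y)"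
    and f': "\<And>y. \<bar>y - x\<bar> \<le> \<bar>z\<bar> \<Longrightarrow> (f' has_real_derivative f'' y) (at y)"
    and Q: "\<And>y. \<bar>y - x\<bar> \<le> \<bar>z\<bar> \<Longrightarrow> \<bar>f'' y\<bar> \<le> 2 * Q"
  shows "\<bar>f (x + z) - f x - f' x * z\<bar> \<le> Q * z\<^sup>2"
proof (cases "z = 0")
  case False
  define d where "d n = (if n = 0 then f else if n = Suc 0 then f' else f'')" for n :: nat
  have "\<exists>t. (if x + z < x then x + z < t \<and> t < x else x < t \<and> t < x + z) \<and>
      f (x + z) = (\<Sum>m<2. d m x / fact m * (x + z - x) ^ m) + d 2 t / fact 2 * (x + z - x) ^ 2"
    using False f f'
    by (intro Taylor[where a = "x - \<bar>z\<bar>" and b = "x + \<bar>z\<bar>"])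
      (auto simp: d_def less_2_cases_iff abs_le_iff)
  then obtain t where "(if x + z < x then x + z < t \<and> t < x else x < t \<and> t < x + z)"
      "f (x + z) = (\<Sum>m<2. d m x / fact m * (x + z - x) ^ m) + d 2 t / fact 2 * (x + z - x) ^ 2" by blast
  then have t: "\<bar>t - x\<bar> \<le> \<bar>z\<bar>" "f (x + z) = f x + f' x * z + f'' t / 2 * z\<^sup>2"
    by (auto simp: d_def numeral_2_eq_2 split: if_splits)
  have "\<bar>f'' t / 2 * z\<^sup>2\<bar> \<le> Q * z\<^sup>2"
    using mult_right_mono[OF Q[OF t(1)], of "z\<^sup>2 / 2"] by (simp add: abs_mult)
  then show ?thesis using t(2) by simp
qed simp

text \<open>A positive \<open>c\<close> would make f' positive just to the right of x, and f would
  increase there.\<close>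

lemma second_deriv_nonpos_at_max:
  fixes f f' :: "real \<Rightarrow> real"
  assumes f: "\<And>y. \<bar>y - x\<bar> < r \<Longrightarrow> (f has_real_derivative f' y) (at y)"
    and f': "(f' has_real_derivative c) (at x)" and "0 < r"
    and max: "\<And>y. \<bar>y - x\<bar> < r \<Longrightarrow> f y \<le> f x"
  shows "f' x = 0" "c \<le> 0"
proof -
  show 0: "f' x = 0"
    using DERIV_local_max[OF f[of x] \<open>0 < r\<close>] max \<open>0 < r\<close> by (auto simp: abs_minus_commute)
  show "c \<le> 0"
  proof (rule ccontr)
    assume "\<not> c \<le> 0"
    then obtain d where d: "0 < d" "\<And>h. 0 < h \<Longrightarrow> h < d \<Longrightarrow> f' x < f' (x + h)"
      using DERIV_pos_inc_right[OF f'] by auto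
    define h where "h = min d r / 2"
    have h: "0 < h" "h < d" "h < r" using d \<open>0 < r\<close> by (auto simp: h_def min_def)
    obtain z where z: "x < z" "z < x + h" "f (x + h) - f x = (x + h - x) * f' z"
      using MVT2[of x "x + h" f f'] f h by (auto simp: abs_if)
    have "0 < f' z" using d(2)[of "z - x"] z h 0 by simp
    then have "f x < f (x + h)" using z h by (simp add: algebra_simps)
    then show False using max[of "x + h"] h by simp
  qed
qed

text \<open>A bounded stand-in for x^2, quadratic near 0 and at least 1/2 outside [-1, 1]. It
  localises maxima where a growing penalty would leave the class of bounded test functions.\<close>

definition bump :: "real \<Rightarrow> real" where "bump x = x\<^sup>2 / (1 + x\<^sup>2)"
definition bump1 :: "real \<Rightarrow> real" where "bump1 x = 2 * x / (1 + x\<^sup>2)\<^sup>2"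
definition bump2 :: "real \<Rightarrow> real" where "bump2 x = (2 - 6 * x\<^sup>2) / (1 + x\<^sup>2) ^ 3"

lemma one_plus_square_pos [simp]: "0 < 1 + (x::real)\<^sup>2" "1 + x\<^sup>2 \<noteq> 0"
  using zero_le_power2[of x] by linarith+

lemma bump_deriv: "(bump has_real_derivative bump1 x) (at x)"
  unfolding bump_def[abs_def] bump1_def
  by (auto intro!: derivative_eq_intros simp: power2_eq_square[of "1 + x\<^sup>2"] field_simps)

lemma bump1_deriv: "(bump1 has_real_derivative bump2 x) (at x)"
proof -
  have "(bump1 has_real_derivative (2 * (1 + x\<^sup>2)\<^sup>2 - 2 * x * (2 * (1 + x\<^sup>2) * (2 * x))) / ((1 + x\<^sup>2)\<^sup>2)\<^sup>2) (at x)"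
    unfolding bump1_def[abs_def]
    by (auto intro!: derivative_eq_intros simp: power2_eq_square[of "(1 + x\<^sup>2)\<^sup>2"])
  moreover have "(2 * (1 + x\<^sup>2)\<^sup>2 - 2 * x * (2 * (1 + x\<^sup>2) * (2 * x))) / ((1 + x\<^sup>2)\<^sup>2)\<^sup>2 = bump2 x"
  proof -
    define s where "s = 1 + x\<^sup>2"
    have s: "s \<noteq> 0" by (simp add: s_def)
    have "2 * s\<^sup>2 - 2 * x * (2 * s * (2 * x)) = s * (2 - 6 * x\<^sup>2)"
      by (simp add: s_def power2_eq_square algebra_simps)
    then show ?thesis using s unfolding bump2_def s_def[symmetric]
      by (simp add: field_simps power2_eq_square power3_eq_cube)
  qed
  ultimately show ?thesis by simp
qed

lemma bump_continuous: "continuous_on A bump" "continuous_on A bump1" "continuous_on A bump2"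
  unfolding bump_def[abs_def] bump1_def[abs_def] bump2_def[abs_def]
  by (auto intro!: continuous_intros)

lemma bump_nonneg: "0 \<le> bump x" and bump_le_1: "bump x \<le> 1" and bump_0 [simp]: "bump 0 = 0"
  by (simp_all add: bump_def divide_le_eq)

lemma bump_ge_half: "1 \<le> \<bar>x\<bar> \<Longrightarrow> 1 / 2 \<le> bump x"
  using abs_le_square_iff[of 1 x] by (simp add: bump_def field_simps)

lemma bump_ge_quadratic:
  assumes "\<bar>z\<bar> \<le> 1" shows "z\<^sup>2 / 2 \<le> bump z"
proof -
  have "z\<^sup>2 \<le> 1" using assms abs_le_square_iff[of z 1] by simp
  then show ?thesis unfolding bump_def by (intro frac_le) auto
qed

lemma bump1_bound: "\<bar>bump1 x\<bar> \<le> 1"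
proof -
  have "2 * \<bar>x\<bar> \<le> 1 + x\<^sup>2" using zero_le_power2[of "\<bar>x\<bar> - 1"] by (simp add: power2_diff)
  also have "\<dots> * 1 \<le> (1 + x\<^sup>2) * (1 + x\<^sup>2)" by (intro mult_left_mono) auto
  finally show ?thesis by (simp add: bump1_def abs_mult power2_eq_square[of "1 + x\<^sup>2"] divide_le_eq)
qed

lemma bump2_bound: "\<bar>bump2 x\<bar> \<le> 6"
proof -
  have "\<bar>2 - 6 * x\<^sup>2\<bar> \<le> 6 * (1 + x\<^sup>2)" using zero_le_power2[of x] by (simp add: abs_le_iff)
  also have "1 + x\<^sup>2 \<le> (1 + x\<^sup>2) ^ 3" using self_le_power[of "1 + x\<^sup>2" 3] by simp
  finally have "\<bar>2 - 6 * x\<^sup>2\<bar> \<le> 6 * (1 + x\<^sup>2) ^ 3" by simp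
  then show ?thesis by (simp add: bump2_def divide_le_eq)
qed

lemma bump_taylor: "\<bar>bump (x + z) - bump x - bump1 x * z\<bar> \<le> 3 * z\<^sup>2"
  using bump2_bound by (intro taylor2_bound[where f'' = bump2] bump_deriv bump1_deriv) auto

text \<open>A \<open>C\<^sup>2\<close> approximation of the positive part from below that vanishes for \<open>s \<le> 0\<close>: the function
  \<open>F - soft_pos k (F - G)\<close> lies between \<open>min F G\<close> and \<open>F\<close> and has the second order jet of \<open>F\<close> wherever \<open>F = G\<close>.\<close>

definition soft_pos :: "real \<Rightarrow> real \<Rightarrow> real" where
  "soft_pos k s = (max 0 s) ^ 3 / (s\<^sup>2 + k\<^sup>2)"

lemma DERIV_max_0_power:
  "((\<lambda>s::real. (max 0 s) ^ Suc (Suc n)) has_real_derivative real (Suc (Suc n)) * (max 0 s) ^ Suc n) (at s)"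
proof (cases s "0::real" rule: linorder_cases)
  case less
  have "((\<lambda>s::real. 0) has_real_derivative 0) (at s)" by simp
  then have "((\<lambda>s::real. (max 0 s) ^ Suc (Suc n)) has_real_derivative 0) (at s)"
    by (rule has_field_derivative_transform_within_open[where S = "{..<0}"]) (use less in auto)
  then show ?thesis using less by simp
next
  case greater
  have "((\<lambda>s::real. s ^ Suc (Suc n)) has_real_derivative real (Suc (Suc n)) * s ^ Suc n) (at s)"
    using DERIV_pow[of "Suc (Suc n)" s] by simp
  then have "((\<lambda>s::real. (max 0 s) ^ Suc (Suc n)) has_real_derivative real (Suc (Suc n)) * s ^ Suc n) (at s)"
    by (rule has_field_derivative_transform_within_open[where S = "{0<..}"]) (use greater in auto)
  then show ?thesis using greater by simp
next
  case equal
  have "((\<lambda>h::real. (max 0 h) ^ Suc n) \<longlongrightarrow> 0) (at 0)"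
    by (rule tendsto_eq_intros refl | simp)+
  then have "((\<lambda>h::real. (max 0 h) ^ Suc (Suc n) / h) \<longlongrightarrow> 0) (at 0)"
    by (rule Lim_transform_within[OF _ zero_less_one]) (auto simp: max_def)
  then show ?thesis using equal by (simp add: DERIV_def)
qed

text \<open>The cube is the lowest integer power of the positive part that is twice continuously
  differentiable at 0, and its first two derivatives vanish there.\<close>

lemma soft_pos_C2:
  assumes "k \<noteq> 0"
  obtains S1 S2 where "\<And>s. (soft_pos k has_real_derivative S1 s) (at s)"
    "\<And>s. (S1 has_real_derivative S2 s) (at s)" "continuous_on UNIV S2" "S1 0 = 0" "S2 0 = 0"
proof -
  define m where "m s = max 0 s" for s :: real
  have k: "s\<^sup>2 + k\<^sup>2 \<noteq> 0" for s using assms by (simp add: sum_power2_eq_zero_iff)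
  have m3: "((\<lambda>s. m s ^ 3) has_real_derivative 3 * m s ^ 2) (at s)" for s
    using DERIV_max_0_power[of 1 s] by (simp add: m_def numeral_eq_Suc)
  have m2: "((\<lambda>s. m s ^ 2) has_real_derivative 2 * m s) (at s)" for s
    using DERIV_max_0_power[of 0 s] by (simp add: m_def numeral_eq_Suc)
  define N where "N s = 3 * m s ^ 2 * (s\<^sup>2 + k\<^sup>2) - m s ^ 3 * (2 * s)" for s
  define N' where "N' s = 3 * (2 * m s) * (s\<^sup>2 + k\<^sup>2) + 3 * m s ^ 2 * (2 * s) - (3 * m s ^ 2 * (2 * s) + m s ^ 3 * 2)" for s
  define S1 where "S1 s = N s / (s\<^sup>2 + k\<^sup>2)\<^sup>2" for s
  define S2 where "S2 s = (N' s * (s\<^sup>2 + k\<^sup>2)\<^sup>2 - N s * (2 * (s\<^sup>2 + k\<^sup>2) * (2 * s))) / ((s\<^sup>2 + k\<^sup>2)\<^sup>2)\<^sup>2" for s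
  have q: "((\<lambda>s. s\<^sup>2 + k\<^sup>2) has_real_derivative 2 * s) (at s)" for s
    by (auto intro!: derivative_eq_intros)
  have q2: "((\<lambda>s. (s\<^sup>2 + k\<^sup>2)\<^sup>2) has_real_derivative 2 * (s\<^sup>2 + k\<^sup>2) * (2 * s)) (at s)" for s
    by (auto intro!: derivative_eq_intros)
  have N: "(N has_real_derivative N' s) (at s)" for s
    unfolding N_def[abs_def] N'_def
    by (rule DERIV_cong[OF DERIV_diff[OF DERIV_mult[OF DERIV_cmult[OF m2, of 3] q] DERIV_mult[OF m3 DERIV_cmult[OF DERIV_ident, of 2]]]])
      (simp add: algebra_simps)
  show ?thesis
  proof
    show "(soft_pos k has_real_derivative S1 s) (at s)" for s
      using DERIV_divide[OF m3 q k, of s] unfolding soft_pos_def[abs_def] S1_def N_def m_def[symmetric]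
      by (simp only: power2_eq_square[of "s\<^sup>2 + k\<^sup>2"])
    show "(S1 has_real_derivative S2 s) (at s)" for s
      using DERIV_divide[OF N q2, of s] k[of s] unfolding S1_def[abs_def] S2_def
      by (simp only: power2_eq_square[of "(s\<^sup>2 + k\<^sup>2)\<^sup>2"] power_eq_0_iff simp_thms if_True HOL.simp_thms not_False_eq_True)
    show "continuous_on UNIV S2"
      unfolding S2_def[abs_def] N_def N'_def m_def using k by (auto intro!: continuous_intros)
  qed (simp_all add: S1_def S2_def N_def N'_def m_def)
qed

lemma soft_pos_nonneg: "0 \<le> soft_pos k s"
  by (simp add: soft_pos_def)

lemma soft_pos_le: "soft_pos k s \<le> max 0 s"
proof (cases "0 < s")
  case True
  then have "s ^ 3 \<le> s * (s\<^sup>2 + k\<^sup>2)" "0 < s\<^sup>2 + k\<^sup>2"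
    by (simp_all add: power3_eq_cube power2_eq_square distrib_left add_pos_nonneg)
  with True show ?thesis by (simp add: soft_pos_def divide_le_eq)
qed (simp add: soft_pos_def max_def)

lemma soft_pos_tendsto:
  assumes "f \<longlonglongrightarrow> 0"
  shows "(\<lambda>n. soft_pos (f n) s) \<longlonglongrightarrow> max 0 s"
proof (cases "0 < s")
  case True
  have "(\<lambda>n. s ^ 3 / (s\<^sup>2 + (f n)\<^sup>2)) \<longlonglongrightarrow> s ^ 3 / (s\<^sup>2 + 0\<^sup>2)"
    using True by (intro tendsto_intros assms) auto
  moreover have "s ^ 3 / (s\<^sup>2 + 0\<^sup>2) = s" using True by (simp add: power3_eq_cube power2_eq_square)
  ultimately show ?thesis using True by (simp add: soft_pos_def)
qed (simp add: soft_pos_def max_def)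

section \<open>The Levy operator and its discretisation\<close>

text \<open>Minus the fractional Laplacian, with the integrand symmetrised so that the compensator disappears.\<close>

definition levy_op :: "real \<Rightarrow> (real \<Rightarrow> real) \<Rightarrow> real \<Rightarrow> real" where
  "levy_op \<alpha> A x = levy_const \<alpha> / 2 * (LINT z|lborel. (A (x + z) + A (x - z) - 2 * A x) / \<bar>z\<bar> powr (1 + \<alpha>))"

text \<open>Removing |z| <= \<delta> leaves a kernel of finite mass, so this operator is bounded on
  bounded functions and explicit time steps become possible.\<close>

definition levy_trunc :: "real \<Rightarrow> real \<Rightarrow> (real \<Rightarrow> real) \<Rightarrow> real \<Rightarrow> real" where
  "levy_trunc \<alpha> \<delta> A x = levy_const \<alpha> / 2 *
     (LINT z|lborel. (A (x + z) + A (x - z) - 2 * A x) * (indicator {z. \<delta> < \<bar>z\<bar>} z / \<bar>z\<bar> powr (1 + \<alpha>)))"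

text \<open>This is min(1, z^2) times the Levy density, whose integrability is the defining property
  of a Levy measure. All bounds on nonlocal terms are expressed through it.\<close>

definition levy_wt :: "real \<Rightarrow> real \<Rightarrow> real" where
  "levy_wt \<alpha> z = (if \<bar>z\<bar> \<le> 1 then z\<^sup>2 else 1) / \<bar>z\<bar> powr (1 + \<alpha>)"

definition levy_mass :: "real \<Rightarrow> real" where
  "levy_mass \<alpha> = (LINT z|lborel. levy_wt \<alpha> z)"

definition levy_tail :: "real \<Rightarrow> real \<Rightarrow> real" where
  "levy_tail \<alpha> \<delta> = (LINT z|lborel. indicator {z. \<delta> < \<bar>z\<bar>} z / \<bar>z\<bar> powr (1 + \<alpha>))"

definition levy_core :: "real \<Rightarrow> real \<Rightarrow> real" where
  "levy_core \<alpha> \<delta> = (LINT z|lborel. levy_wt \<alpha> z * indicator {z. \<bar>z\<bar> \<le> \<delta>} z)"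

text \<open>Regularity at the single point x: a two-sided parabola with slope p and a bound on the
  oscillation. It is what the symmetrised Levy integral at x requires, and it can hold for the
  minimum of two C2 functions, which need not be differentiable elsewhere.\<close>

definition quad_touch :: "(real \<Rightarrow> real) \<Rightarrow> real \<Rightarrow> real \<Rightarrow> real \<Rightarrow> real \<Rightarrow> bool" where
  "quad_touch A x p Q M \<longleftrightarrow> A \<in> borel_measurable borel \<and>
     (\<forall>z. \<bar>A (x + z) - A x - p * z\<bar> \<le> Q * z\<^sup>2) \<and> (\<forall>z. \<bar>A (x + z) - A x\<bar> \<le> M)"

text \<open>Discretises |w_x| times \<open>levy_op\<close>, which is the nonlinearity of the
  equation with its sign. The truncation radius and the step of the one-sided quotients are the same
  \<delta>, so one limit removes both errors.\<close>

definition nonlin :: "real \<Rightarrow> real \<Rightarrow> (real \<Rightarrow> real) \<Rightarrow> real \<Rightarrow> real" where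
  "nonlin \<alpha> \<delta> w x = flux (levy_trunc \<alpha> \<delta> w x) ((w (x + \<delta>) - w x) / \<delta>) ((w (x - \<delta>) - w x) / \<delta>)"

lemma quad_touchD:
  assumes "quad_touch A x p Q M"
  shows "A \<in> borel_measurable borel" "\<bar>A (x + z) - A x - p * z\<bar> \<le> Q * z\<^sup>2" "\<bar>A (x + z) - A x\<bar> \<le> M"
    "0 \<le> Q" "0 \<le> M"
proof -
  have *: "\<And>z. \<bar>A (x + z) - A x - p * z\<bar> \<le> Q * z\<^sup>2" "\<And>z. \<bar>A (x + z) - A x\<bar> \<le> M"
    using assms by (simp_all add: quad_touch_def)
  show "\<bar>A (x + z) - A x - p * z\<bar> \<le> Q * z\<^sup>2" "\<bar>A (x + z) - A x\<bar> \<le> M" by (fact *)+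
  show "0 \<le> Q" using order_trans[OF abs_ge_zero *(1)[of 1]] by simp
  show "0 \<le> M" using order_trans[OF abs_ge_zero *(2)[of 1]] .
  show "A \<in> borel_measurable borel" using assms by (simp add: quad_touch_def)
qed

lemma levy_wt_nonneg: "0 \<le> levy_wt \<alpha> z"
  by (simp add: levy_wt_def)

lemma levy_wt_measurable [measurable]: "levy_wt \<alpha> \<in> borel_measurable borel"
  unfolding levy_wt_def[abs_def] by simp

lemma levy_mass_nonneg: "0 \<le> levy_mass \<alpha>"
  unfolding levy_mass_def by (intro Bochner_Integration.integral_nonneg levy_wt_nonneg)

lemma levy_tail_nonneg: "0 \<le> levy_tail \<alpha> \<delta>"
  unfolding levy_tail_def by (intro Bochner_Integration.integral_nonneg) simp

text \<open>Adding the bounds at z and -z cancels the slope. The parabola serves for |z| <= 1 and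
  the oscillation bound elsewhere.\<close>

lemma second_difference_bound:
  assumes "quad_touch A x p Q M"
  shows "\<bar>A (x + z) + A (x - z) - 2 * A x\<bar> / \<bar>z\<bar> powr (1 + \<alpha>) \<le> 2 * (Q + M) * levy_wt \<alpha> z"
proof -
  note q = quad_touchD[OF assms]
  have "\<bar>A (x + z) + A (x - z) - 2 * A x\<bar> \<le> 2 * (Q * z\<^sup>2)"
    using q(2)[of z] q(2)[of "-z"] by simp
  moreover have "\<bar>A (x + z) + A (x - z) - 2 * A x\<bar> \<le> 2 * M"
    using q(3)[of z] q(3)[of "-z"] by simp
  moreover have "2 * (Q * z\<^sup>2) \<le> 2 * (Q + M) * z\<^sup>2" "2 * M \<le> 2 * (Q + M)"
    using q(4,5) mult_nonneg_nonneg[OF q(5) zero_le_power2[of z]] by (simp_all add: distrib_right)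
  ultimately have "\<bar>A (x + z) + A (x - z) - 2 * A x\<bar> \<le> 2 * (Q + M) * (if \<bar>z\<bar> \<le> 1 then z\<^sup>2 else 1)"
    by (auto split: if_splits)
  then show ?thesis by (simp add: levy_wt_def divide_right_mono)
qed

locale levy_exponent =
  fixes \<alpha> :: real
  assumes \<alpha>_pos: "0 < \<alpha>" and \<alpha>_less: "\<alpha> < 2"
begin

lemma levy_const_pos: "0 < levy_const \<alpha>"
  using levy_const_well_defined(2) \<alpha>_pos \<alpha>_less .

lemma levy_wt_integrable: "integrable lborel (levy_wt \<alpha>)"
  using levy_weight_integrable[OF \<alpha>_pos \<alpha>_less] by (simp add: levy_wt_def[abs_def])

lemma quad_touch_integrable:
  assumes "quad_touch A x p Q M"
  shows "integrable lborel (\<lambda>z. (A (x + z) + A (x - z) - 2 * A x) / \<bar>z\<bar> powr (1 + \<alpha>))"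
proof (rule Bochner_Integration.integrable_bound)
  show "integrable lborel (\<lambda>z. 2 * (Q + M) * levy_wt \<alpha> z)" using levy_wt_integrable by simp
  have [measurable]: "A \<in> borel_measurable borel" using quad_touchD[OF assms] by simp
  show "(\<lambda>z. (A (x + z) + A (x - z) - 2 * A x) / \<bar>z\<bar> powr (1 + \<alpha>)) \<in> borel_measurable lborel" by measurable
  have "0 \<le> Q + M" using quad_touchD(4,5)[OF assms] by simp
  then show "AE z in lborel. norm ((A (x + z) + A (x - z) - 2 * A x) / \<bar>z\<bar> powr (1 + \<alpha>)) \<le> norm (2 * (Q + M) * levy_wt \<alpha> z)"
    using second_difference_bound[OF assms] levy_wt_nonneg[of \<alpha>] by (simp add: abs_mult)
qed

lemma levy_op_bound:
  assumes "quad_touch A x p Q M"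
  shows "\<bar>levy_op \<alpha> A x\<bar> \<le> levy_const \<alpha> * (Q + M) * levy_mass \<alpha>"
proof -
  have "norm (LINT z|lborel. (A (x + z) + A (x - z) - 2 * A x) / \<bar>z\<bar> powr (1 + \<alpha>))
      \<le> (LINT z|lborel. 2 * (Q + M) * levy_wt \<alpha> z)"
    using second_difference_bound[OF assms] levy_wt_integrable
    by (intro Bochner_Integration.integral_norm_bound_integral quad_touch_integrable[OF assms]) auto
  then have "\<bar>LINT z|lborel. (A (x + z) + A (x - z) - 2 * A x) / \<bar>z\<bar> powr (1 + \<alpha>)\<bar> \<le> 2 * (Q + M) * levy_mass \<alpha>"
    by (simp add: levy_mass_def)
  then have "levy_const \<alpha> / 2 * \<bar>LINT z|lborel. (A (x + z) + A (x - z) - 2 * A x) / \<bar>z\<bar> powr (1 + \<alpha>)\<bar>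
      \<le> levy_const \<alpha> / 2 * (2 * ((Q + M) * levy_mass \<alpha>))"
    unfolding mult.assoc using levy_const_pos by (intro mult_left_mono) auto
  then show ?thesis
    using levy_const_pos by (simp add: levy_op_def abs_mult mult.assoc)
qed

lemma levy_op_add:
  assumes "quad_touch A x p Q M" "quad_touch B x p' Q' M'"
  shows "levy_op \<alpha> (\<lambda>y. A y + k * B y) x = levy_op \<alpha> A x + k * levy_op \<alpha> B x"
proof -
  have "(LINT z|lborel. ((A (x + z) + k * B (x + z)) + (A (x - z) + k * B (x - z)) - 2 * (A x + k * B x)) / \<bar>z\<bar> powr (1 + \<alpha>))
     = (LINT z|lborel. (A (x + z) + A (x - z) - 2 * A x) / \<bar>z\<bar> powr (1 + \<alpha>) + k * ((B (x + z) + B (x - z) - 2 * B x) / \<bar>z\<bar> powr (1 + \<alpha>)))"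
    by (rule Bochner_Integration.integral_cong) (auto simp: add_divide_distrib diff_divide_distrib algebra_simps)
  also have "\<dots> = (LINT z|lborel. (A (x + z) + A (x - z) - 2 * A x) / \<bar>z\<bar> powr (1 + \<alpha>)) + k * (LINT z|lborel. (B (x + z) + B (x - z) - 2 * B x) / \<bar>z\<bar> powr (1 + \<alpha>))"
    using quad_touch_integrable[OF assms(1)] quad_touch_integrable[OF assms(2)]
    by (simp only: Bochner_Integration.integral_add integrable_mult_right integral_mult_right_zero)
  finally show ?thesis unfolding levy_op_def by (simp add: algebra_simps)
qed

text \<open>Averaging the compensated integrand over z and -z cancels the odd compensator. This is
  legitimate because the parabola and the oscillation bound make the compensated integrand itself
  integrable.\<close>

lemma frac_lap_eq_levy_op:
  assumes q: "quad_touch A x p Q M" and "deriv A x = p"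
  shows "frac_lap \<alpha> A x = - levy_op \<alpha> A x"
proof -
  note qd = quad_touchD[OF q]
  define h where "h z = (A (x + z) - A x - z * p * indicator {z. \<bar>z\<bar> \<le> 1} z) / \<bar>z\<bar> powr (1 + \<alpha>)" for z
  have [measurable]: "A \<in> borel_measurable borel" by (fact qd(1))
  have h: "integrable lborel h"
  proof (rule Bochner_Integration.integrable_bound)
    show "integrable lborel (\<lambda>z. (Q + M) * levy_wt \<alpha> z)" using levy_wt_integrable by simp
    show "h \<in> borel_measurable lborel" unfolding h_def[abs_def] by measurable
    have "\<bar>A (x + z) - A x - z * p * indicator {z. \<bar>z\<bar> \<le> 1} z\<bar> \<le> (Q + M) * (if \<bar>z\<bar> \<le> 1 then z\<^sup>2 else 1)" for z
    proof (cases "\<bar>z\<bar> \<le> 1")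
      case True
      have "Q * z\<^sup>2 \<le> (Q + M) * z\<^sup>2" using qd(5) by (intro mult_right_mono) auto
      then show ?thesis using True qd(2)[of z] by (simp add: mult.commute[of z])
    next
      case False
      then show ?thesis using qd(3)[of z] qd(4) by simp
    qed
    then have "\<bar>h z\<bar> \<le> (Q + M) * levy_wt \<alpha> z" for z
      unfolding h_def levy_wt_def by (simp add: divide_right_mono)
    then show "AE z in lborel. norm (h z) \<le> norm ((Q + M) * levy_wt \<alpha> z)"
      using qd(4,5) levy_wt_nonneg[of \<alpha>] by (simp add: abs_mult)
  qed
  have h': "integrable lborel (\<lambda>z. h (- z))" "(LINT z|lborel. h (- z)) = (LINT z|lborel. h z)"
    using lborel_integrable_real_affine[OF h, of "-1" 0] lborel_integral_real_affine[of "-1" h 0] by simp_all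
  have "levy_integral \<alpha> A x = (LINT z|lborel. h z)"
    unfolding levy_integral_def h_def assms(2) ..
  then have "2 * levy_integral \<alpha> A x = (LINT z|lborel. h z + h (- z))"
    using h h' by simp
  also have "\<dots> = (LINT z|lborel. (A (x + z) + A (x - z) - 2 * A x) / \<bar>z\<bar> powr (1 + \<alpha>))"
    by (rule Bochner_Integration.integral_cong) (auto simp: h_def add_divide_distrib diff_divide_distrib indicator_def)
  finally show ?thesis by (simp add: frac_lap_def levy_op_def algebra_simps)
qed

lemma tail_integrable:
  assumes "0 < \<delta>"
  shows "integrable lborel (\<lambda>z. indicator {z. \<delta> < \<bar>z\<bar>} z / \<bar>z\<bar> powr (1 + \<alpha>) :: real)"
proof (rule Bochner_Integration.integrable_bound)
  \<comment> \<open>On \<delta> < |z| <= 1 the weight has numerator z^2 >= \<delta>^2, which costs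
    the factor 1/\<delta>^2; for |z| > 1 the factor 1 suffices.\<close>
  show "integrable lborel (\<lambda>z. (1 + 1 / \<delta>\<^sup>2) * levy_wt \<alpha> z)" using levy_wt_integrable by simp
  have "indicator {z. \<delta> < \<bar>z\<bar>} z \<le> (1 + 1 / \<delta>\<^sup>2) * (if \<bar>z\<bar> \<le> 1 then z\<^sup>2 else 1)" for z
  proof (cases "\<delta> < \<bar>z\<bar>")
    case True
    then have "\<delta>\<^sup>2 \<le> z\<^sup>2" using assms abs_le_square_iff[of \<delta> z] by simp
    then have "1 \<le> 1 / \<delta>\<^sup>2 * z\<^sup>2" using assms by simp
    moreover have "(1 + 1 / \<delta>\<^sup>2) * z\<^sup>2 = z\<^sup>2 + 1 / \<delta>\<^sup>2 * z\<^sup>2" by (simp only: distrib_right mult_1)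
    ultimately have "1 \<le> (1 + 1 / \<delta>\<^sup>2) * z\<^sup>2" using zero_le_power2[of z] by linarith
    then show ?thesis using True by auto
  qed (simp add: add_nonneg_nonneg)
  then have "indicator {z. \<delta> < \<bar>z\<bar>} z / \<bar>z\<bar> powr (1 + \<alpha>) \<le> (1 + 1 / \<delta>\<^sup>2) * levy_wt \<alpha> z" for z
    unfolding levy_wt_def times_divide_eq_right by (intro divide_right_mono) auto
  then show "AE z in lborel. norm (indicator {z. \<delta> < \<bar>z\<bar>} z / \<bar>z\<bar> powr (1 + \<alpha>)) \<le> norm ((1 + 1 / \<delta>\<^sup>2) * levy_wt \<alpha> z)"
    using levy_wt_nonneg[of \<alpha>] by (simp add: abs_mult add_nonneg_nonneg)
qed simp

lemma levy_trunc_integrable: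
  assumes \<delta>: "0 < \<delta>" and [measurable]: "A \<in> borel_measurable borel" and M: "\<And>y. \<bar>A y\<bar> \<le> M"
  shows "integrable lborel (\<lambda>z. (A (x + z) + A (x - z) - 2 * A x) * (indicator {z. \<delta> < \<bar>z\<bar>} z / \<bar>z\<bar> powr (1 + \<alpha>)))"
proof (rule Bochner_Integration.integrable_bound)
  show "integrable lborel (\<lambda>z. 4 * M * (indicator {z. \<delta> < \<bar>z\<bar>} z / \<bar>z\<bar> powr (1 + \<alpha>)))"
    by (rule integrable_mult_right) (rule tail_integrable[OF \<delta>])
  have "0 \<le> M" using order_trans[OF abs_ge_zero M] .
  have "\<bar>A (x + z) + A (x - z) - 2 * A x\<bar> \<le> 4 * M" for z
    using M[of "x + z"] M[of "x - z"] M[of x] by linarith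
  then show "AE z in lborel. norm ((A (x + z) + A (x - z) - 2 * A x) * (indicator {z. \<delta> < \<bar>z\<bar>} z / \<bar>z\<bar> powr (1 + \<alpha>)))
     \<le> norm (4 * M * (indicator {z. \<delta> < \<bar>z\<bar>} z / \<bar>z\<bar> powr (1 + \<alpha>)))"
    using \<open>0 \<le> M\<close> by (intro AE_I2) (simp add: abs_mult mult_right_mono divide_right_mono)
qed measurable

text \<open>A gap d in the increments moves the second difference by at most 2 d, and the factor 1/2
  in front of the integral removes the 2. With d = 0 this is monotonicity; with d > 0 it measures
  the dependence on the value at the centre.\<close>

lemma levy_trunc_mono_gap:
  assumes \<delta>: "0 < \<delta>" and meas: "A \<in> borel_measurable borel" "B \<in> borel_measurable borel"
    and "\<And>y. \<bar>A y\<bar> \<le> M" "\<And>y. \<bar>B y\<bar> \<le> M'"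
    and le: "\<And>y. A y - A x \<le> B y - B x + d"
  shows "levy_trunc \<alpha> \<delta> A x \<le> levy_trunc \<alpha> \<delta> B x + levy_const \<alpha> * levy_tail \<alpha> \<delta> * d"
proof -
  let ?t = "\<lambda>z. indicator {z. \<delta> < \<bar>z\<bar>} z / \<bar>z\<bar> powr (1 + \<alpha>)"
  note iB = levy_trunc_integrable[OF \<delta> meas(2) assms(5), of x]
  note iA = levy_trunc_integrable[OF \<delta> meas(1) assms(4), of x]
  have "(LINT z|lborel. (A (x + z) + A (x - z) - 2 * A x) * ?t z)
      \<le> (LINT z|lborel. (B (x + z) + B (x - z) - 2 * B x) * ?t z + 2 * d * ?t z)"
  proof (rule Bochner_Integration.integral_mono[OF iA])
    show "integrable lborel (\<lambda>z. (B (x + z) + B (x - z) - 2 * B x) * ?t z + 2 * d * ?t z)"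
      by (intro Bochner_Integration.integrable_add integrable_mult_right iB tail_integrable[OF \<delta>])
    fix z
    have "(A (x + z) + A (x - z) - 2 * A x) * ?t z \<le> (B (x + z) + B (x - z) - 2 * B x + 2 * d) * ?t z"
      using le[of "x + z"] le[of "x - z"] by (intro mult_right_mono) auto
    then show "(A (x + z) + A (x - z) - 2 * A x) * ?t z \<le> (B (x + z) + B (x - z) - 2 * B x) * ?t z + 2 * d * ?t z"
      by (simp only: distrib_right)
  qed
  also have "\<dots> = (LINT z|lborel. (B (x + z) + B (x - z) - 2 * B x) * ?t z) + 2 * d * levy_tail \<alpha> \<delta>"
    unfolding levy_tail_def using iB tail_integrable[OF \<delta>]
    by (simp only: Bochner_Integration.integral_add integrable_mult_right integral_mult_right_zero)
  finally have "levy_const \<alpha> / 2 * (LINT z|lborel. (A (x + z) + A (x - z) - 2 * A x) * ?t z)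
     \<le> levy_const \<alpha> / 2 * ((LINT z|lborel. (B (x + z) + B (x - z) - 2 * B x) * ?t z) + 2 * d * levy_tail \<alpha> \<delta>)"
    using levy_const_pos by (intro mult_left_mono) auto
  then show ?thesis unfolding levy_trunc_def by (simp add: algebra_simps)
qed

lemma levy_trunc_uminus: "levy_trunc \<alpha> \<delta> (\<lambda>y. - A y) x = - levy_trunc \<alpha> \<delta> A x"
proof -
  have neg: "- a + - b - 2 * - c = - (a + b - 2 * c)" for a b c :: real by simp
  have "(LINT z|lborel. (- A (x + z) + - A (x - z) - 2 * - A x) * (indicator {z. \<delta> < \<bar>z\<bar>} z / \<bar>z\<bar> powr (1 + \<alpha>)))
     = (LINT z|lborel. - ((A (x + z) + A (x - z) - 2 * A x) * (indicator {z. \<delta> < \<bar>z\<bar>} z / \<bar>z\<bar> powr (1 + \<alpha>))))"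
    by (rule Bochner_Integration.integral_cong) (simp_all only: neg minus_mult_left)
  then show ?thesis unfolding levy_trunc_def by simp
qed

lemma levy_trunc_lipschitz:
  assumes \<delta>: "0 < \<delta>" and meas: "A \<in> borel_measurable borel" "B \<in> borel_measurable borel"
    and "\<And>y. \<bar>A y\<bar> \<le> M" "\<And>y. \<bar>B y\<bar> \<le> M'" and le: "\<And>y. \<bar>A y - B y\<bar> \<le> k"
  shows "\<bar>levy_trunc \<alpha> \<delta> A x - levy_trunc \<alpha> \<delta> B x\<bar> \<le> levy_const \<alpha> * levy_tail \<alpha> \<delta> * (2 * k)"
proof -
  have "A y - A x \<le> B y - B x + 2 * k" "B y - B x \<le> A y - A x + 2 * k" for y
    using le[of x] le[of y] by linarith+
  then show ?thesis
    using levy_trunc_mono_gap[OF \<delta> meas assms(4,5), of x "2 * k"]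
      levy_trunc_mono_gap[OF \<delta> meas(2,1) assms(5,4), of x "2 * k"] by fastforce
qed

lemma levy_trunc_bound:
  assumes \<delta>: "0 < \<delta>" and meas: "A \<in> borel_measurable borel" and M: "\<And>y. \<bar>A y\<bar> \<le> M"
  shows "\<bar>levy_trunc \<alpha> \<delta> A x\<bar> \<le> levy_const \<alpha> * levy_tail \<alpha> \<delta> * (2 * M)"
  using levy_trunc_lipschitz[OF \<delta> meas _ M, of "\<lambda>_. 0" 0 M] M by (simp add: levy_trunc_def)

lemma levy_core_tendsto: "(\<lambda>n. levy_core \<alpha> (1 / real (Suc n))) \<longlonglongrightarrow> 0"
proof -
  have "(\<lambda>n. LINT z|lborel. levy_wt \<alpha> z * indicator {z. \<bar>z\<bar> \<le> 1 / real (Suc n)} z) \<longlonglongrightarrow> (LINT z::real|lborel. 0)"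
  proof (rule integral_dominated_convergence[where w = "levy_wt \<alpha>"])
    show "integrable lborel (levy_wt \<alpha>)" by (rule levy_wt_integrable)
    show "AE z in lborel. (\<lambda>n. levy_wt \<alpha> z * indicator {z. \<bar>z\<bar> \<le> 1 / real (Suc n)} z) \<longlonglongrightarrow> 0"
    proof (rule AE_I2)
      fix z :: real
      show "(\<lambda>n. levy_wt \<alpha> z * indicator {z. \<bar>z\<bar> \<le> 1 / real (Suc n)} z) \<longlonglongrightarrow> 0"
      proof (cases "z = 0")
        \<comment> \<open>At 0 the indicator is always 1, but the weight itself is 0 there.\<close>
        case True then show ?thesis by (simp add: levy_wt_def)
      next
        case False
        have "(\<lambda>n. 1 / real (Suc n)) \<longlonglongrightarrow> 0" using LIMSEQ_Suc[OF lim_1_over_n] by simp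
        then have "\<forall>\<^sub>F n in sequentially. 1 / real (Suc n) < \<bar>z\<bar>" using False by (intro order_tendstoD) auto
        then have "\<forall>\<^sub>F n in sequentially. levy_wt \<alpha> z * indicator {z. \<bar>z\<bar> \<le> 1 / real (Suc n)} z = 0"
          by eventually_elim auto
        then show ?thesis by (rule tendsto_eventually)
      qed
    qed
    show "AE z in lborel. norm (levy_wt \<alpha> z * indicator {z. \<bar>z\<bar> \<le> 1 / real (Suc n)} z) \<le> levy_wt \<alpha> z" for n
      using levy_wt_nonneg[of \<alpha>] by (intro AE_I2) (auto simp: indicator_def abs_mult)
  qed measurable
  then show ?thesis by (simp add: levy_core_def)
qed

lemma levy_core_integrable: "integrable lborel (\<lambda>z. levy_wt \<alpha> z * indicator {z. \<bar>z\<bar> \<le> \<delta>} z)"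
  using levy_wt_nonneg[of \<alpha>]
  by (intro Bochner_Integration.integrable_bound[OF levy_wt_integrable]) (auto simp: indicator_def)

lemma levy_core_mono:
  assumes "\<delta> \<le> \<delta>'" shows "levy_core \<alpha> \<delta> \<le> levy_core \<alpha> \<delta>'"
  unfolding levy_core_def using levy_wt_nonneg[of \<alpha>] assms
  by (intro Bochner_Integration.integral_mono levy_core_integrable) (auto simp: indicator_def)

lemma levy_core_nonneg: "0 \<le> levy_core \<alpha> \<delta>"
  unfolding levy_core_def by (intro Bochner_Integration.integral_nonneg) (simp add: levy_wt_nonneg)

text \<open>The integrands differ only on |z| <= \<delta>, where the second difference is at most 2
  Q z^2. Since \<delta> <= 1, the weight there is exactly z^2 times the Levy density.\<close>

lemma levy_op_trunc:
  assumes q: "quad_touch A x p Q M" and \<delta>: "0 < \<delta>" "\<delta> \<le> 1"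
  shows "\<bar>levy_op \<alpha> A x - levy_trunc \<alpha> \<delta> A x\<bar> \<le> levy_const \<alpha> * Q * levy_core \<alpha> \<delta>"
proof -
  note qd = quad_touchD[OF q]
  let ?s = "\<lambda>z. (A (x + z) + A (x - z) - 2 * A x) / \<bar>z\<bar> powr (1 + \<alpha>)"
  let ?t = "\<lambda>z. (A (x + z) + A (x - z) - 2 * A x) * (indicator {z. \<delta> < \<bar>z\<bar>} z / \<bar>z\<bar> powr (1 + \<alpha>))"
  have [measurable]: "A \<in> borel_measurable borel" by (fact qd(1))
  have "\<bar>A y\<bar> \<le> \<bar>A x\<bar> + M" for y using qd(3)[of "y - x"] by simp
  then have t: "integrable lborel ?t" using levy_trunc_integrable[OF \<delta>(1) qd(1)] by blast
  note s = quad_touch_integrable[OF q]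
  have b: "\<bar>?s z - ?t z\<bar> \<le> 2 * Q * (levy_wt \<alpha> z * indicator {z. \<bar>z\<bar> \<le> \<delta>} z)" for z
  proof (cases "\<bar>z\<bar> \<le> \<delta>")
    case True
    have "\<bar>A (x + z) + A (x - z) - 2 * A x\<bar> \<le> 2 * Q * z\<^sup>2"
      using qd(2)[of z] qd(2)[of "-z"] by simp
    then have "\<bar>A (x + z) + A (x - z) - 2 * A x\<bar> / \<bar>z\<bar> powr (1 + \<alpha>) \<le> 2 * Q * z\<^sup>2 / \<bar>z\<bar> powr (1 + \<alpha>)"
      by (rule divide_right_mono) simp
    then show ?thesis using True \<delta> by (simp add: levy_wt_def)
  qed simp
  have "norm (LINT z|lborel. ?s z - ?t z) \<le> (LINT z|lborel. 2 * Q * (levy_wt \<alpha> z * indicator {z. \<bar>z\<bar> \<le> \<delta>} z))"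
    using b s t levy_core_integrable
    by (intro Bochner_Integration.integral_norm_bound_integral) auto
  then have "\<bar>(LINT z|lborel. ?s z) - (LINT z|lborel. ?t z)\<bar> \<le> 2 * Q * levy_core \<alpha> \<delta>"
    using s t unfolding levy_core_def by simp
  then have "levy_const \<alpha> / 2 * \<bar>(LINT z|lborel. ?s z) - (LINT z|lborel. ?t z)\<bar> \<le> levy_const \<alpha> / 2 * (2 * Q * levy_core \<alpha> \<delta>)"
    using levy_const_pos by (intro mult_left_mono) auto
  moreover have "\<bar>levy_op \<alpha> A x - levy_trunc \<alpha> \<delta> A x\<bar> = levy_const \<alpha> / 2 * \<bar>(LINT z|lborel. ?s z) - (LINT z|lborel. ?t z)\<bar>"
    unfolding levy_op_def levy_trunc_def right_diff_distrib[symmetric] abs_mult using levy_const_pos by simp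
  ultimately show ?thesis by (simp add: algebra_simps)
qed

section \<open>The discretised nonlinearity: monotonicity, Lipschitz bound, consistency\<close>

lemma nonlin_uminus: "nonlin \<alpha> \<delta> (\<lambda>y. - w y) x = - nonlin \<alpha> \<delta> w x"
proof -
  have d: "(- w y - - w x) / \<delta> = - ((w y - w x) / \<delta>)" for y
    by (simp only: minus_divide_left) simp
  show ?thesis
    unfolding nonlin_def levy_trunc_uminus d flux_uminus ..
qed

text \<open>Only increments about the base point enter, so \<open>B\<close> may be translated until
  the base points coincide. This is the degenerate ellipticity used at every touching point.\<close>

lemma nonlin_mono:
  assumes \<delta>: "0 < \<delta>" and meas: "A \<in> borel_measurable borel" "B \<in> borel_measurable borel"
    and "\<And>y. \<bar>A y\<bar> \<le> M" "\<And>y. \<bar>B y\<bar> \<le> M'"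
    and le: "\<And>z. A (x + z) - A x \<le> B (x' + z) - B x'"
  shows "nonlin \<alpha> \<delta> A x \<le> nonlin \<alpha> \<delta> B x'"
proof -
  define B' where "B' y = B (x' - x + y)" for y
  have B': "B' \<in> borel_measurable borel" "\<And>y. \<bar>B' y\<bar> \<le> M'"
    using meas(2) assms(5) unfolding B'_def[abs_def] by (simp_all)
  have "A y - A x \<le> B' y - B' x + 0" for y using le[of "y - x"] by (simp add: B'_def algebra_simps)
  then have "levy_trunc \<alpha> \<delta> A x \<le> levy_trunc \<alpha> \<delta> B' x"
    using levy_trunc_mono_gap[OF \<delta> meas(1) B'(1) assms(4) B'(2), of x 0] by simp
  also have "levy_trunc \<alpha> \<delta> B' x = levy_trunc \<alpha> \<delta> B x'"
    unfolding levy_trunc_def B'_def by simp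
  finally show ?thesis
    unfolding nonlin_def using le[of \<delta>] le[of "-\<delta>"] \<delta> by (intro flux_mono divide_right_mono) auto
qed

lemma nonlin_lipschitz:
  assumes \<delta>: "0 < \<delta>" and meas: "A \<in> borel_measurable borel" "B \<in> borel_measurable borel"
    and M: "\<And>y. \<bar>A y\<bar> \<le> M" "\<And>y. \<bar>B y\<bar> \<le> M" and le: "\<And>y. \<bar>A y - B y\<bar> \<le> k"
  shows "\<bar>nonlin \<alpha> \<delta> A x - nonlin \<alpha> \<delta> B x\<bar> \<le> 16 * levy_const \<alpha> * levy_tail \<alpha> \<delta> * M / \<delta> * k"
proof -
  let ?C = "levy_const \<alpha> * levy_tail \<alpha> \<delta>"
  have q: "\<bar>(c - d) / \<delta>\<bar> \<le> 2 * m / \<delta>" if "\<bar>c\<bar> \<le> m" "\<bar>d\<bar> \<le> m" for c d m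
    using that \<delta> by (simp add: divide_le_cancel)
  \<comment> \<open>The truncated operators are bounded by \<open>?C * (2 * M)\<close> and differ by
    \<open>?C * (2 * k)\<close>; the quotients are bounded by \<open>2 * M / \<delta>\<close> and
    differ by \<open>2 * k / \<delta>\<close>. This adds up to the factor 16.\<close>
  have "\<bar>nonlin \<alpha> \<delta> A x - nonlin \<alpha> \<delta> B x\<bar> \<le> 2 * (?C * (2 * k) * (2 * M / \<delta>) + ?C * (2 * M) * (2 * k / \<delta>))"
    unfolding nonlin_def
  proof (rule flux_lipschitz)
    have "(A (x + \<delta>) - A x) / \<delta> - (B (x + \<delta>) - B x) / \<delta> = ((A (x + \<delta>) - B (x + \<delta>)) - (A x - B x)) / \<delta>"
      by (simp add: diff_divide_distrib)
    then show "\<bar>(A (x + \<delta>) - A x) / \<delta> - (B (x + \<delta>) - B x) / \<delta>\<bar> \<le> 2 * k / \<delta>" using q[OF le le] by simp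
    have "(A (x - \<delta>) - A x) / \<delta> - (B (x - \<delta>) - B x) / \<delta> = ((A (x - \<delta>) - B (x - \<delta>)) - (A x - B x)) / \<delta>"
      by (simp add: diff_divide_distrib)
    then show "\<bar>(A (x - \<delta>) - A x) / \<delta> - (B (x - \<delta>) - B x) / \<delta>\<bar> \<le> 2 * k / \<delta>" using q[OF le le] by simp
  qed (use q M levy_trunc_bound[OF \<delta> meas(1) M(1)] levy_trunc_bound[OF \<delta> meas(2) M(2)]
      levy_trunc_lipschitz[OF \<delta> meas M le] in auto)
  then show ?thesis by (simp add: field_simps)
qed

text \<open>Two errors are separated: replacing the one-sided quotients by the slope costs Q
  \<delta> times the size of the truncated operator, and truncation costs |p| times a multiple of
  \<open>levy_core\<close>. The size of the truncated operator is bounded through the full one, with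
  the core at radius 1 making the bound uniform in \<delta>.\<close>

lemma nonlin_error:
  assumes q: "quad_touch A x p Q M" and \<delta>: "0 < \<delta>" "\<delta> \<le> 1"
  shows "\<bar>nonlin \<alpha> \<delta> A x - \<bar>p\<bar> * levy_op \<alpha> A x\<bar> \<le>
    \<bar>p\<bar> * (levy_const \<alpha> * Q * levy_core \<alpha> \<delta>)
      + (levy_const \<alpha> * (Q + M) * levy_mass \<alpha> + levy_const \<alpha> * Q * levy_core \<alpha> 1) * (Q * \<delta>)"
proof -
  note qd = quad_touchD[OF q]
  let ?c = "levy_trunc \<alpha> \<delta> A x"
  have "\<bar>nonlin \<alpha> \<delta> A x - \<bar>p\<bar> * ?c\<bar> \<le> \<bar>?c\<bar> * (Q * \<delta>)"
    unfolding nonlin_def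
  proof (rule flux_consistent)
    have "(A (x + \<delta>) - A x) / \<delta> - p = (A (x + \<delta>) - A x - p * \<delta>) / \<delta>" using \<delta> by (simp add: field_simps)
    then show "\<bar>(A (x + \<delta>) - A x) / \<delta> - p\<bar> \<le> Q * \<delta>"
      using qd(2)[of \<delta>] \<delta> by (simp add: divide_le_eq power2_eq_square mult.assoc)
    have "(A (x - \<delta>) - A x) / \<delta> + p = (A (x + - \<delta>) - A x - p * - \<delta>) / \<delta>" using \<delta> by (simp add: field_simps)
    then show "\<bar>(A (x - \<delta>) - A x) / \<delta> + p\<bar> \<le> Q * \<delta>"
      using qd(2)[of "-\<delta>"] \<delta> by (simp add: divide_le_eq power2_eq_square mult.assoc)
  qed
  moreover have e: "\<bar>levy_op \<alpha> A x - ?c\<bar> \<le> levy_const \<alpha> * Q * levy_core \<alpha> \<delta>"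
    by (rule levy_op_trunc[OF q \<delta>])
  moreover have "\<bar>?c\<bar> \<le> levy_const \<alpha> * (Q + M) * levy_mass \<alpha> + levy_const \<alpha> * Q * levy_core \<alpha> 1"
  proof -
    have "levy_const \<alpha> * Q * levy_core \<alpha> \<delta> \<le> levy_const \<alpha> * Q * levy_core \<alpha> 1"
      using levy_core_mono[OF \<delta>(2)] levy_const_pos qd(4) by (intro mult_left_mono) auto
    then show ?thesis using e levy_op_bound[OF q] by linarith
  qed
  then have "\<bar>?c\<bar> * (Q * \<delta>) \<le> (levy_const \<alpha> * (Q + M) * levy_mass \<alpha> + levy_const \<alpha> * Q * levy_core \<alpha> 1) * (Q * \<delta>)"
    using \<delta> qd(4) by (intro mult_right_mono) auto
  moreover have "\<bar>\<bar>p\<bar> * ?c - \<bar>p\<bar> * levy_op \<alpha> A x\<bar> \<le> \<bar>p\<bar> * (levy_const \<alpha> * Q * levy_core \<alpha> \<delta>)"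
    using e unfolding right_diff_distrib[symmetric] abs_mult by (simp add: abs_minus_commute mult_left_mono)
  ultimately show ?thesis by linarith
qed

text \<open>The threshold depends only on \<open>Q\<close>, \<open>M\<close>, \<open>R\<close> and
  \<open>e\<close>, uniformly in the function, the point and the slope; this order of quantifiers is
  what the comparison relies on.\<close>

lemma nonlin_consistent:
  assumes "0 < e"
  obtains \<delta>\<^sub>0 where "0 < \<delta>\<^sub>0" "\<forall>\<delta> A x p. 0 < \<delta> \<and> \<delta> \<le> \<delta>\<^sub>0 \<and> quad_touch A x p Q M \<and> \<bar>p\<bar> \<le> R \<longrightarrow>
    \<bar>nonlin \<alpha> \<delta> A x - \<bar>p\<bar> * levy_op \<alpha> A x\<bar> \<le> e"
proof -
  define K where "K = (levy_const \<alpha> * (Q + M) * levy_mass \<alpha> + levy_const \<alpha> * Q * levy_core \<alpha> 1) * Q"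
  let ?b = "\<lambda>\<delta>. R * (levy_const \<alpha> * Q * levy_core \<alpha> \<delta>) + K * \<delta>"
  have "(\<lambda>n. R * (levy_const \<alpha> * Q * levy_core \<alpha> (1 / real (Suc n))) + K * (1 / real (Suc n))) \<longlonglongrightarrow>
     R * (levy_const \<alpha> * Q * 0) + K * 0"
    using LIMSEQ_Suc[OF lim_1_over_n[where 'a = real]]
    by (intro tendsto_intros levy_core_tendsto) simp
  then have "\<forall>\<^sub>F n in sequentially. ?b (1 / real (Suc n)) < e"
    using assms by (intro order_tendstoD(2)[where y = 0]) simp_all
  then obtain n where n: "?b (1 / real (Suc n)) < e" by (auto simp: eventually_sequentially)
  show ?thesis
  proof (rule that[of "1 / real (Suc n)"])
    show "\<forall>\<delta> A x p. 0 < \<delta> \<and> \<delta> \<le> 1 / real (Suc n) \<and> quad_touch A x p Q M \<and> \<bar>p\<bar> \<le> R \<longrightarrow>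
      \<bar>nonlin \<alpha> \<delta> A x - \<bar>p\<bar> * levy_op \<alpha> A x\<bar> \<le> e"
    proof (intro allI impI)
      fix \<delta> A x p
      assume "0 < \<delta> \<and> \<delta> \<le> 1 / real (Suc n) \<and> quad_touch A x p Q M \<and> \<bar>p\<bar> \<le> R"
      then have *: "0 < \<delta>" "\<delta> \<le> 1 / real (Suc n)" "quad_touch A x p Q M" "\<bar>p\<bar> \<le> R" by auto
      note qd = quad_touchD(4,5)[OF *(3)]
      have "1 / real (Suc n) \<le> 1" by simp
      then have d1: "\<delta> \<le> 1" using *(2) by linarith
      have K: "0 \<le> K" unfolding K_def
        using qd levy_const_pos levy_mass_nonneg levy_core_nonneg by simp
      have "\<bar>p\<bar> * (levy_const \<alpha> * Q * levy_core \<alpha> \<delta>) \<le> R * (levy_const \<alpha> * Q * levy_core \<alpha> (1 / real (Suc n)))"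
        using * qd levy_const_pos levy_core_nonneg levy_core_mono[OF *(2)]
        by (intro mult_mono mult_left_mono) auto
      moreover have "K * \<delta> \<le> K * (1 / real (Suc n))" using K * by (intro mult_left_mono) auto
      ultimately show "\<bar>nonlin \<alpha> \<delta> A x - \<bar>p\<bar> * levy_op \<alpha> A x\<bar> \<le> e"
        using nonlin_error[OF *(3,1) d1] n unfolding K_def by (simp only: mult.assoc)
    qed
  qed simp
qed

end

section \<open>The monotone scheme\<close>

lemma nonlin_translate: "nonlin \<alpha> \<delta> (\<lambda>y. w (y + h)) x = nonlin \<alpha> \<delta> w (x + h)"
proof -
  have "w (x + z + h) = w (x + h + z)" "w (x - z + h) = w (x + h - z)" for z by (simp_all add: algebra_simps)
  then show ?thesis unfolding nonlin_def levy_trunc_def by (simp only:)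
qed

lemma nonlin_add_const: "nonlin \<alpha> \<delta> (\<lambda>y. w y + c) x = nonlin \<alpha> \<delta> w x"
  unfolding nonlin_def levy_trunc_def by (simp add: algebra_simps)

lemma nonlin_const: "nonlin \<alpha> \<delta> (\<lambda>y. c) x = 0"
  unfolding nonlin_def levy_trunc_def by simp

section \<open>Central second differences and local averages\<close>

definition diff2 :: "real \<Rightarrow> (real \<Rightarrow> real) \<Rightarrow> real \<Rightarrow> real" where
  "diff2 k w x = (w (x + k) + w (x - k) - 2 * w x) / k\<^sup>2"

text \<open>After subtracting the parabola with coefficient f''(x)/2, the second derivative is at
  most \<open>c\<close> near x, and Taylor's formula at both neighbours gives c/2 twice.\<close>

lemma diff2_error:
  fixes f f' f'' :: "real \<Rightarrow> real"
  assumes "0 < k" and f: "\<And>y. (f has_real_derivative f' y) (at y)" "\<And>y. (f' has_real_derivative f'' y) (at y)"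
    and c: "\<And>y. \<bar>y - x\<bar> \<le> k \<Longrightarrow> \<bar>f'' y - f'' x\<bar> \<le> c"
  shows "\<bar>diff2 k f x - f'' x\<bar> \<le> c"
proof -
  define g where "g y = f y - f'' x / 2 * (y - x)\<^sup>2" for y
  define g' where "g' y = f' y - f'' x * (y - x)" for y
  have g: "(g has_real_derivative g' y) (at y)" "(g' has_real_derivative (f'' y - f'' x)) (at y)" for y
    unfolding g_def[abs_def] g'_def[abs_def] by (auto intro!: derivative_eq_intros f)
  have "\<bar>g (x + z) - g x - g' x * z\<bar> \<le> (c / 2) * z\<^sup>2" if "\<bar>z\<bar> \<le> k" for z
    using c that by (intro taylor2_bound[OF g]) auto
  from this[of k] this[of "-k"] \<open>0 < k\<close>
  have "\<bar>g (x + k) - g x - g' x * k\<bar> \<le> c / 2 * k\<^sup>2" "\<bar>g (x - k) - g x + g' x * k\<bar> \<le> c / 2 * k\<^sup>2"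
    by simp_all
  then have "\<bar>g (x + k) + g (x - k) - 2 * g x\<bar> \<le> c * k\<^sup>2" by linarith
  then have "\<bar>f (x + k) + f (x - k) - 2 * f x - f'' x * k\<^sup>2\<bar> \<le> c * k\<^sup>2"
    by (simp add: g_def algebra_simps)
  moreover have "diff2 k f x - f'' x = (f (x + k) + f (x - k) - 2 * f x - f'' x * k\<^sup>2) / k\<^sup>2"
    using \<open>0 < k\<close> by (simp add: diff2_def diff_divide_distrib)
  ultimately show ?thesis using \<open>0 < k\<close> by (simp add: divide_le_eq)
qed

text \<open>The derivative of a right-sided average is a difference quotient, so averaging a
  continuous function twice gives a C2 function whose second derivative is an explicit second
  difference. Averaging also commutes with translations and linear combinations, hence with the
  linear part of the scheme.\<close>

definition avg :: "real \<Rightarrow> (real \<Rightarrow> real) \<Rightarrow> real \<Rightarrow> real" where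
  "avg m f x = integral {x..x + m} f / m"

context
  fixes m :: real
  assumes m: "0 < m"
begin

lemma avg_close:
  assumes "continuous_on UNIV f" "\<And>y. x \<le> y \<Longrightarrow> y \<le> x + m \<Longrightarrow> \<bar>f y - c\<bar> \<le> k"
  shows "\<bar>avg m f x - c\<bar> \<le> k"
proof -
  have f: "continuous_on {x..x + m} f" using assms(1) continuous_on_subset by blast
  have "integral {x..x + m} (\<lambda>y. f y - c) = integral {x..x + m} f - m * c"
    using m by (subst Henstock_Kurzweil_Integration.integral_diff) (auto intro: integrable_continuous_real f)
  moreover have "norm (integral {x..x + m} (\<lambda>y. f y - c)) \<le> k * (x + m - x)"
    using m assms(2) by (intro integral_bound) (auto intro!: continuous_intros f)
  ultimately have "\<bar>integral {x..x + m} f - m * c\<bar> \<le> k * m" by simp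
  moreover have "avg m f x - c = (integral {x..x + m} f - m * c) / m"
    using m by (simp add: avg_def diff_divide_distrib)
  ultimately show ?thesis using m by (simp add: divide_le_eq)
qed

lemma avg_cmult_add:
  assumes "continuous_on UNIV f" "continuous_on UNIV g"
  shows "avg m (\<lambda>y. a * f y + b * g y) x = a * avg m f x + b * avg m g x"
proof -
  have fg: "continuous_on {x..x + m} f" "continuous_on {x..x + m} g"
    using assms continuous_on_subset by blast+
  have "integral {x..x + m} (\<lambda>y. a * f y + b * g y) = a * integral {x..x + m} f + b * integral {x..x + m} g"
    by (subst Henstock_Kurzweil_Integration.integral_add)
      (auto intro!: integrable_continuous_real continuous_intros fg)
  then show ?thesis by (simp add: avg_def add_divide_distrib)
qed

lemma avg_translate:
  assumes "continuous_on UNIV f"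
  shows "avg m (\<lambda>y. f (y + h)) x = avg m f (x + h)"
proof -
  have "integral {x..x + m} (f \<circ> (\<lambda>y. y + h)) = integral {x + h..x + m + h} f"
    using assms continuous_on_subset by (intro integral_shift) blast
  then show ?thesis by (simp add: avg_def comp_def algebra_simps)
qed

lemma avg_DERIV:
  assumes "continuous_on UNIV f"
  shows "(avg m f has_real_derivative (f (x + m) - f x) / m) (at x)"
proof -
  \<comment> \<open>A base point to the left of x, so that the integral from \<open>a\<close> is
    differentiable in a two-sided neighbourhood of x.\<close>
  define a where "a = x - 1"
  have cont: "continuous_on A f" for A using assms continuous_on_subset by blast
  have F: "((\<lambda>y. integral {a..y} f) has_real_derivative f y) (at y)" if "a < y" for y
  proof -
    have "((\<lambda>y. integral {a..y} f) has_vector_derivative f y) (at y within {a..y + 1})"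
      using that by (intro integral_has_vector_derivative cont) auto
    then have "((\<lambda>y. integral {a..y} f) has_vector_derivative f y) (at y within {a<..<y + 1})"
      by (rule has_vector_derivative_within_subset) auto
    moreover have "at y within {a<..<y + 1} = at y" using that by (intro at_within_open) auto
    ultimately show ?thesis by (simp only: has_real_derivative_iff_has_vector_derivative)
  qed
  have "((\<lambda>y. (integral {a..y + m} f - integral {a..y} f) / m) has_real_derivative (f (x + m) - f x) / m) (at x)"
  proof (rule DERIV_cdivide[OF DERIV_diff])
    show "((\<lambda>y. integral {a..y + m} f) has_real_derivative f (x + m)) (at x)"
      using DERIV_chain2[OF F DERIV_add[OF DERIV_ident DERIV_const], of x m] m by (simp add: a_def)
    show "((\<lambda>y. integral {a..y} f) has_real_derivative f x) (at x)" by (rule F) (simp add: a_def)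
  qed
  then show ?thesis
  proof (rule has_field_derivative_transform_within_open[where S = "{a<..}"])
    fix y assume "y \<in> {a<..}"
    then have "integral {a..y} f + integral {y..y + m} f = integral {a..y + m} f"
      using m by (intro Henstock_Kurzweil_Integration.integral_combine integrable_continuous_real cont) auto
    then show "(integral {a..y + m} f - integral {a..y} f) / m = avg m f y" by (simp add: avg_def)
  qed (auto simp: a_def)
qed

lemma avg_continuous:
  assumes "continuous_on UNIV f" shows "continuous_on UNIV (avg m f)"
  by (meson assms avg_DERIV DERIV_isCont continuous_at_imp_continuous_on)

lemma avg_avg_close:
  assumes f: "continuous_on UNIV f" "\<And>y. x \<le> y \<Longrightarrow> y \<le> x + 2 * m \<Longrightarrow> \<bar>f y - c\<bar> \<le> k"
  shows "\<bar>avg m (avg m f) x - c\<bar> \<le> k"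
  using m by (intro avg_close avg_continuous f) auto

end

section \<open>Affine interpolation in time\<close>

definition interp :: "real \<Rightarrow> (nat \<Rightarrow> real) \<Rightarrow> real \<Rightarrow> real" where
  "interp \<tau> a t = (let n = nat \<lfloor>t / \<tau>\<rfloor> in a n + (t / \<tau> - real n) * (a (Suc n) - a n))"

context
  fixes \<tau> :: real
  assumes \<tau>: "0 < \<tau>"
begin

text \<open>The right end point is included: there the floor selects the next cell, and the two
  affine pieces agree.\<close>

lemma interp_cell:
  assumes "real n * \<tau> \<le> t" "t \<le> real (Suc n) * \<tau>"
  shows "interp \<tau> a t = a n + (t / \<tau> - real n) * (a (Suc n) - a n)"
proof (cases "t = real (Suc n) * \<tau>")
  case True
  then have "t / \<tau> = real (Suc n)" using \<tau> by simp
  moreover from this have "nat \<lfloor>t / \<tau>\<rfloor> = Suc n" by (metis floor_of_nat nat_int)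
  ultimately show ?thesis by (simp add: interp_def)
next
  case False
  then have "real n \<le> t / \<tau>" "t / \<tau> < real n + 1" using \<tau> assms by (auto simp: field_simps)
  then have "\<lfloor>t / \<tau>\<rfloor> = int n" by (intro floor_unique) auto
  then show ?thesis by (simp add: interp_def)
qed

lemma interp_grid: "interp \<tau> a (real n * \<tau>) = a n"
  using interp_cell[of n "real n * \<tau>" a] \<tau> by (simp add: mult_right_mono)

lemma interp_cell_ex:
  assumes "0 \<le> t"
  obtains n where "real n * \<tau> \<le> t" "t \<le> real (Suc n) * \<tau>"
proof -
  have "0 \<le> t / \<tau>" using assms \<tau> by simp
  then have "real (nat \<lfloor>t / \<tau>\<rfloor>) \<le> t / \<tau>" "t / \<tau> \<le> real (Suc (nat \<lfloor>t / \<tau>\<rfloor>))" by linarith+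
  then show ?thesis using that[of "nat \<lfloor>t / \<tau>\<rfloor>"] \<tau> by (simp add: le_divide_eq divide_le_eq)
qed

text \<open>The cell is open on the left, so that t - r stays in the same affine piece for small r >
  0.\<close>

lemma interp_left_cell_ex:
  assumes "0 < t"
  obtains n where "real n * \<tau> < t" "t \<le> real (Suc n) * \<tau>"
proof -
  have "0 < t / \<tau>" using assms \<tau> by simp
  then have "real (nat (\<lceil>t / \<tau>\<rceil> - 1)) < t / \<tau>" "t / \<tau> \<le> real (Suc (nat (\<lceil>t / \<tau>\<rceil> - 1)))" by linarith+
  then show ?thesis using that[of "nat (\<lceil>t / \<tau>\<rceil> - 1)"] \<tau> by (simp add: less_divide_eq divide_le_eq)
qed

text \<open>The weight is the same for all sequences, so interpolation at a fixed time commutes with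
  space derivatives.\<close>

lemma interp_convex:
  assumes "real n * \<tau> \<le> t" "t \<le> real (Suc n) * \<tau>"
  obtains s where "0 \<le> s" "s \<le> 1" "\<forall>a. interp \<tau> a t = (1 - s) * a n + s * a (Suc n)"
proof (rule that[of "t / \<tau> - real n"])
  show "\<forall>a. interp \<tau> a t = (1 - (t / \<tau> - real n)) * a n + (t / \<tau> - real n) * a (Suc n)"
    using interp_cell[OF assms] by (simp add: algebra_simps)
qed (use assms \<tau> in \<open>auto simp: field_simps\<close>)

lemma interp_lipschitz:
  assumes a: "\<And>n. \<bar>a (Suc n) - a n\<bar> \<le> L * \<tau>" and "0 \<le> s" "0 \<le> t"
  shows "\<bar>interp \<tau> a t - interp \<tau> a s\<bar> \<le> L * \<bar>t - s\<bar>"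
proof -
  have "0 \<le> L * \<tau>" using order_trans[OF abs_ge_zero a] .
  then have L: "0 \<le> L" using \<tau> by (simp add: zero_le_mult_iff)
  have aj: "\<bar>a (j + d) - a j\<bar> \<le> L * (real d * \<tau>)" for j d
  proof (induction d)
    case (Suc d)
    then have "\<bar>a (j + Suc d) - a j\<bar> \<le> L * \<tau> + L * (real d * \<tau>)" using a[of "j + d"] by simp
    then show ?case by (simp add: algebra_simps)
  qed simp
  have cell: "\<bar>interp \<tau> a t - interp \<tau> a s\<bar> \<le> L * \<bar>t - s\<bar>"
    if "real n * \<tau> \<le> t" "t \<le> real (Suc n) * \<tau>" "real n * \<tau> \<le> s" "s \<le> real (Suc n) * \<tau>" for n s t
  proof -
    have "interp \<tau> a t - interp \<tau> a s = (t - s) / \<tau> * (a (Suc n) - a n)"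
      unfolding interp_cell[OF that(1,2)] interp_cell[OF that(3,4)] by (simp add: field_simps diff_divide_distrib)
    then have "\<bar>interp \<tau> a t - interp \<tau> a s\<bar> = \<bar>t - s\<bar> / \<tau> * \<bar>a (Suc n) - a n\<bar>"
      using \<tau> by (simp add: abs_mult)
    also have "\<dots> \<le> \<bar>t - s\<bar> / \<tau> * (L * \<tau>)" using a[of n] \<tau> by (intro mult_left_mono) auto
    finally show ?thesis using \<tau> by (simp add: mult.commute)
  qed
  have above: "\<bar>interp \<tau> a t - a j\<bar> \<le> L * (t - real j * \<tau>)" if "real j * \<tau> \<le> t" for j t
  proof -
    have "0 \<le> t" using that \<tau> by (meson mult_nonneg_nonneg of_nat_0_le_iff order_trans less_imp_le)
    then obtain n where n: "real n * \<tau> \<le> t" "t \<le> real (Suc n) * \<tau>" by (rule interp_cell_ex)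
    show ?thesis
    proof (cases "j \<le> n")
      case True
      have "\<bar>interp \<tau> a t - a n\<bar> \<le> L * (t - real n * \<tau>)"
        using cell[OF n, of "real n * \<tau>"] n \<tau> interp_grid[of a n] by (simp add: mult_right_mono)
      moreover have "\<bar>a n - a j\<bar> \<le> L * (real (n - j) * \<tau>)" using aj[of j "n - j"] True by simp
      moreover have "real (n - j) = real n - real j" using True by (rule of_nat_diff)
      ultimately show ?thesis by (simp add: algebra_simps)
    next
      case False
      then have "real (Suc n) * \<tau> \<le> real j * \<tau>" using \<tau> by (intro mult_right_mono) linarith+
      then have "t = real j * \<tau>" using that n by linarith
      then show ?thesis using interp_grid[of a j] by simp
    qed
  qed
  have below: "\<bar>interp \<tau> a s - a j\<bar> \<le> L * (real j * \<tau> - s)" if "s \<le> real j * \<tau>" "0 \<le> s" for j s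
  proof -
    obtain n where n: "real n * \<tau> \<le> s" "s \<le> real (Suc n) * \<tau>" using \<open>0 \<le> s\<close> by (rule interp_cell_ex)
    show ?thesis
    proof (cases "Suc n \<le> j")
      case True
      have "\<bar>interp \<tau> a s - a (Suc n)\<bar> \<le> L * (real (Suc n) * \<tau> - s)"
        using cell[OF n, of "real (Suc n) * \<tau>"] n \<tau> interp_grid[of a "Suc n"] by (simp add: mult_right_mono)
      moreover have "\<bar>a j - a (Suc n)\<bar> \<le> L * (real (j - Suc n) * \<tau>)" using aj[of "Suc n" "j - Suc n"] True by simp
      moreover have "real (j - Suc n) = real j - real (Suc n)" using True by (rule of_nat_diff)
      ultimately show ?thesis by (simp add: algebra_simps)
    next
      case False
      then have "real j * \<tau> \<le> real n * \<tau>" using \<tau> by (intro mult_right_mono) linarith+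
      then have "s = real j * \<tau>" using that n by linarith
      then show ?thesis using interp_grid[of a j] by simp
    qed
  qed
  have main: "\<bar>interp \<tau> a t - interp \<tau> a s\<bar> \<le> L * \<bar>t - s\<bar>" if "0 \<le> s" "s \<le> t" for s t
  proof -
    have "0 \<le> t" using that by simp
    then obtain n where n: "real n * \<tau> \<le> t" "t \<le> real (Suc n) * \<tau>" by (rule interp_cell_ex)
    show ?thesis
    proof (cases "real n * \<tau> \<le> s")
      case True
      then show ?thesis using cell[OF n True] that n by simp
    next
      case False
      \<comment> \<open>Here the grid point n \<tau> lies between s and t, and the two bounds add
        up.\<close>
      then show ?thesis using above[OF n(1)] below[of s n] that n by (simp add: algebra_simps)
    qed
  qed
  show ?thesis using main[of s t] main[of t s] assms by (cases "s \<le> t") (simp_all add: abs_minus_commute)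
qed

end

section \<open>Explicit Euler steps\<close>

definition euler_step :: "real \<Rightarrow> real \<Rightarrow> real \<Rightarrow> real \<Rightarrow> real \<Rightarrow> (real \<Rightarrow> real) \<Rightarrow> real \<Rightarrow> real" where
  "euler_step \<alpha> \<eta> \<delta> k \<tau> w x = w x + \<tau> * (\<eta> * diff2 k w x + nonlin \<alpha> \<delta> w x)"

lemma euler_step_translate: "euler_step \<alpha> \<eta> \<delta> k \<tau> (\<lambda>y. w (y + h)) x = euler_step \<alpha> \<eta> \<delta> k \<tau> w (x + h)"
  unfolding euler_step_def nonlin_translate diff2_def by (simp add: algebra_simps)

lemma euler_step_add_const: "euler_step \<alpha> \<eta> \<delta> k \<tau> (\<lambda>y. w y + c) x = euler_step \<alpha> \<eta> \<delta> k \<tau> w x + c"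
  unfolding euler_step_def nonlin_add_const diff2_def by simp

lemma euler_step_const: "euler_step \<alpha> \<eta> \<delta> k \<tau> (\<lambda>y. c) x = c"
  unfolding euler_step_def nonlin_const diff2_def by simp

context levy_exponent begin

text \<open>The hypothesis v <= w does not order increments: those of v may exceed those of w by d =
  w x - v x. Lowering the operator by K d and both quotients by d/\<delta> restores the order, and
  \<open>flux_lipschitz\<close> bounds the cost of this change. The resulting factor is the nonlocal
  part of the CFL condition.\<close>

lemma nonlin_mono_gap:
  assumes \<delta>: "0 < \<delta>" and meas: "v \<in> borel_measurable borel" "w \<in> borel_measurable borel"
    and M: "\<And>y. \<bar>v y\<bar> \<le> M" "\<And>y. \<bar>w y\<bar> \<le> M" and le: "\<And>y. v y \<le> w y"
  shows "nonlin \<alpha> \<delta> v x \<le> nonlin \<alpha> \<delta> w x + 16 * levy_const \<alpha> * levy_tail \<alpha> \<delta> * M / \<delta> * (w x - v x)"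
proof -
  define K where "K = levy_const \<alpha> * levy_tail \<alpha> \<delta>"
  define d where "d = w x - v x"
  have K: "0 \<le> K" using levy_const_pos levy_tail_nonneg by (simp add: K_def)
  have d: "0 \<le> d" "d \<le> 2 * M" using le[of x] M(1)[of x] M(2)[of x] by (auto simp: d_def)
  let ?c = "levy_trunc \<alpha> \<delta> v x" and ?a = "(v (x + \<delta>) - v x) / \<delta>" and ?b = "(v (x - \<delta>) - v x) / \<delta>"
  have "v y - v x \<le> w y - w x + d" for y using le[of y] by (simp add: d_def)
  then have "?c \<le> levy_trunc \<alpha> \<delta> w x + K * d"
    unfolding K_def by (rule levy_trunc_mono_gap[OF \<delta> meas M])
  then have m: "flux (?c - K * d) (?a - d / \<delta>) (?b - d / \<delta>) \<le> nonlin \<alpha> \<delta> w x"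
    unfolding nonlin_def using le[of "x + \<delta>"] le[of "x - \<delta>"] \<delta>
    by (intro flux_mono) (auto simp: d_def diff_divide_distrib[symmetric] divide_le_cancel)
  have c: "\<bar>?c\<bar> \<le> K * (2 * M)" unfolding K_def by (rule levy_trunc_bound[OF \<delta> meas(1) M(1)])
  have Kd: "0 \<le> K * d" "K * d \<le> K * (2 * M)" using K d by (simp_all add: mult_left_mono)
  have q: "\<bar>(v y - v x) / \<delta>\<bar> \<le> 4 * M / \<delta>" "\<bar>(v y - v x) / \<delta> - d / \<delta>\<bar> \<le> 4 * M / \<delta>" for y
    unfolding diff_divide_distrib[symmetric]
    using \<delta> M(1)[of y] M(1)[of x] d by (auto simp: divide_le_cancel)
  have "\<bar>flux ?c ?a ?b - flux (?c - K * d) (?a - d / \<delta>) (?b - d / \<delta>)\<bar> \<le> 2 * (K * d * (4 * M / \<delta>) + K * (4 * M) * (d / \<delta>))"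
    using c Kd \<delta> d by (intro flux_lipschitz q) (auto simp: abs_le_iff)
  also have "\<dots> = 16 * K * M / \<delta> * d" using \<delta> by (simp add: field_simps)
  finally have "flux ?c ?a ?b \<le> flux (?c - K * d) (?a - d / \<delta>) (?b - d / \<delta>) + 16 * K * M / \<delta> * d" by linarith
  then show ?thesis using m unfolding nonlin_def[of _ _ v] K_def d_def by (simp add: mult.assoc)
qed

end

section \<open>Smooth functions of space and approximate flows\<close>

definition C2_derivs :: "(real \<Rightarrow> real) \<Rightarrow> (real \<Rightarrow> real) \<Rightarrow> (real \<Rightarrow> real) \<Rightarrow> bool" where
  "C2_derivs f f1 f2 \<longleftrightarrow> (\<forall>x. (f has_real_derivative f1 x) (at x)) \<and>
     (\<forall>x. (f1 has_real_derivative f2 x) (at x)) \<and> continuous_on UNIV f2"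

lemma C2_derivs_continuous:
  assumes "C2_derivs f f1 f2"
  shows "continuous_on UNIV f" "continuous_on UNIV f1" "continuous_on UNIV f2"
  using assms unfolding C2_derivs_def
  by (meson DERIV_isCont continuous_at_imp_continuous_on)+

lemma C2_derivs_bump: "C2_derivs (\<lambda>x. k * bump (x - a)) (\<lambda>x. k * bump1 (x - a)) (\<lambda>x. k * bump2 (x - a))"
  unfolding C2_derivs_def
proof (intro conjI allI)
  fix x
  show "((\<lambda>x. k * bump (x - a)) has_real_derivative k * bump1 (x - a)) (at x)"
    using DERIV_cmult[OF bump_deriv[of "x + - a", unfolded DERIV_shift]] by simp
  show "((\<lambda>x. k * bump1 (x - a)) has_real_derivative k * bump2 (x - a)) (at x)"
    using DERIV_cmult[OF bump1_deriv[of "x + - a", unfolded DERIV_shift]] by simp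
  show "continuous_on UNIV (\<lambda>x. k * bump2 (x - a))"
    by (intro continuous_intros continuous_on_compose2[OF bump_continuous(3)[of UNIV]]) auto
qed

lemma C2_derivs_add:
  assumes "C2_derivs f f1 f2" "C2_derivs g g1 g2"
  shows "C2_derivs (\<lambda>x. f x + g x) (\<lambda>x. f1 x + g1 x) (\<lambda>x. f2 x + g2 x)"
  using assms unfolding C2_derivs_def by (auto intro!: DERIV_add continuous_intros)

lemma C2_derivs_translate:
  assumes "C2_derivs f f1 f2"
  shows "C2_derivs (\<lambda>x. f (x + h)) (\<lambda>x. f1 (x + h)) (\<lambda>x. f2 (x + h))"
  using assms unfolding C2_derivs_def DERIV_shift[symmetric]
  by (auto intro!: continuous_on_compose2[of UNIV f2] continuous_intros)

text \<open>For |z| <= 1 Taylor's formula gives the coefficient C/2. For |z| > 1 both 1 and |z| are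
  at most z^2, which absorbs the supremum bound and the slope. The sum of the three serves
  everywhere.\<close>

lemma C2_derivs_quad_touch_bound:
  assumes f: "C2_derivs f f1 f2"
    and B: "\<And>y. \<bar>f y\<bar> \<le> B" and P: "\<bar>f1 x\<bar> \<le> P" and C: "\<And>y. \<bar>y - x\<bar> \<le> 1 \<Longrightarrow> \<bar>f2 y\<bar> \<le> C"
  shows "quad_touch f x (f1 x) (C / 2 + 2 * B + P) (2 * B)"
proof -
  have C0: "0 \<le> C" using C[of x] by force
  have B0: "0 \<le> B" using B[of 0] by linarith
  have P0: "0 \<le> P" using P by linarith
  have "\<bar>f (x + z) - f x - f1 x * z\<bar> \<le> (C / 2 + 2 * B + P) * z\<^sup>2" for z
  proof (cases "\<bar>z\<bar> \<le> 1")
    case True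
    have "\<bar>f (x + z) - f x - f1 x * z\<bar> \<le> (C / 2) * z\<^sup>2"
      using C True f unfolding C2_derivs_def by (intro taylor2_bound[where f'' = f2]) auto
    also have "\<dots> \<le> (C / 2 + 2 * B + P) * z\<^sup>2" using B0 P0 by (intro mult_right_mono) auto
    finally show ?thesis .
  next
    case False
    then have z: "1 \<le> z\<^sup>2" "\<bar>z\<bar> \<le> z\<^sup>2"
      using abs_le_square_iff[of 1 z] mult_left_mono[of 1 "\<bar>z\<bar>" "\<bar>z\<bar>"] by (auto simp: power2_eq_square abs_mult[symmetric])
    have "\<bar>f (x + z) - f x - f1 x * z\<bar> \<le> \<bar>f (x + z)\<bar> + \<bar>f x\<bar> + \<bar>f1 x * z\<bar>" by linarith
    also have "\<dots> \<le> 2 * B * 1 + \<bar>f1 x\<bar> * \<bar>z\<bar>" using B[of "x + z"] B[of x] by (simp add: abs_mult)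
    also have "\<dots> \<le> 2 * B * z\<^sup>2 + P * z\<^sup>2" using z B0 P by (intro add_mono mult_left_mono mult_mono) auto
    also have "\<dots> \<le> (C / 2 + 2 * B + P) * z\<^sup>2" using C0 by (simp add: distrib_right)
    finally show ?thesis .
  qed
  moreover have "\<bar>f (x + z) - f x\<bar> \<le> 2 * B" for z using B[of "x + z"] B[of x] by linarith
  moreover have "f \<in> borel_measurable borel"
    by (rule borel_measurable_continuous_onI[OF C2_derivs_continuous(1)[OF f]])
  ultimately show ?thesis by (simp add: quad_touch_def)
qed

lemma C2_derivs_quad_touch:
  assumes f: "C2_derivs f f1 f2" and B: "\<And>x. \<bar>f x\<bar> \<le> B"
  obtains Q M where "quad_touch f x (f1 x) Q M"
proof -
  have "compact (f2 ` {x - 1..x + 1})"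
    using C2_derivs_continuous(3)[OF f] by (intro compact_continuous_image) (auto intro: continuous_on_subset)
  then have "bounded (f2 ` {x - 1..x + 1})" by (rule compact_imp_bounded)
  then obtain C where C: "\<forall>v\<in>f2 ` {x - 1..x + 1}. \<bar>v\<bar> \<le> C" unfolding bounded_iff real_norm_def by blast
  show ?thesis
  proof (rule that, rule C2_derivs_quad_touch_bound[OF f B order_refl])
    fix y assume "\<bar>y - x\<bar> \<le> 1"
    then have "f2 y \<in> f2 ` {x - 1..x + 1}" by (intro imageI) auto
    then show "\<bar>f2 y\<bar> \<le> C" using C by blast
  qed
qed

text \<open>Only left difference quotients in time occur because the approximations are piecewise affine in time.\<close>

definition residual_le ::
  "real \<Rightarrow> real \<Rightarrow> real \<Rightarrow> real \<Rightarrow> (real \<times> real \<Rightarrow> real) \<Rightarrow> (real \<Rightarrow> real \<Rightarrow> real) \<Rightarrow> bool" where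
  "residual_le \<alpha> \<eta> \<delta> e W W2 \<longleftrightarrow> (\<forall>t>0. \<exists>r\<^sub>0>0. \<forall>x r. 0 < r \<and> r \<le> r\<^sub>0 \<longrightarrow>
     \<bar>(W (x, t) - W (x, t - r)) / r - (\<eta> * W2 t x + nonlin \<alpha> \<delta> (\<lambda>y. W (y, t)) x)\<bar> \<le> e)"

text \<open>The Lipschitz constant in time is existential and may depend on the flow: the doubling
  argument uses it to choose the time penalty, after which no estimate depends on it.\<close>

definition approx_flow :: "real \<Rightarrow> real \<Rightarrow> real \<Rightarrow> real \<Rightarrow> real \<Rightarrow> (real \<times> real \<Rightarrow> real) \<Rightarrow> bool" where
  "approx_flow \<alpha> \<eta> \<delta> M e W \<longleftrightarrow>
     (\<forall>x. \<forall>t\<ge>0. \<bar>W (x, t)\<bar> \<le> M) \<and> continuous_on closed_domain W \<and>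
     (\<exists>L. \<forall>x. \<forall>s\<ge>0. \<forall>t\<ge>0. \<bar>W (x, t) - W (x, s)\<bar> \<le> L * \<bar>t - s\<bar>) \<and>
     (\<exists>W1 W2. (\<forall>t\<ge>0. C2_derivs (\<lambda>y. W (y, t)) (W1 t) (W2 t)) \<and> residual_le \<alpha> \<eta> \<delta> e W W2)"

lemma continuous_on_closed_domain_if_lipschitz_in_time:
  fixes W :: "real \<times> real \<Rightarrow> real"
  assumes L: "\<And>x s t. 0 \<le> s \<Longrightarrow> 0 \<le> t \<Longrightarrow> \<bar>W (x, t) - W (x, s)\<bar> \<le> L * \<bar>t - s\<bar>"
    and c: "\<And>t. 0 \<le> t \<Longrightarrow> continuous_on UNIV (\<lambda>x. W (x, t))"
  shows "continuous_on closed_domain W"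
  unfolding continuous_on_def
proof
  fix p assume p: "p \<in> closed_domain"
  obtain x t where xt: "p = (x, t)" "0 \<le> t" using p by (cases p) (auto simp: closed_domain_def)
  let ?F = "at p within closed_domain"
  have id: "((\<lambda>q. q) \<longlongrightarrow> p) ?F" by (rule tendsto_ident_at)
  have "isCont (\<lambda>y. W (y, t)) x" using c[OF xt(2)] by (simp add: continuous_on_eq_continuous_at)
  then have "((\<lambda>y. W (y, t)) \<longlongrightarrow> W (x, t)) (nhds x)" unfolding isCont_def using tendsto_at_iff_tendsto_nhds by metis
  moreover have "filterlim fst (nhds x) ?F" using tendsto_fst[OF id] xt by simp
  ultimately have 1: "((\<lambda>q. W (fst q, t)) \<longlongrightarrow> W p) ?F" using xt by (auto intro: filterlim_compose)
  have "((\<lambda>q. L * \<bar>snd q - t\<bar>) \<longlongrightarrow> L * \<bar>snd p - t\<bar>) ?F" by (intro tendsto_intros id)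
  then have "((\<lambda>q. L * \<bar>snd q - t\<bar>) \<longlongrightarrow> 0) ?F" using xt by simp
  then have 2: "((\<lambda>q. W q - W (fst q, t)) \<longlongrightarrow> 0) ?F"
  proof (rule Lim_null_comparison[rotated])
    show "\<forall>\<^sub>F q in ?F. norm (W q - W (fst q, t)) \<le> L * \<bar>snd q - t\<bar>"
      unfolding eventually_at_filter using L xt(2) by (intro always_eventually) (auto simp: closed_domain_def)
  qed
  show "(W \<longlongrightarrow> W p) ?F" using tendsto_add[OF 2 1] by simp
qed

context levy_exponent begin

text \<open>Raising the value at the centre by d lowers the discretised right-hand side by at most
  the bracket in \<open>cfl\<close> times d, while the explicit term gains d. The CFL condition says
  that the gain prevails.\<close>

lemma euler_step_mono:
  assumes "0 < \<delta>" "0 < k" "0 < \<tau>" "0 \<le> \<eta>"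
    and cfl: "\<tau> * (2 * \<eta> / k\<^sup>2 + 16 * levy_const \<alpha> * levy_tail \<alpha> \<delta> * M / \<delta>) \<le> 1"
    and meas: "v \<in> borel_measurable borel" "w \<in> borel_measurable borel"
    and M: "\<And>y. \<bar>v y\<bar> \<le> M" "\<And>y. \<bar>w y\<bar> \<le> M" and le: "\<And>y. v y \<le> w y"
  shows "euler_step \<alpha> \<eta> \<delta> k \<tau> v x \<le> euler_step \<alpha> \<eta> \<delta> k \<tau> w x"
proof -
  let ?K = "16 * levy_const \<alpha> * levy_tail \<alpha> \<delta> * M / \<delta>"
  define d where "d = w x - v x"
  have "0 \<le> d" using le by (simp add: d_def)
  have "diff2 k v x - 2 / k\<^sup>2 * d \<le> diff2 k w x"
  proof -
    have "diff2 k v x - 2 / k\<^sup>2 * d = (v (x + k) + v (x - k) - 2 * w x) / k\<^sup>2"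
      by (simp add: diff2_def d_def diff_divide_distrib add_divide_distrib algebra_simps)
    also have "\<dots> \<le> diff2 k w x"
      unfolding diff2_def using le[of "x + k"] le[of "x - k"] by (intro divide_right_mono) auto
    finally show ?thesis .
  qed
  then have "\<eta> * (diff2 k v x - 2 / k\<^sup>2 * d) \<le> \<eta> * diff2 k w x" using \<open>0 \<le> \<eta>\<close> by (rule mult_left_mono)
  moreover have "nonlin \<alpha> \<delta> v x \<le> nonlin \<alpha> \<delta> w x + ?K * d"
    unfolding d_def by (rule nonlin_mono_gap[OF \<open>0 < \<delta>\<close> meas M le])
  ultimately have "\<eta> * diff2 k v x + nonlin \<alpha> \<delta> v x \<le> \<eta> * diff2 k w x + nonlin \<alpha> \<delta> w x + (2 * \<eta> / k\<^sup>2 + ?K) * d"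
    by (simp add: algebra_simps)
  then have "\<tau> * (\<eta> * diff2 k v x + nonlin \<alpha> \<delta> v x) \<le> \<tau> * (\<eta> * diff2 k w x + nonlin \<alpha> \<delta> w x + (2 * \<eta> / k\<^sup>2 + ?K) * d)"
    using \<open>0 < \<tau>\<close> by (intro mult_left_mono) auto
  also have "\<dots> = \<tau> * (\<eta> * diff2 k w x + nonlin \<alpha> \<delta> w x) + (\<tau> * (2 * \<eta> / k\<^sup>2 + ?K)) * d"
    by (simp add: algebra_simps)
  also have "\<dots> \<le> \<tau> * (\<eta> * diff2 k w x + nonlin \<alpha> \<delta> w x) + 1 * d"
    using cfl \<open>0 \<le> d\<close> by (intro add_left_mono mult_right_mono) auto
  finally show ?thesis by (simp add: euler_step_def d_def)
qed

lemma euler_step_bound: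
  assumes "0 < \<delta>" "0 < k" "0 < \<tau>" "0 \<le> \<eta>"
    and cfl: "\<tau> * (2 * \<eta> / k\<^sup>2 + 16 * levy_const \<alpha> * levy_tail \<alpha> \<delta> * M / \<delta>) \<le> 1"
    and meas: "w \<in> borel_measurable borel" and M: "\<And>y. \<bar>w y\<bar> \<le> M"
  shows "\<bar>euler_step \<alpha> \<eta> \<delta> k \<tau> w x\<bar> \<le> M"
proof -
  have "\<bar>M\<bar> \<le> M" using M[of 0] by linarith
  have "- M \<le> w y" "w y \<le> M" for y using M[of y] by (auto simp: abs_le_iff)
  then have "euler_step \<alpha> \<eta> \<delta> k \<tau> (\<lambda>_. - M) x \<le> euler_step \<alpha> \<eta> \<delta> k \<tau> w x"
    "euler_step \<alpha> \<eta> \<delta> k \<tau> w x \<le> euler_step \<alpha> \<eta> \<delta> k \<tau> (\<lambda>_. M) x"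
    using assms \<open>\<bar>M\<bar> \<le> M\<close> by (auto intro!: euler_step_mono[OF assms(1-5)])
  then show ?thesis unfolding euler_step_const by simp
qed

text \<open>A monotone map that commutes with the addition of constants is nonexpansive in the
  supremum norm, since v <= w + c passes to the images.\<close>

lemma euler_step_contraction:
  assumes pos: "0 < \<delta>" "0 < k" "0 < \<tau>" "0 \<le> \<eta>"
    and cfl: "\<tau> * (2 * \<eta> / k\<^sup>2 + 16 * levy_const \<alpha> * levy_tail \<alpha> \<delta> * (3 * M) / \<delta>) \<le> 1"
    and meas: "v \<in> borel_measurable borel" "w \<in> borel_measurable borel"
    and M: "\<And>y. \<bar>v y\<bar> \<le> M" "\<And>y. \<bar>w y\<bar> \<le> M" and c: "\<And>y. \<bar>v y - w y\<bar> \<le> c"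
  shows "\<bar>euler_step \<alpha> \<eta> \<delta> k \<tau> v x - euler_step \<alpha> \<eta> \<delta> k \<tau> w x\<bar> \<le> c"
proof -
  have *: "euler_step \<alpha> \<eta> \<delta> k \<tau> v x \<le> euler_step \<alpha> \<eta> \<delta> k \<tau> w x + c"
    if meas: "v \<in> borel_measurable borel" "w \<in> borel_measurable borel"
    and M: "\<And>y. \<bar>v y\<bar> \<le> M" "\<And>y. \<bar>w y\<bar> \<le> M" and c: "\<And>y. \<bar>v y - w y\<bar> \<le> c" for v w
  proof -
    have M0: "0 \<le> M" using order_trans[OF abs_ge_zero M(1)] .
    have c0: "0 \<le> c" using order_trans[OF abs_ge_zero c] .
    \<comment> \<open>The shift is capped at 2 M, which already dominates v - w. Thus w + c' stays
      within 3 M, the bound for which the CFL condition is assumed.\<close>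
    define c' where "c' = min c (2 * M)"
    have "euler_step \<alpha> \<eta> \<delta> k \<tau> v x \<le> euler_step \<alpha> \<eta> \<delta> k \<tau> (\<lambda>y. w y + c') x"
    proof (rule euler_step_mono[OF pos cfl meas(1)])
      fix y
      show "\<bar>v y\<bar> \<le> 3 * M" using M(1)[of y] by linarith
      show "\<bar>w y + c'\<bar> \<le> 3 * M" using M(2)[of y] M0 c0 unfolding c'_def by linarith
      show "v y \<le> w y + c'" using M(1)[of y] M(2)[of y] c[of y] unfolding c'_def by linarith
    qed (use meas in measurable)
    then show ?thesis unfolding euler_step_add_const c'_def by linarith
  qed
  have "\<bar>w y - v y\<bar> \<le> c" for y using c[of y] by (simp add: abs_minus_commute)
  then show ?thesis using *[OF meas M c] *[OF meas(2,1) M(2,1)] by (simp add: abs_le_iff)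
qed

text \<open>The averaging window \<open>m\<close>, the space step \<open>k\<close> and the time step
  \<tau> are chosen in this order, each small relative to the earlier ones. This succeeds because
  the iterates keep the modulus of \<open>u\<^sub>0\<close> and never move faster than in the first
  step.\<close>

lemma approx_flow_exists:
  assumes \<eta>: "0 \<le> \<eta>" and M: "\<And>x. \<bar>u\<^sub>0 x\<bar> \<le> M"
    and uc: "\<And>c. 0 < c \<Longrightarrow> \<exists>d>0. \<forall>h. \<bar>h\<bar> \<le> d \<longrightarrow> (\<forall>x. \<bar>u\<^sub>0 (x + h) - u\<^sub>0 x\<bar> \<le> c)"
    and \<delta>: "0 < \<delta>" and e: "0 < e"
  obtains W where "approx_flow \<alpha> \<eta> \<delta> M e W" "\<And>x. \<bar>W (x, 0) - u\<^sub>0 x\<bar> \<le> e"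
proof -
  define K where "K = 16 * levy_const \<alpha> * levy_tail \<alpha> \<delta> / \<delta>"
  have K0: "0 \<le> K" using levy_const_pos levy_tail_nonneg \<delta> by (simp add: K_def)
  have M0: "0 \<le> M" using order_trans[OF abs_ge_zero M] .
  define \<Lambda> where "\<Lambda> = K * M"
  have \<Lambda>: "0 \<le> \<Lambda>" using K0 M0 by (simp add: \<Lambda>_def)
  have lip: "\<bar>nonlin \<alpha> \<delta> A x - nonlin \<alpha> \<delta> B x\<bar> \<le> \<Lambda> * c"
    if "A \<in> borel_measurable borel" "B \<in> borel_measurable borel" "\<And>y. \<bar>A y\<bar> \<le> M" "\<And>y. \<bar>B y\<bar> \<le> M" "\<And>y. \<bar>A y - B y\<bar> \<le> c" for A B c x
    using nonlin_lipschitz[OF \<delta> that, of x] by (simp add: \<Lambda>_def K_def field_simps)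
  \<comment> \<open>The oscillation allowed within an averaging window: \<open>nonlin\<close> is
    \<Lambda>-Lipschitz on the range in question, so it costs at most e/8.\<close>
  define c1 where "c1 = e / (8 * (\<Lambda> + 1))"
  have c1: "0 < c1" "\<Lambda> * c1 \<le> e / 8" "c1 \<le> e"
    using e \<Lambda> by (auto simp: c1_def field_simps intro: add_pos_nonneg)
  obtain d1 where d1: "0 < d1" "\<And>h x. \<bar>h\<bar> \<le> d1 \<Longrightarrow> \<bar>u\<^sub>0 (x + h) - u\<^sub>0 x\<bar> \<le> c1" using uc[OF c1(1)] by blast
  \<comment> \<open>A double average at x sees the interval [x, x + 2 m], whose length is
    d1.\<close>
  define m where "m = d1 / 2"
  have m: "0 < m" using d1 by (simp add: m_def)
  \<comment> \<open>The second derivative of a double average is a second difference divided by m^2,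
    so an oscillation c2 of the function changes it by at most 4 c2/m^2.\<close>
  define c2 where "c2 = e * m\<^sup>2 / (16 * (\<eta> + 1))"
  have c2: "0 < c2" using e m \<eta> by (simp add: c2_def add_nonneg_pos)
  have c2': "\<eta> * (4 * c2 / m\<^sup>2) \<le> e / 4"
  proof -
    have "\<eta> * (4 * c2 / m\<^sup>2) = e / 4 * (\<eta> / (\<eta> + 1))" using m \<eta> by (simp add: c2_def divide_simps)
    also have "\<dots> \<le> e / 4 * 1" using \<eta> e by (intro mult_left_mono) auto
    finally show ?thesis by simp
  qed
  obtain k where k: "0 < k" "\<And>h x. \<bar>h\<bar> \<le> k \<Longrightarrow> \<bar>u\<^sub>0 (x + h) - u\<^sub>0 x\<bar> \<le> c2" using uc[OF c2] by blast
  \<comment> \<open>A bound for the speed of the first Euler step.\<close>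
  define L where "L = \<eta> * (4 * M / k\<^sup>2) + \<Lambda> * M"
  have L: "0 \<le> L" using \<eta> M0 \<Lambda> by (simp add: L_def)
  \<comment> \<open>The sum of everything that 1/\<tau> must dominate: the CFL bound for 3 M and two
    interpolation errors linear in \<tau>.\<close>
  define S where "S = 1 + (2 * \<eta> / k\<^sup>2 + K * (3 * M)) + 16 * \<eta> * L / (m\<^sup>2 * e) + 8 * \<Lambda> * L / e"
  have Sparts: "0 \<le> 2 * \<eta> / k\<^sup>2 + K * (3 * M)" "0 \<le> 16 * \<eta> * L / (m\<^sup>2 * e)" "0 \<le> 8 * \<Lambda> * L / e"
    using \<eta> K0 M0 L \<Lambda> e by simp_all
  define \<tau> where "\<tau> = 1 / S"
  have S: "1 \<le> S" using Sparts by (simp add: S_def)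
  have \<tau>: "0 < \<tau>" using S by (simp add: \<tau>_def)
  have \<tau>S: "\<tau> * a \<le> 1" if "a \<le> S" for a using that S by (simp add: \<tau>_def)
  have cfl3: "\<tau> * (2 * \<eta> / k\<^sup>2 + 16 * levy_const \<alpha> * levy_tail \<alpha> \<delta> * (3 * M) / \<delta>) \<le> 1"
    using \<tau>S[of "2 * \<eta> / k\<^sup>2 + K * (3 * M)"] Sparts by (simp add: S_def K_def)
  have cfl1: "\<tau> * (2 * \<eta> / k\<^sup>2 + 16 * levy_const \<alpha> * levy_tail \<alpha> \<delta> * M / \<delta>) \<le> 1"
  proof -
    have "K * M \<le> K * (3 * M)" using K0 M0 by (intro mult_left_mono) auto
    then have "\<tau> * (2 * \<eta> / k\<^sup>2 + K * M) \<le> 1"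
      using \<tau>S[of "2 * \<eta> / k\<^sup>2 + K * M"] Sparts by (simp add: S_def)
    then show ?thesis by (simp add: K_def)
  qed
  have \<tau>1: "\<eta> * (4 * (L * \<tau>) / m\<^sup>2) \<le> e / 4"
  proof -
    have "\<tau> * (16 * \<eta> * L / (m\<^sup>2 * e)) \<le> 1" using Sparts by (intro \<tau>S) (simp add: S_def)
    then show ?thesis using m e by (simp add: field_simps)
  qed
  have \<tau>2: "\<Lambda> * (L * \<tau>) \<le> e / 8"
  proof -
    have "\<tau> * (8 * \<Lambda> * L / e) \<le> 1" using Sparts by (intro \<tau>S) (simp add: S_def)
    then show ?thesis using e by (simp add: field_simps)
  qed
  let ?G = "euler_step \<alpha> \<eta> \<delta> k \<tau>"
  define w where "w n = (?G ^^ n) u\<^sub>0" for n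
  have w0: "w 0 = u\<^sub>0" and wS: "w (Suc n) = ?G (w n)" for n by (simp_all add: w_def)
  have cont_of_mod: "continuous_on UNIV f"
    if f: "\<And>h c. (\<forall>x. \<bar>u\<^sub>0 (x + h) - u\<^sub>0 x\<bar> \<le> c) \<Longrightarrow> (\<forall>x. \<bar>f (x + h) - f x\<bar> \<le> c)" for f :: "real \<Rightarrow> real"
    unfolding continuous_on_iff
  proof (intro ballI allI impI)
    fix x c :: real assume "0 < c"
    then obtain d where d: "0 < d" "\<forall>h. \<bar>h\<bar> \<le> d \<longrightarrow> (\<forall>x. \<bar>u\<^sub>0 (x + h) - u\<^sub>0 x\<bar> \<le> c / 2)" using uc[of "c / 2"] by auto
    have "dist (f y) (f x) < c" if "dist y x < d" for y
    proof -
      have "\<bar>f (x + (y - x)) - f x\<bar> \<le> c / 2"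
        by (rule f[rule_format]) (use d that in \<open>auto simp: dist_real_def\<close>)
      then show ?thesis using \<open>0 < c\<close> by (simp add: dist_real_def)
    qed
    then show "\<exists>d>0. \<forall>y\<in>UNIV. dist y x < d \<longrightarrow> dist (f y) (f x) < c" using d(1) by blast
  qed
  \<comment> \<open>Translation invariance and contraction together: a bound on the change of
    \<open>u\<^sub>0\<close> under a shift by h holds for every iterate with the same h and the same
    constant.\<close>
  have inv: "(\<forall>x. \<bar>w n x\<bar> \<le> M) \<and> (\<forall>h c. (\<forall>x. \<bar>u\<^sub>0 (x + h) - u\<^sub>0 x\<bar> \<le> c) \<longrightarrow> (\<forall>x. \<bar>w n (x + h) - w n x\<bar> \<le> c))" for n
  proof (induction n)
    case 0 show ?case using M by (simp add: w0)
  next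
    case (Suc n)
    then have meas: "w n \<in> borel_measurable borel"
      by (intro borel_measurable_continuous_onI cont_of_mod) blast
    have meas': "(\<lambda>y. w n (y + h)) \<in> borel_measurable borel" for h using meas by measurable
    have "\<bar>?G (w n) x\<bar> \<le> M" for x
      using Suc by (intro euler_step_bound[OF \<delta> k(1) \<tau> \<eta> cfl1 meas]) auto
    moreover have "\<bar>?G (w n) (x + h) - ?G (w n) x\<bar> \<le> c" if "\<forall>x. \<bar>u\<^sub>0 (x + h) - u\<^sub>0 x\<bar> \<le> c" for h c x
      unfolding euler_step_translate[of _ _ _ _ _ "w n" h x, symmetric]
      using Suc that by (intro euler_step_contraction[OF \<delta> k(1) \<tau> \<eta> cfl3 meas' meas]) auto
    ultimately show ?case by (simp add: wS)
  qed
  have wM: "\<bar>w n x\<bar> \<le> M" for n x using inv by blast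
  have wmod: "\<bar>w n (x + h) - w n x\<bar> \<le> c" if "\<And>x. \<bar>u\<^sub>0 (x + h) - u\<^sub>0 x\<bar> \<le> c" for n x h c using inv that by blast
  have wc: "continuous_on UNIV (w n)" for n using inv by (intro cont_of_mod) blast
  have wm: "w n \<in> borel_measurable borel" for n by (intro borel_measurable_continuous_onI wc)
  have wm': "(\<lambda>y. w n (y + h)) \<in> borel_measurable borel" for n h using wm by measurable
  \<comment> \<open>Contraction applied to consecutive iterates carries the increment of the first
    step to all later ones.\<close>
  have inc: "\<bar>w (Suc n) x - w n x\<bar> \<le> L * \<tau>" for n x
  proof (induction n arbitrary: x)
    case 0
    have "\<bar>diff2 k u\<^sub>0 x\<bar> \<le> 4 * M / k\<^sup>2"
      using M[of "x + k"] M[of "x - k"] M[of x] unfolding diff2_def abs_divide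
      by (simp add: divide_right_mono)
    then have "\<bar>\<eta> * diff2 k u\<^sub>0 x\<bar> \<le> \<eta> * (4 * M / k\<^sup>2)" using mult_left_mono[OF _ \<eta>] \<eta> by (simp only: abs_mult abs_of_nonneg)
    moreover have "\<bar>nonlin \<alpha> \<delta> u\<^sub>0 x - nonlin \<alpha> \<delta> (\<lambda>_. 0) x\<bar> \<le> \<Lambda> * M"
      using wm[of 0] M M0 by (intro lip) (auto simp: w0)
    ultimately have "\<bar>\<eta> * diff2 k u\<^sub>0 x + nonlin \<alpha> \<delta> u\<^sub>0 x\<bar> \<le> L" unfolding L_def nonlin_const by linarith
    then have "\<bar>\<tau> * (\<eta> * diff2 k u\<^sub>0 x + nonlin \<alpha> \<delta> u\<^sub>0 x)\<bar> \<le> \<tau> * L" using \<tau> by (simp add: abs_mult)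
    then show ?case by (simp add: wS w0 euler_step_def mult.commute)
  next
    case (Suc n)
    show ?case unfolding wS[of "Suc n"] wS[of n, symmetric]
      by (subst (2) wS) (intro euler_step_contraction[OF \<delta> k(1) \<tau> \<eta> cfl3 wm wm wM wM Suc])
  qed
  define A where "A f = avg m (avg m f)" for f
  have A_lin: "A (\<lambda>y. a * f y + b * g y) x = a * A f x + b * A g x"
    if "continuous_on UNIV f" "continuous_on UNIV g" for a b f g x
    unfolding A_def using that
    by (subst avg_cmult_add[OF m that, abs_def]) (rule avg_cmult_add[OF m avg_continuous[OF m that(1)] avg_continuous[OF m that(2)]])
  have A_tr: "A (\<lambda>y. f (y + h)) x = A f (x + h)" if "continuous_on UNIV f" for f h x
    unfolding A_def using that
    by (subst avg_translate[OF m that, abs_def]) (rule avg_translate[OF m avg_continuous[OF m that]])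
  have A_close: "\<bar>A f x - c\<bar> \<le> b" if "continuous_on UNIV f" "\<And>y. x \<le> y \<Longrightarrow> y \<le> x + 2 * m \<Longrightarrow> \<bar>f y - c\<bar> \<le> b" for f x c b
    unfolding A_def by (rule avg_avg_close[OF m that])
  define A1 where "A1 f x = (avg m f (x + m) - avg m f x) / m" for f x
  define A2 where "A2 f x = (f (x + 2 * m) - 2 * f (x + m) + f x) / m\<^sup>2" for f :: "real \<Rightarrow> real" and x
  have dA: "(A f has_real_derivative A1 f x) (at x)" if "continuous_on UNIV f" for f x
    unfolding A_def A1_def by (rule avg_DERIV[OF m avg_continuous[OF m that]])
  have dA1: "(A1 f has_real_derivative A2 f x) (at x)" if "continuous_on UNIV f" for f x
  proof -
    have "((\<lambda>x. avg m f (x + m)) has_real_derivative (f (x + m + m) - f (x + m)) / m) (at x)"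
      using avg_DERIV[OF m that, of "x + m"] by (simp only: DERIV_shift)
    from DERIV_cdivide[OF DERIV_diff[OF this avg_DERIV[OF m that]], of m]
    have "(A1 f has_real_derivative ((f (x + m + m) - f (x + m)) / m - (f (x + m) - f x) / m) / m) (at x)"
      by (simp add: A1_def[abs_def])
    moreover have "((f (x + m + m) - f (x + m)) / m - (f (x + m) - f x) / m) / m = A2 f x"
      using m by (simp add: A2_def power2_eq_square field_simps)
    ultimately show ?thesis by simp
  qed
  define W where "W p = interp \<tau> (\<lambda>n. A (w n) (fst p)) (snd p)" for p
  define W1 where "W1 t x = interp \<tau> (\<lambda>n. A1 (w n) x) t" for t x
  define W2 where "W2 t x = interp \<tau> (\<lambda>n. A2 (w n) x) t" for t x
  have AM: "\<bar>A (w n) x\<bar> \<le> M" for n x using A_close[OF wc, of x n 0 M] wM by simp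
  have AwS: "\<bar>A (w (Suc n)) x - A (w n) x\<bar> \<le> L * \<tau>" for n x
  proof -
    have "\<bar>A (\<lambda>y. 1 * w (Suc n) y + (-1) * w n y) x - 0\<bar> \<le> L * \<tau>"
      using inc by (intro A_close) (auto intro!: continuous_intros wc)
    then show ?thesis by (subst (asm) A_lin[OF wc wc]) simp
  qed
  have lipW: "\<bar>W (x, t) - W (x, s)\<bar> \<le> L * \<bar>t - s\<bar>" if "0 \<le> s" "0 \<le> t" for x s t
    unfolding W_def fst_conv snd_conv by (rule interp_lipschitz[OF \<tau> _ that]) (rule AwS)
  have cvx: "\<bar>(1 - s) * a + s * b\<bar> \<le> r" if "0 \<le> s" "s \<le> 1" "\<bar>a\<bar> \<le> r" "\<bar>b\<bar> \<le> r" for s a b r :: real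
  proof -
    have "\<bar>(1 - s) * a + s * b\<bar> \<le> (1 - s) * \<bar>a\<bar> + s * \<bar>b\<bar>"
      using that abs_triangle_ineq[of "(1 - s) * a" "s * b"] by (simp add: abs_mult)
    also have "\<dots> \<le> (1 - s) * r + s * r" using that by (intro add_mono mult_left_mono) auto
    finally show ?thesis by (simp add: algebra_simps)
  qed
  have WM: "\<bar>W (x, t)\<bar> \<le> M" if t0: "0 \<le> t" for x t
  proof -
    obtain n where n: "real n * \<tau> \<le> t" "t \<le> real (Suc n) * \<tau>" by (rule interp_cell_ex[OF \<tau> t0])
    obtain s where "0 \<le> s" "s \<le> 1" "\<forall>a. interp \<tau> a t = (1 - s) * a n + s * a (Suc n)"
      by (rule interp_convex[OF \<tau> n])
    then show ?thesis unfolding W_def using cvx AM by simp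
  qed
  have C2W: "C2_derivs (\<lambda>y. W (y, t)) (W1 t) (W2 t)" if t0: "0 \<le> t" for t
    unfolding C2_derivs_def
  proof (intro conjI allI)
    fix x
    obtain n where n: "real n * \<tau> \<le> t" "t \<le> real (Suc n) * \<tau>" by (rule interp_cell_ex[OF \<tau> t0])
    obtain s where "\<forall>a. interp \<tau> a t = (1 - s) * a n + s * a (Suc n)"
      by (rule interp_convex[OF \<tau> n])
    then have s: "interp \<tau> a t = (1 - s) * a n + s * a (Suc n)" for a by blast
    show "((\<lambda>y. W (y, t)) has_real_derivative W1 t x) (at x)"
      unfolding W_def W1_def fst_conv snd_conv s by (intro DERIV_add DERIV_cmult dA wc)
    show "(W1 t has_real_derivative W2 t x) (at x)"
      unfolding W1_def[abs_def] W2_def s by (intro DERIV_add DERIV_cmult dA1 wc)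
    have "continuous_on UNIV (\<lambda>x. w n (x + h))" for n h
      by (rule continuous_on_compose2[OF wc]) (auto intro!: continuous_intros)
    then show "continuous_on UNIV (W2 t)"
      unfolding W2_def[abs_def] s A2_def using m by (auto intro!: continuous_intros wc)
  qed
  have contW: "continuous_on closed_domain W"
    by (rule continuous_on_closed_domain_if_lipschitz_in_time[OF lipW C2_derivs_continuous(1)[OF C2W]])
  have left: "\<exists>r\<^sub>0>0. \<forall>x r. 0 < r \<and> r \<le> r\<^sub>0 \<longrightarrow>
      \<bar>(W (x, t) - W (x, t - r)) / r - (\<eta> * W2 t x + nonlin \<alpha> \<delta> (\<lambda>y. W (y, t)) x)\<bar> \<le> e" if t: "0 < t" for t
  proof -
    have t0: "0 \<le> t" using t by simp
    obtain n where n: "real n * \<tau> < t" "t \<le> real (Suc n) * \<tau>" by (rule interp_left_cell_ex[OF \<tau> t])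
    obtain s where s: "0 \<le> s" "s \<le> 1" "\<forall>a. interp \<tau> a t = (1 - s) * a n + s * a (Suc n)"
      by (rule interp_convex[OF \<tau> less_imp_le[OF n(1)] n(2)])
    have sl: "\<bar>interp \<tau> a t - a n\<bar> \<le> b" if "\<bar>a (Suc n) - a n\<bar> \<le> b" for a b
    proof -
      have "interp \<tau> a t - a n = s * (a (Suc n) - a n)" by (simp add: s(3)[rule_format] algebra_simps)
      then have "\<bar>interp \<tau> a t - a n\<bar> = s * \<bar>a (Suc n) - a n\<bar>" using s by (simp add: abs_mult)
      also have "\<dots> \<le> 1 * \<bar>a (Suc n) - a n\<bar>" using s by (intro mult_right_mono) auto
      finally show ?thesis using that by simp
    qed
    show ?thesis
    proof (rule exI[of _ "t - real n * \<tau>"], intro conjI allI impI)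
      show "0 < t - real n * \<tau>" using n by simp
      fix x r assume r: "0 < r \<and> r \<le> t - real n * \<tau>"
      have "W (x, t) - W (x, t - r) = r / \<tau> * (A (w (Suc n)) x - A (w n) x)"
      proof -
        have cell: "real n * \<tau> \<le> t" "real n * \<tau> \<le> t - r" "t - r \<le> real (Suc n) * \<tau>" using n r by auto
        show ?thesis unfolding W_def fst_conv snd_conv interp_cell[OF \<tau> cell(1) n(2)] interp_cell[OF \<tau> cell(2,3)]
          by (simp add: diff_divide_distrib algebra_simps)
      qed
      \<comment> \<open>Within one affine piece the left quotient is exactly the increment per
        step.\<close>
      then have q: "(W (x, t) - W (x, t - r)) / r = (A (w (Suc n)) x - A (w n) x) / \<tau>" using r by simp
      have nc: "continuous_on UNIV (nonlin \<alpha> \<delta> (w n))"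
        unfolding continuous_on_iff
      proof (intro ballI allI impI)
        fix y c :: real assume "0 < c"
        then have "0 < c / (2 * (\<Lambda> + 1))" using \<Lambda> by simp
        then obtain d where d: "0 < d" "\<And>h x. \<bar>h\<bar> \<le> d \<Longrightarrow> \<bar>u\<^sub>0 (x + h) - u\<^sub>0 x\<bar> \<le> c / (2 * (\<Lambda> + 1))" using uc by meson
        have "dist (nonlin \<alpha> \<delta> (w n) z) (nonlin \<alpha> \<delta> (w n) y) < c" if "dist z y < d" for z
        proof -
          have "\<bar>nonlin \<alpha> \<delta> (\<lambda>x. w n (x + (z - y))) y - nonlin \<alpha> \<delta> (w n) y\<bar> \<le> \<Lambda> * (c / (2 * (\<Lambda> + 1)))"
            using that by (intro lip wm wm' wM wmod d(2)) (simp add: dist_real_def)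
          also have "\<dots> = c / 2 * (\<Lambda> / (\<Lambda> + 1))" by simp
          also have "\<dots> \<le> c / 2 * 1" using \<Lambda> \<open>0 < c\<close> by (intro mult_left_mono) auto
          also have "\<dots> < c" using \<open>0 < c\<close> by simp
          finally show ?thesis unfolding nonlin_translate by (simp add: dist_real_def)
        qed
        then show "\<exists>d>0. \<forall>z\<in>UNIV. dist z y < d \<longrightarrow> dist (nonlin \<alpha> \<delta> (w n) z) (nonlin \<alpha> \<delta> (w n) y) < c"
          using d(1) by blast
      qed
      have shc: "continuous_on UNIV (\<lambda>x. w n (x + h))" for h
        by (rule continuous_on_compose2[OF wc]) (auto intro!: continuous_intros)
      have "A (w (Suc n)) x - A (w n) x = \<tau> * (\<eta> * diff2 k (A (w n)) x + A (nonlin \<alpha> \<delta> (w n)) x)"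
      proof -
        \<comment> \<open>The explicit coefficients and the form x + - k match the rules for
          linearity and translation of \<open>A\<close>, which move the average inside the second
          difference.\<close>
        have "A (w (Suc n)) x = A (\<lambda>y. 1 * w n y + \<tau> * (\<eta> / k\<^sup>2 * (1 * (1 * w n (y + k) + 1 * w n (y + - k)) + (- 2) * w n y) + 1 * nonlin \<alpha> \<delta> (w n) y)) x"
          by (rule arg_cong[of _ _ "\<lambda>f. A f x"]) (auto simp: wS euler_step_def diff2_def fun_eq_iff)
        also have "\<dots> = 1 * A (w n) x + \<tau> * (\<eta> / k\<^sup>2 * (1 * (1 * A (w n) (x + k) + 1 * A (w n) (x + - k)) + (- 2) * A (w n) x) + 1 * A (nonlin \<alpha> \<delta> (w n)) x)"
          by (subst A_lin A_tr, (intro continuous_intros wc nc shc; fail)+)+ simp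
        finally show ?thesis by (simp add: diff2_def)
      qed
      then have q': "(W (x, t) - W (x, t - r)) / r = \<eta> * diff2 k (A (w n)) x + A (nonlin \<alpha> \<delta> (w n)) x"
        unfolding q using \<tau> by simp
      have A2_bound: "\<bar>A2 f y - A2 g z\<bar> \<le> 4 * c / m\<^sup>2" if "\<And>h. \<bar>f (y + h) - g (z + h)\<bar> \<le> c" for f g c y z
      proof -
        have "\<bar>(f (y + 2 * m) - 2 * f (y + m) + f y) - (g (z + 2 * m) - 2 * g (z + m) + g z)\<bar> \<le> 4 * c"
          using that[of "2 * m"] that[of m] that[of 0] by simp
        then show ?thesis unfolding A2_def diff_divide_distrib[symmetric] abs_divide
          by (simp add: divide_right_mono)
      qed
      \<comment> \<open>The second difference is compared with \<open>A2\<close>, whose oscillation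
        over distance k is controlled by that of the iterate.\<close>
      have e1: "\<bar>diff2 k (A (w n)) x - A2 (w n) x\<bar> \<le> 4 * c2 / m\<^sup>2"
      proof (rule diff2_error[OF k(1) dA dA1])
        fix y assume "\<bar>y - x\<bar> \<le> k"
        then have "\<bar>w n (x + h + (y - x)) - w n (x + h)\<bar> \<le> c2" for h by (intro wmod k(2))
        then show "\<bar>A2 (w n) y - A2 (w n) x\<bar> \<le> 4 * c2 / m\<^sup>2" by (intro A2_bound) (simp add: algebra_simps)
      qed (rule wc)+
      have e2: "\<bar>W2 t x - A2 (w n) x\<bar> \<le> 4 * (L * \<tau>) / m\<^sup>2"
        unfolding W2_def by (rule sl, rule A2_bound, rule inc)
      have e3: "\<bar>A (nonlin \<alpha> \<delta> (w n)) x - nonlin \<alpha> \<delta> (w n) x\<bar> \<le> \<Lambda> * c1"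
      proof (rule A_close[OF nc])
        fix y assume "x \<le> y" "y \<le> x + 2 * m"
        then have "\<bar>nonlin \<alpha> \<delta> (\<lambda>z. w n (z + (y - x))) x - nonlin \<alpha> \<delta> (w n) x\<bar> \<le> \<Lambda> * c1"
          by (intro lip wm wm' wM wmod d1(2)) (simp add: m_def)
        then show "\<bar>nonlin \<alpha> \<delta> (w n) y - nonlin \<alpha> \<delta> (w n) x\<bar> \<le> \<Lambda> * c1" unfolding nonlin_translate by simp
      qed
      have Aw: "\<bar>A (w n) y - w n y\<bar> \<le> c1" for n y
      proof (rule A_close[OF wc])
        fix z assume "y \<le> z" "z \<le> y + 2 * m"
        then show "\<bar>w n z - w n y\<bar> \<le> c1" using wmod[OF d1(2), of "z - y" n y] by (simp add: m_def)
      qed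
      have e4: "\<bar>nonlin \<alpha> \<delta> (\<lambda>y. W (y, t)) x - nonlin \<alpha> \<delta> (w n) x\<bar> \<le> \<Lambda> * (L * \<tau> + c1)"
      proof (rule lip)
        show "(\<lambda>y. W (y, t)) \<in> borel_measurable borel"
          by (rule borel_measurable_continuous_onI[OF C2_derivs_continuous(1)[OF C2W[OF t0]]])
        fix y
        show "\<bar>W (y, t)\<bar> \<le> M" by (rule WM[OF t0])
        have "\<bar>W (y, t) - A (w n) y\<bar> \<le> L * \<tau>" unfolding W_def fst_conv snd_conv by (rule sl, rule AwS)
        then show "\<bar>W (y, t) - w n y\<bar> \<le> L * \<tau> + c1" using Aw[of n y] by linarith
      qed (rule wm wM)+
      \<comment> \<open>Error budget: e/4 for the second difference, e/4 for the change of the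
        second derivative by interpolation in time, e/8 for averaging \<open>nonlin\<close>, and e/4
        for evaluating it at W instead of the iterate.\<close>
      have "\<bar>\<eta> * diff2 k (A (w n)) x - \<eta> * A2 (w n) x\<bar> \<le> \<eta> * (4 * c2 / m\<^sup>2)"
        using mult_left_mono[OF e1 \<eta>] \<eta> by (simp only: right_diff_distrib[symmetric] abs_mult abs_of_nonneg)
      moreover have "\<bar>\<eta> * W2 t x - \<eta> * A2 (w n) x\<bar> \<le> \<eta> * (4 * (L * \<tau>) / m\<^sup>2)"
        using mult_left_mono[OF e2 \<eta>] \<eta> by (simp only: right_diff_distrib[symmetric] abs_mult abs_of_nonneg)
      moreover have "\<Lambda> * (L * \<tau> + c1) \<le> e / 4" using \<tau>2 c1(2) by (simp add: distrib_left)
      ultimately show "\<bar>(W (x, t) - W (x, t - r)) / r - (\<eta> * W2 t x + nonlin \<alpha> \<delta> (\<lambda>y. W (y, t)) x)\<bar> \<le> e"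
        unfolding q' using e3 e4 c2' \<tau>1 c1(2) by linarith
    qed
  qed
  have "approx_flow \<alpha> \<eta> \<delta> M e W"
    unfolding approx_flow_def residual_le_def using WM contW lipW C2W left by blast
  moreover have "\<bar>W (x, 0) - u\<^sub>0 x\<bar> \<le> e" for x
  proof -
    have "W (x, 0) = A u\<^sub>0 x" using interp_grid[OF \<tau>, of "\<lambda>n. A (w n) x" 0] by (simp add: W_def w0)
    moreover have "\<bar>A u\<^sub>0 x - u\<^sub>0 x\<bar> \<le> c1"
    proof (rule A_close)
      show "continuous_on UNIV u\<^sub>0" using wc[of 0] by (simp add: w0)
      fix z assume "x \<le> z" "z \<le> x + 2 * m"
      then show "\<bar>u\<^sub>0 z - u\<^sub>0 x\<bar> \<le> c1" using d1(2)[of "z - x" x] by (simp add: m_def)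
    qed
    ultimately show ?thesis using c1(3) by simp
  qed
  ultimately show ?thesis using that by blast
qed

end

section \<open>Weak subsolutions\<close>

text \<open>The test functions passed to the viscosity definition below are sums of a function of x
  and a function of t, for which both Frechet derivatives can be written down.\<close>

lemma C2_on_separable:
  assumes a: "C2_derivs a a1 a2" and b: "C2_derivs b b1 b2"
  shows "C2_on S (\<lambda>p. a (fst p) + b (snd p))"
proof -
  define X :: "(real \<times> real) \<Rightarrow>\<^sub>L real" where "X = Blinfun fst"
  define T :: "(real \<times> real) \<Rightarrow>\<^sub>L real" where "T = Blinfun snd"
  have X: "blinfun_apply X = fst" and T: "blinfun_apply T = snd"
    unfolding X_def T_def by (simp_all add: bounded_linear_Blinfun_apply bounded_linear_fst bounded_linear_snd)
  define f' where "f' p = a1 (fst p) *\<^sub>R X + b1 (snd p) *\<^sub>R T" for p :: "real \<times> real"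
  define f'' where "f'' p = a2 (fst p) *\<^sub>R (blinfun_scaleR_left X o\<^sub>L X) + b2 (snd p) *\<^sub>R (blinfun_scaleR_left T o\<^sub>L T)"
    for p :: "real \<times> real"
  have fs: "(fst has_derivative fst) (at p)" "(snd has_derivative snd) (at p)" for p :: "real \<times> real"
    by (auto intro!: derivative_eq_intros)
  have "((\<lambda>p. a (fst p) + b (snd p)) has_derivative blinfun_apply (f' p)) (at p)" for p
  proof -
    have "((\<lambda>p. a (fst p) + b (snd p)) has_derivative (\<lambda>h. fst h * a1 (fst p) + snd h * b1 (snd p))) (at p)"
      using a b unfolding C2_derivs_def
      by (intro has_derivative_add DERIV_compose_FDERIV fs) auto
    moreover have "blinfun_apply (f' p) = (\<lambda>h. fst h * a1 (fst p) + snd h * b1 (snd p))"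
      by (auto simp: f'_def blinfun.add_left blinfun.scaleR_left X T)
    ultimately show ?thesis by simp
  qed
  moreover have "(f' has_derivative blinfun_apply (f'' p)) (at p)" for p
  proof -
    have "(f' has_derivative (\<lambda>h. (fst h * a2 (fst p)) *\<^sub>R X + (snd h * b2 (snd p)) *\<^sub>R T)) (at p)"
      using a b unfolding C2_derivs_def f'_def[abs_def]
      by (intro has_derivative_add has_derivative_scaleR_left DERIV_compose_FDERIV fs) auto
    moreover have "blinfun_apply (f'' p) = (\<lambda>h. (fst h * a2 (fst p)) *\<^sub>R X + (snd h * b2 (snd p)) *\<^sub>R T)"
      by (auto simp: f''_def blinfun.add_left blinfun.scaleR_left X T mult.commute)
    ultimately show ?thesis by simp
  qed
  moreover have "continuous_on S f''"
    unfolding f''_def[abs_def]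
    by (intro continuous_intros continuous_on_compose2[OF C2_derivs_continuous(3)[OF a]]
        continuous_on_compose2[OF C2_derivs_continuous(3)[OF b]]) auto
  ultimately show ?thesis unfolding C2_on_def by blast
qed

context levy_exponent begin

text \<open>Common constants \<open>Q\<close> and \<open>M\<close> give one integrable majorant,
  although base points and slopes vary with n.\<close>

lemma levy_op_tendsto:
  assumes q: "\<And>n. quad_touch (A n) (x n) (p n) Q M" and B: "B \<in> borel_measurable borel"
    and lim: "\<And>z. (\<lambda>n. A n (x n + z)) \<longlonglongrightarrow> B (y + z)"
  shows "(\<lambda>n. levy_op \<alpha> (A n) (x n)) \<longlonglongrightarrow> levy_op \<alpha> B y"
proof -
  have "(\<lambda>n. LINT z|lborel. (A n (x n + z) + A n (x n - z) - 2 * A n (x n)) / \<bar>z\<bar> powr (1 + \<alpha>))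
    \<longlonglongrightarrow> (LINT z|lborel. (B (y + z) + B (y - z) - 2 * B y) / \<bar>z\<bar> powr (1 + \<alpha>))"
  proof (rule integral_dominated_convergence[where w = "\<lambda>z. 2 * (Q + M) * levy_wt \<alpha> z"])
    show "integrable lborel (\<lambda>z. 2 * (Q + M) * levy_wt \<alpha> z)" using levy_wt_integrable by simp
    show "(\<lambda>z. (B (y + z) + B (y - z) - 2 * B y) / \<bar>z\<bar> powr (1 + \<alpha>)) \<in> borel_measurable lborel"
      using B by measurable
    show "(\<lambda>z. (A n (x n + z) + A n (x n - z) - 2 * A n (x n)) / \<bar>z\<bar> powr (1 + \<alpha>)) \<in> borel_measurable lborel" for n
      using quad_touchD(1)[OF q[of n]] by measurable
    show "AE z in lborel. (\<lambda>n. (A n (x n + z) + A n (x n - z) - 2 * A n (x n)) / \<bar>z\<bar> powr (1 + \<alpha>))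
        \<longlonglongrightarrow> (B (y + z) + B (y - z) - 2 * B y) / \<bar>z\<bar> powr (1 + \<alpha>)"
    proof (rule AE_I2)
      fix z :: real
      have "(\<lambda>n. (A n (x n + z) + A n (x n + - z) - 2 * A n (x n + 0)) * inverse (\<bar>z\<bar> powr (1 + \<alpha>)))
        \<longlonglongrightarrow> (B (y + z) + B (y + - z) - 2 * B (y + 0)) * inverse (\<bar>z\<bar> powr (1 + \<alpha>))"
        by (intro tendsto_intros lim)
      then show "(\<lambda>n. (A n (x n + z) + A n (x n - z) - 2 * A n (x n)) / \<bar>z\<bar> powr (1 + \<alpha>))
        \<longlonglongrightarrow> (B (y + z) + B (y - z) - 2 * B y) / \<bar>z\<bar> powr (1 + \<alpha>)" by (simp add: divide_inverse)
    qed
    show "AE z in lborel. norm ((A n (x n + z) + A n (x n - z) - 2 * A n (x n)) / \<bar>z\<bar> powr (1 + \<alpha>)) \<le> 2 * (Q + M) * levy_wt \<alpha> z" for n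
      using second_difference_bound[OF q[of n]] by (intro AE_I2) simp
  qed
  then show ?thesis unfolding levy_op_def by (rule tendsto_mult_left)
qed

text \<open>The property of subsolutions that the comparison argument uses; it holds for viscosity subsolutions
  with \<open>e = 0\<close> and for the approximations with small \<open>e\<close>. The local term is evaluated at \<open>F\<close> alone, the nonlocal one
  at \<open>min F G\<close>, and the error depends on \<open>F\<close> only through \<open>Q\<close>, \<open>R\<close> and \<open>B\<close>.\<close>

definition weak_subsol :: "real \<Rightarrow> real \<Rightarrow> real \<Rightarrow> real \<Rightarrow> real \<Rightarrow> (real \<times> real \<Rightarrow> real) \<Rightarrow> bool" where
  "weak_subsol \<eta> Q R B e u \<longleftrightarrow> (\<forall>x\<^sub>0 t\<^sub>0 c K F F1 F2 G G1 G2 g.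
     0 < t\<^sub>0 \<and> C2_derivs F F1 F2 \<and> C2_derivs G G1 G2 \<and> bounded (range F) \<and> (\<forall>x. g \<le> G x) \<and> F x\<^sub>0 = G x\<^sub>0 \<and>
     quad_touch (\<lambda>x. min (F x) (G x)) x\<^sub>0 (F1 x\<^sub>0) Q B \<and> \<bar>F1 x\<^sub>0\<bar> \<le> R \<and>
     (\<forall>x. \<forall>t\<ge>0. u (x, t) \<le> u (x\<^sub>0, t\<^sub>0) + (min (F x) (G x) - F x\<^sub>0) + c * (t - t\<^sub>0) + K * (t - t\<^sub>0)\<^sup>2)
     \<longrightarrow> c \<le> \<eta> * F2 x\<^sub>0 + \<bar>F1 x\<^sub>0\<bar> * levy_op \<alpha> (\<lambda>x. min (F x) (G x)) x\<^sub>0 + e)"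

lemma visc_op_separable:
  assumes a: "C2_derivs a a1 a2" and b: "C2_derivs b b1 b2" and q: "quad_touch a x (a1 x) Q M"
  shows "visc_op \<alpha> \<eta> (\<lambda>p. a (fst p) + b (snd p)) x t = b1 t - \<eta> * a2 x - \<bar>a1 x\<bar> * levy_op \<alpha> a x"
proof -
  have d: "((\<lambda>y. a y + b t) has_real_derivative a1 y) (at y)" for y
    using a by (auto simp: C2_derivs_def intro!: derivative_eq_intros)
  then have "deriv (\<lambda>y. a y + b t) = a1" by (auto intro: DERIV_imp_deriv)
  moreover have "deriv a1 x = a2 x" using a by (auto simp: C2_derivs_def intro: DERIV_imp_deriv)
  moreover have "deriv (\<lambda>s. a x + b s) t = b1 t"
    using b by (intro DERIV_imp_deriv) (auto simp: C2_derivs_def intro!: derivative_eq_intros)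
  moreover have "quad_touch (\<lambda>y. a y + b t) x (a1 x) Q M"
    using q by (auto simp: quad_touch_def)
  ultimately show ?thesis
    by (simp add: visc_op_def frac_lap_eq_levy_op levy_op_def algebra_simps)
qed

text \<open>Test functions must be bounded, while c r + K r^2 is not. A bump displaced by 1 has
  slope 1/2 at the contact time and supplies the linear part; a second bump, flat there, absorbs the
  Taylor error and the quadratic term.\<close>

lemma bounded_time_majorant:
  obtains b b1 b2 where "C2_derivs b b1 b2" "bounded (range b)" "b t = 0" "b1 t = c"
    "\<forall>s. \<bar>s - t\<bar> \<le> 1 \<longrightarrow> c * (s - t) + K * (s - t)\<^sup>2 \<le> b s"
proof -
  \<comment> \<open>The Taylor constant 3 of \<open>bump\<close> times 2 |c| gives 6 |c|; the outer
    factor 2 compensates for bump r >= r^2/2.\<close>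
  define k where "k = 2 * (6 * \<bar>c\<bar> + \<bar>K\<bar>)"
  have h: "bump 1 = 1 / 2" "bump1 1 = 1 / 2" "bump1 0 = 0" by (simp_all add: bump_def bump1_def)
  let ?b = "\<lambda>s. 2 * c * bump (s - (t - 1)) + k * bump (s - t) + - c"
  show ?thesis
  proof (rule that[of ?b "\<lambda>s. 2 * c * bump1 (s - (t - 1)) + k * bump1 (s - t) + 0" "\<lambda>s. 2 * c * bump2 (s - (t - 1)) + k * bump2 (s - t) + 0"])
    show "C2_derivs ?b (\<lambda>s. 2 * c * bump1 (s - (t - 1)) + k * bump1 (s - t) + 0) (\<lambda>s. 2 * c * bump2 (s - (t - 1)) + k * bump2 (s - t) + 0)"
      by (intro C2_derivs_add C2_derivs_bump) (simp add: C2_derivs_def)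
    have *: "\<bar>a * bump x\<bar> \<le> \<bar>a\<bar>" for a x
      using mult_left_mono[OF bump_le_1, of "\<bar>a\<bar>" x] bump_nonneg[of x] by (simp add: abs_mult)
    have "\<bar>x + y + - c\<bar> \<le> a + b + \<bar>c\<bar>" if "\<bar>x\<bar> \<le> a" "\<bar>y\<bar> \<le> b" for x y a b using that by linarith
    from this[OF * *] have "\<bar>?b s\<bar> \<le> \<bar>2 * c\<bar> + \<bar>k\<bar> + \<bar>c\<bar>" for s .
    then show "bounded (range ?b)" unfolding bounded_iff by auto
    show "\<forall>s. \<bar>s - t\<bar> \<le> 1 \<longrightarrow> c * (s - t) + K * (s - t)\<^sup>2 \<le> ?b s"
    proof (intro allI impI)
      fix s assume s: "\<bar>s - t\<bar> \<le> 1"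
      define r where "r = s - t"
      have "\<bar>bump (1 + r) - bump 1 - bump1 1 * r\<bar> \<le> 3 * r\<^sup>2" by (rule bump_taylor)
      from mult_left_mono[OF this, of "2 * \<bar>c\<bar>"]
      have "\<bar>2 * c * (bump (1 + r) - bump 1 - bump1 1 * r)\<bar> \<le> 6 * \<bar>c\<bar> * r\<^sup>2" by (simp add: abs_mult)
      then have 1: "2 * c * bump (1 + r) - c - c * r \<ge> - (6 * \<bar>c\<bar> * r\<^sup>2)"
        by (simp add: h abs_le_iff right_diff_distrib)
      have "r\<^sup>2 / 2 \<le> bump r" using s unfolding r_def by (rule bump_ge_quadratic)
      then have "k * (r\<^sup>2 / 2) \<le> k * bump r" by (intro mult_left_mono) (auto simp: k_def)
      then have 2: "6 * \<bar>c\<bar> * r\<^sup>2 + \<bar>K\<bar> * r\<^sup>2 \<le> k * bump r" by (simp add: k_def algebra_simps)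
      have "K * r\<^sup>2 \<le> \<bar>K\<bar> * r\<^sup>2" by (intro mult_right_mono) auto
      then have "c * r + K * r\<^sup>2 \<le> 2 * c * bump (1 + r) + k * bump r + - c" using 1 2 by linarith
      moreover have "s - (t - 1) = 1 + r" by (simp add: r_def)
      ultimately show "c * (s - t) + K * (s - t)\<^sup>2 \<le> ?b s" by (simp only: r_def)
    qed
  qed (simp_all add: h)
qed

text \<open>The minimum of F and G need not be C2, hence need not be admissible. It is approximated
  from above by C2 functions \<open>a n\<close> that have the jet of F at the contact point; in
  their viscosity inequalities only the Levy integral depends on n, and it converges by
  domination.\<close>

lemma visc_subsolution_imp_weak_subsol:
  assumes u: "visc_subsolution \<alpha> \<eta> u"
  shows "weak_subsol \<eta> Q R B 0 u"
  unfolding weak_subsol_def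
proof (intro allI impI, elim conjE)
  fix x\<^sub>0 t\<^sub>0 c K F F1 F2 G G1 G2 g
  assume t0: "0 < t\<^sub>0" and F: "C2_derivs F F1 F2" and G: "C2_derivs G G1 G2"
    and bF: "bounded (range F)" and g: "\<forall>x. g \<le> G x" and eq: "F x\<^sub>0 = G x\<^sub>0"
    and q: "quad_touch (\<lambda>x. min (F x) (G x)) x\<^sub>0 (F1 x\<^sub>0) Q B" and R: "\<bar>F1 x\<^sub>0\<bar> \<le> R"
    and max: "\<forall>x. \<forall>t\<ge>0. u (x, t) \<le> u (x\<^sub>0, t\<^sub>0) + (min (F x) (G x) - F x\<^sub>0) + c * (t - t\<^sub>0) + K * (t - t\<^sub>0)\<^sup>2"
  obtain b b1 b2 where b: "C2_derivs b b1 b2" "bounded (range b)" "b t\<^sub>0 = 0" "b1 t\<^sub>0 = c"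
    and bmaj: "\<forall>s. \<bar>s - t\<^sub>0\<bar> \<le> 1 \<longrightarrow> c * (s - t\<^sub>0) + K * (s - t\<^sub>0)\<^sup>2 \<le> b s"
    by (rule bounded_time_majorant[of t\<^sub>0 c K])
  obtain BF where BF: "\<And>x. \<bar>F x\<bar> \<le> BF" using bF unfolding bounded_iff by auto
  obtain QF MF where qF: "quad_touch F x\<^sub>0 (F1 x\<^sub>0) QF MF" by (rule C2_derivs_quad_touch[OF F BF])
  define k where "k n = 1 / real (Suc n)" for n
  define a where "a n x = F x - soft_pos (k n) (F x - G x)" for n x
  have sp: "soft_pos (k n) 0 = 0" for n by (simp add: soft_pos_def)
  have a0: "a n x\<^sub>0 = F x\<^sub>0" for n by (simp add: a_def eq sp)
  have a_bounds: "min (F x) (G x) \<le> a n x" "a n x \<le> F x" for n x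
    using soft_pos_le[of "k n" "F x - G x"] soft_pos_nonneg[of "k n" "F x - G x"] by (auto simp: a_def)
  have key: "c \<le> \<eta> * F2 x\<^sub>0 + \<bar>F1 x\<^sub>0\<bar> * levy_op \<alpha> (a n) x\<^sub>0"
    and aq: "quad_touch (a n) x\<^sub>0 (F1 x\<^sub>0) (max Q QF) (max B MF)" for n
  proof -
    obtain S1 S2 where S: "\<And>s. (soft_pos (k n) has_real_derivative S1 s) (at s)"
      "\<And>s. (S1 has_real_derivative S2 s) (at s)" "continuous_on UNIV S2" "S1 0 = 0" "S2 0 = 0"
      by (rule soft_pos_C2[of "k n"]) (auto simp: k_def)
    define D where "D x = F x - G x" for x
    define D1 where "D1 x = F1 x - G1 x" for x
    define D2 where "D2 x = F2 x - G2 x" for x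
    have D: "(D has_real_derivative D1 x) (at x)" "(D1 has_real_derivative D2 x) (at x)" for x
      using F G unfolding C2_derivs_def D_def[abs_def] D1_def[abs_def] D2_def[abs_def] by (auto intro!: DERIV_diff)
    have Dc: "continuous_on UNIV D" "continuous_on UNIV D1" "continuous_on UNIV D2"
      using C2_derivs_continuous[OF F] C2_derivs_continuous[OF G]
      unfolding D_def[abs_def] D1_def[abs_def] D2_def[abs_def] by (auto intro!: continuous_intros)
    have S1c: "continuous_on UNIV S1" using S(2) by (meson DERIV_isCont continuous_at_imp_continuous_on)
    define a1 where "a1 x = F1 x - S1 (D x) * D1 x" for x
    define a2 where "a2 x = F2 x - (S2 (D x) * D1 x * D1 x + D2 x * S1 (D x))" for x
    have an: "C2_derivs (a n) a1 a2"
      unfolding C2_derivs_def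
    proof (intro conjI allI)
      fix x
      show "(a n has_real_derivative a1 x) (at x)"
        unfolding a_def[abs_def] a1_def D_def[symmetric]
        using F by (intro DERIV_diff DERIV_chain2[OF S(1)] D) (auto simp: C2_derivs_def)
      show "(a1 has_real_derivative a2 x) (at x)"
        unfolding a1_def[abs_def] a2_def
        using F by (intro DERIV_diff DERIV_mult DERIV_chain2[OF S(2)] D) (auto simp: C2_derivs_def)
      show "continuous_on UNIV a2"
        unfolding a2_def[abs_def]
        by (intro continuous_intros C2_derivs_continuous[OF F] Dc continuous_on_compose2[OF S(3) Dc(1)] continuous_on_compose2[OF S1c Dc(1)]) auto
    qed
    have D0: "D x\<^sub>0 = 0" by (simp add: D_def eq)
    have a12: "a1 x\<^sub>0 = F1 x\<^sub>0" "a2 x\<^sub>0 = F2 x\<^sub>0" by (simp_all add: a1_def a2_def D0 S)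
    have aB: "\<bar>a n x\<bar> \<le> BF + \<bar>g\<bar>" for x
    proof -
      have "- (BF + \<bar>g\<bar>) \<le> min (F x) (G x)" "F x \<le> BF + \<bar>g\<bar>"
        using BF[of x] g[rule_format, of x] by linarith+
      then show ?thesis using a_bounds(1)[of x n] a_bounds(2)[of n x] by linarith
    qed
    have m0: "min (F x\<^sub>0) (G x\<^sub>0) = F x\<^sub>0" using eq by simp
    show aq: "quad_touch (a n) x\<^sub>0 (F1 x\<^sub>0) (max Q QF) (max B MF)"
      unfolding quad_touch_def
    proof (intro conjI allI)
      show "a n \<in> borel_measurable borel" by (rule borel_measurable_continuous_onI[OF C2_derivs_continuous(1)[OF an]])
      fix z
      \<comment> \<open>\<open>a n\<close> lies between the minimum and F, which have the same value
        and slope at the contact point, so the larger of their constants serves for every n.\<close>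
      have sandwich: "\<bar>y\<bar> \<le> r" if "\<bar>l\<bar> \<le> r1" "\<bar>h\<bar> \<le> r2" "l \<le> y" "y \<le> h" "r1 \<le> r" "r2 \<le> r" for l y h r1 r2 r :: real
        using that by linarith
      have "Q * z\<^sup>2 \<le> max Q QF * z\<^sup>2" "QF * z\<^sup>2 \<le> max Q QF * z\<^sup>2" by (intro mult_right_mono; simp)+
      then show "\<bar>a n (x\<^sub>0 + z) - a n x\<^sub>0 - F1 x\<^sub>0 * z\<bar> \<le> max Q QF * z\<^sup>2"
        using a_bounds(1)[of "x\<^sub>0 + z" n] a_bounds(2)[of n "x\<^sub>0 + z"] unfolding a0
        by (intro sandwich[OF quad_touchD(2)[OF q, of z, unfolded m0] quad_touchD(2)[OF qF, of z]]) simp_all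
      show "\<bar>a n (x\<^sub>0 + z) - a n x\<^sub>0\<bar> \<le> max B MF"
        using a_bounds(1)[of "x\<^sub>0 + z" n] a_bounds(2)[of n "x\<^sub>0 + z"] unfolding a0
        by (intro sandwich[OF quad_touchD(3)[OF q, of z, unfolded m0] quad_touchD(3)[OF qF, of z]]) simp_all
    qed
    let ?\<phi> = "\<lambda>p. a n (fst p) + b (snd p)"
    obtain Bb where Bb: "\<And>t. \<bar>b t\<bar> \<le> Bb" using b(2) unfolding bounded_iff by auto
    have "\<bar>?\<phi> p\<bar> \<le> BF + \<bar>g\<bar> + Bb" for p using aB[of "fst p"] Bb[of "snd p"] by linarith
    then have "bounded (?\<phi> ` open_domain)"
      unfolding bounded_iff real_norm_def by (intro exI[of _ "BF + \<bar>g\<bar> + Bb"] ballI) blast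
    then have tf: "test_function ?\<phi>" unfolding test_function_def using C2_on_separable[OF an b(1)] by blast
    \<comment> \<open>At most 1, because the time majorant is available only within distance 1 of
      the contact time.\<close>
    define \<tau> where "\<tau> = min 1 (t\<^sub>0 / 2)"
    have \<tau>: "0 < \<tau>" "\<tau> < t\<^sub>0" "\<tau> \<le> 1" using t0 by (auto simp: \<tau>_def)
    have "u (x, t) - ?\<phi> (x, t) \<le> u (x\<^sub>0, t\<^sub>0) - ?\<phi> (x\<^sub>0, t\<^sub>0)" if "t \<in> {t\<^sub>0 - \<tau><..<t\<^sub>0 + \<tau>}" for x t
    proof -
      have "0 \<le> t" "\<bar>t - t\<^sub>0\<bar> \<le> 1" using that \<tau> by auto
      then show ?thesis using max[rule_format, of t x] bmaj[rule_format, of t] a_bounds(1)[of x n] by (simp add: b a0)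
    qed
    then have "visc_op \<alpha> \<eta> ?\<phi> x\<^sub>0 t\<^sub>0 \<le> 0"
      using u \<tau>(1,2) tf unfolding visc_subsolution_def by blast
    then show "c \<le> \<eta> * F2 x\<^sub>0 + \<bar>F1 x\<^sub>0\<bar> * levy_op \<alpha> (a n) x\<^sub>0"
      using visc_op_separable[OF an b(1), of x\<^sub>0] aq by (simp add: a12 b)
  qed
  have "(\<lambda>n. levy_op \<alpha> (a n) x\<^sub>0) \<longlonglongrightarrow> levy_op \<alpha> (\<lambda>x. min (F x) (G x)) x\<^sub>0"
  proof (rule levy_op_tendsto[OF aq quad_touchD(1)[OF q]])
    fix z
    have "k \<longlonglongrightarrow> 0" unfolding k_def using LIMSEQ_Suc[OF lim_1_over_n[where 'a = real]] by simp
    then have "(\<lambda>n. a n (x\<^sub>0 + z)) \<longlonglongrightarrow> F (x\<^sub>0 + z) - max 0 (F (x\<^sub>0 + z) - G (x\<^sub>0 + z))"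
      unfolding a_def by (intro tendsto_intros soft_pos_tendsto)
    then show "(\<lambda>n. a n (x\<^sub>0 + z)) \<longlonglongrightarrow> min (F (x\<^sub>0 + z)) (G (x\<^sub>0 + z))" by (simp add: min_def max_def split: if_splits)
  qed
  then have "(\<lambda>n. \<eta> * F2 x\<^sub>0 + \<bar>F1 x\<^sub>0\<bar> * levy_op \<alpha> (a n) x\<^sub>0) \<longlonglongrightarrow> \<eta> * F2 x\<^sub>0 + \<bar>F1 x\<^sub>0\<bar> * levy_op \<alpha> (\<lambda>x. min (F x) (G x)) x\<^sub>0"
    by (intro tendsto_intros)
  then have "c \<le> \<eta> * F2 x\<^sub>0 + \<bar>F1 x\<^sub>0\<bar> * levy_op \<alpha> (\<lambda>x. min (F x) (G x)) x\<^sub>0"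
    using key by (intro LIMSEQ_le_const) auto
  then show "c \<le> \<eta> * F2 x\<^sub>0 + \<bar>F1 x\<^sub>0\<bar> * levy_op \<alpha> (\<lambda>x. min (F x) (G x)) x\<^sub>0 + 0" by simp
qed

end

section \<open>Approximate flows as weak subsolutions\<close>

lemma approx_flowE:
  assumes "approx_flow \<alpha> \<eta> \<delta> M e W"
  obtains L W1 W2 where "\<forall>x. \<forall>t\<ge>0. \<bar>W (x, t)\<bar> \<le> M" "continuous_on closed_domain W"
    "\<forall>x. \<forall>s\<ge>0. \<forall>t\<ge>0. \<bar>W (x, t) - W (x, s)\<bar> \<le> L * \<bar>t - s\<bar>"
    "\<forall>t\<ge>0. C2_derivs (\<lambda>y. W (y, t)) (W1 t) (W2 t)" "residual_le \<alpha> \<eta> \<delta> e W W2"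
  using assms unfolding approx_flow_def by (elim conjE exE) (rule that)

lemma approx_flowI:
  assumes "\<forall>x. \<forall>t\<ge>0. \<bar>W (x, t)\<bar> \<le> M" "continuous_on closed_domain W"
    "\<forall>x. \<forall>s\<ge>0. \<forall>t\<ge>0. \<bar>W (x, t) - W (x, s)\<bar> \<le> L * \<bar>t - s\<bar>"
    "\<forall>t\<ge>0. C2_derivs (\<lambda>y. W (y, t)) (W1 t) (W2 t)" "residual_le \<alpha> \<eta> \<delta> e W W2"
  shows "approx_flow \<alpha> \<eta> \<delta> M e W"
  unfolding approx_flow_def using assms by (intro conjI exI[of _ W1] exI[of _ W2] exI[of _ L]) assumption+

lemma approx_flow_mono:
  assumes "approx_flow \<alpha> \<eta> \<delta> M e W" "M \<le> M'" "e \<le> e'"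
  shows "approx_flow \<alpha> \<eta> \<delta> M' e' W"
proof -
  obtain L W1 W2 where W: "\<forall>x. \<forall>t\<ge>0. \<bar>W (x, t)\<bar> \<le> M" "continuous_on closed_domain W"
    "\<forall>x. \<forall>s\<ge>0. \<forall>t\<ge>0. \<bar>W (x, t) - W (x, s)\<bar> \<le> L * \<bar>t - s\<bar>"
    "\<forall>t\<ge>0. C2_derivs (\<lambda>y. W (y, t)) (W1 t) (W2 t)" "residual_le \<alpha> \<eta> \<delta> e W W2"
    using assms(1) by (rule approx_flowE)
  have "\<forall>x. \<forall>t\<ge>0. \<bar>W (x, t)\<bar> \<le> M'" using W(1) assms(2) order_trans by blast
  moreover have "residual_le \<alpha> \<eta> \<delta> e' W W2"
    using W(5) order_trans[OF _ assms(3)] unfolding residual_le_def by meson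
  ultimately show ?thesis using W(2-4) by (intro approx_flowI)
qed

context levy_exponent begin

lemma approx_flow_uminus:
  assumes "approx_flow \<alpha> \<eta> \<delta> M e W"
  shows "approx_flow \<alpha> \<eta> \<delta> M e (\<lambda>p. - W p)"
proof -
  obtain L W1 W2 where W: "\<forall>x. \<forall>t\<ge>0. \<bar>W (x, t)\<bar> \<le> M" "continuous_on closed_domain W"
    "\<forall>x. \<forall>s\<ge>0. \<forall>t\<ge>0. \<bar>W (x, t) - W (x, s)\<bar> \<le> L * \<bar>t - s\<bar>"
    "\<forall>t\<ge>0. C2_derivs (\<lambda>y. W (y, t)) (W1 t) (W2 t)" "residual_le \<alpha> \<eta> \<delta> e W W2"
    using assms by (rule approx_flowE)
  have neg: "\<bar>(- W (x, t) - - W (x, t - r)) / r - (\<eta> * - W2 t x + nonlin \<alpha> \<delta> (\<lambda>y. - W (y, t)) x)\<bar>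
     = \<bar>(W (x, t) - W (x, t - r)) / r - (\<eta> * W2 t x + nonlin \<alpha> \<delta> (\<lambda>y. W (y, t)) x)\<bar>" for x t r
  proof -
    have "(- W (x, t) - - W (x, t - r)) / r = - ((W (x, t) - W (x, t - r)) / r)"
      by (simp only: minus_divide_left) simp
    then show ?thesis unfolding nonlin_uminus by linarith
  qed
  show ?thesis
  proof (rule approx_flowI)
    show "\<forall>x. \<forall>t\<ge>0. \<bar>- W (x, t)\<bar> \<le> M" using W(1) by simp
    show "continuous_on closed_domain (\<lambda>p. - W p)" using W(2) by (rule continuous_on_minus)
    show "\<forall>x. \<forall>s\<ge>0. \<forall>t\<ge>0. \<bar>- W (x, t) - - W (x, s)\<bar> \<le> L * \<bar>t - s\<bar>"
      using W(3) by (simp add: abs_minus_commute)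
    show "\<forall>t\<ge>0. C2_derivs (\<lambda>y. - W (y, t)) (\<lambda>x. - W1 t x) (\<lambda>x. - W2 t x)"
      using W(4) DERIV_minus continuous_on_minus unfolding C2_derivs_def by blast
    show "residual_le \<alpha> \<eta> \<delta> e (\<lambda>p. - W p) (\<lambda>t x. - W2 t x)"
      using W(5) unfolding residual_le_def neg .
  qed
qed

text \<open>The derivative of \<psi> is also the limit of its left quotients, and where \<psi>
  touches w from above on the left these are at most the quotients of w.\<close>

lemma left_slope_le:
  fixes w \<psi> :: "real \<Rightarrow> real"
  assumes d: "(\<psi> has_real_derivative c) (at t)" and "0 < \<rho>" "0 < r\<^sub>0"
    and le: "\<And>r. 0 < r \<Longrightarrow> r < \<rho> \<Longrightarrow> w (t - r) - w t \<le> \<psi> (t - r) - \<psi> t"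
    and B: "\<And>r. 0 < r \<Longrightarrow> r \<le> r\<^sub>0 \<Longrightarrow> (w t - w (t - r)) / r \<le> B"
  shows "c \<le> B"
proof -
  have "((\<lambda>h. (\<psi> (t + h) - \<psi> t) / h) \<longlongrightarrow> c) (at 0)" using d by (simp add: DERIV_def)
  then have "((\<lambda>h. (\<psi> (t + h) - \<psi> t) / h) \<longlongrightarrow> c) (at_left 0)" by (rule filterlim_at_split[THEN iffD1, THEN conjunct1])
  then have "((\<lambda>r. (\<psi> (t + - r) - \<psi> t) / - r) \<longlongrightarrow> c) (at_right 0)"
    by (subst (asm) at_left_minus) (simp add: filterlim_filtermap)
  moreover have "(\<psi> (t + - r) - \<psi> t) / - r = (\<psi> t - \<psi> (t - r)) / r" for r
    by (simp add: minus_divide_right[symmetric] minus_divide_left)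
  ultimately have lim: "((\<lambda>r. (\<psi> t - \<psi> (t - r)) / r) \<longlongrightarrow> c) (at_right 0)" by simp
  have "\<forall>\<^sub>F r in at_right 0. (\<psi> t - \<psi> (t - r)) / r \<le> B"
    unfolding eventually_at_right_field
  proof (rule exI[of _ "min r\<^sub>0 \<rho>"], intro conjI allI impI)
    fix r assume r: "0 < r" "r < min r\<^sub>0 \<rho>"
    then have "\<psi> t - \<psi> (t - r) \<le> w t - w (t - r)" using le[of r] by simp
    then have "(\<psi> t - \<psi> (t - r)) / r \<le> (w t - w (t - r)) / r" using r by (intro divide_right_mono) auto
    then show "(\<psi> t - \<psi> (t - r)) / r \<le> B" using B[of r] r by simp
  qed (use assms in auto)
  then show ?thesis using lim by (intro tendsto_upperbound) auto
qed

lemma residual_upper: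
  assumes W: "residual_le \<alpha> \<eta> \<delta> e W W2" and t: "0 < t" "0 < \<rho>" "\<rho> \<le> t"
    and d: "(\<psi> has_real_derivative c) (at t)"
    and le: "\<And>s. t - \<rho> < s \<Longrightarrow> s < t \<Longrightarrow> W (x, s) - W (x, t) \<le> \<psi> s - \<psi> t"
  shows "c \<le> \<eta> * W2 t x + nonlin \<alpha> \<delta> (\<lambda>y. W (y, t)) x + e"
proof -
  obtain r\<^sub>0 where r0: "0 < r\<^sub>0" "\<forall>x r. 0 < r \<and> r \<le> r\<^sub>0 \<longrightarrow>
      \<bar>(W (x, t) - W (x, t - r)) / r - (\<eta> * W2 t x + nonlin \<alpha> \<delta> (\<lambda>y. W (y, t)) x)\<bar> \<le> e"
    using W t(1) unfolding residual_le_def by blast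
  show ?thesis
  proof (rule left_slope_le[OF d t(2) r0(1), of "\<lambda>s. W (x, s)"])
    fix r :: real assume "0 < r"
    then show "r < \<rho> \<Longrightarrow> W (x, t - r) - W (x, t) \<le> \<psi> (t - r) - \<psi> t" using le[of "t - r"] by simp
    show "(W (x, t) - W (x, t - r)) / r \<le> \<eta> * W2 t x + nonlin \<alpha> \<delta> (\<lambda>y. W (y, t)) x + e" if "r \<le> r\<^sub>0"
      using r0(2)[rule_format, OF conjI[OF \<open>0 < r\<close> that], of x] by linarith
  qed
qed

lemma residual_lower:
  assumes W: "residual_le \<alpha> \<eta> \<delta> e W W2" and t: "0 < t"
    and d: "(\<psi> has_real_derivative c) (at t)"
    and le: "\<And>s. 0 \<le> s \<Longrightarrow> s < t \<Longrightarrow> \<psi> s - \<psi> t \<le> W (x, s) - W (x, t)"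
  shows "\<eta> * W2 t x + nonlin \<alpha> \<delta> (\<lambda>y. W (y, t)) x - e \<le> c"
proof -
  obtain r\<^sub>0 where r0: "0 < r\<^sub>0" "\<forall>x r. 0 < r \<and> r \<le> r\<^sub>0 \<longrightarrow>
      \<bar>(W (x, t) - W (x, t - r)) / r - (\<eta> * W2 t x + nonlin \<alpha> \<delta> (\<lambda>y. W (y, t)) x)\<bar> \<le> e"
    using W t unfolding residual_le_def by blast
  have "- c \<le> - (\<eta> * W2 t x + nonlin \<alpha> \<delta> (\<lambda>y. W (y, t)) x - e)"
  proof (rule left_slope_le[OF DERIV_minus[OF d] t r0(1), of "\<lambda>s. - W (x, s)"])
    fix r :: real assume "0 < r"
    then show "r < t \<Longrightarrow> - W (x, t - r) - - W (x, t) \<le> - \<psi> (t - r) - - \<psi> t" using le[of "t - r"] by simp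
    have neg: "(- W (x, t) - - W (x, t - r)) / r = - ((W (x, t) - W (x, t - r)) / r)"
      by (simp only: minus_divide_left) simp
    show "(- W (x, t) - - W (x, t - r)) / r \<le> - (\<eta> * W2 t x + nonlin \<alpha> \<delta> (\<lambda>y. W (y, t)) x - e)" if "r \<le> r\<^sub>0"
      using r0(2)[rule_format, OF conjI[OF \<open>0 < r\<close> that], of x] unfolding neg by linarith
  qed
  then show ?thesis by simp
qed

text \<open>F touches W from above, which bounds the second derivative. The minimum touches as well,
  which bounds \<open>nonlin\<close> by monotonicity. Consistency is then invoked at the minimum,
  whose parabola constants are prescribed, rather than at W.\<close>

lemma approx_flow_imp_weak_subsol:
  assumes \<eta>: "0 \<le> \<eta>" and \<delta>: "0 < \<delta>" and W: "approx_flow \<alpha> \<eta> \<delta> M e W"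
    and cons: "\<And>A x p. quad_touch A x p Q B \<Longrightarrow> \<bar>p\<bar> \<le> R \<Longrightarrow> \<bar>nonlin \<alpha> \<delta> A x - \<bar>p\<bar> * levy_op \<alpha> A x\<bar> \<le> e'"
  shows "weak_subsol \<eta> Q R B (e + e') W"
  unfolding weak_subsol_def
proof (intro allI impI, elim conjE)
  fix x\<^sub>0 t\<^sub>0 c K F F1 F2 G G1 G2 g
  assume t0: "0 < t\<^sub>0" and F: "C2_derivs F F1 F2" and G: "C2_derivs G G1 G2"
    and bF: "bounded (range F)" and g: "\<forall>x. g \<le> G x" and eq: "F x\<^sub>0 = G x\<^sub>0"
    and q: "quad_touch (\<lambda>x. min (F x) (G x)) x\<^sub>0 (F1 x\<^sub>0) Q B" and R: "\<bar>F1 x\<^sub>0\<bar> \<le> R"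
    and max: "\<forall>x. \<forall>t\<ge>0. W (x, t) \<le> W (x\<^sub>0, t\<^sub>0) + (min (F x) (G x) - F x\<^sub>0) + c * (t - t\<^sub>0) + K * (t - t\<^sub>0)\<^sup>2"
  obtain W1 W2 where W12: "\<forall>t\<ge>0. C2_derivs (\<lambda>y. W (y, t)) (W1 t) (W2 t)" "residual_le \<alpha> \<eta> \<delta> e W W2"
    using W by (rule approx_flowE)
  let ?A = "\<lambda>x. min (F x) (G x)"
  have C2W: "C2_derivs (\<lambda>y. W (y, t\<^sub>0)) (W1 t\<^sub>0) (W2 t\<^sub>0)" using W12 t0 by simp
  have "c \<le> \<eta> * W2 t\<^sub>0 x\<^sub>0 + nonlin \<alpha> \<delta> (\<lambda>y. W (y, t\<^sub>0)) x\<^sub>0 + e"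
  proof (rule residual_upper[OF W12(2) t0 t0 order_refl, of "\<lambda>t. c * (t - t\<^sub>0) + K * (t - t\<^sub>0)\<^sup>2"])
    show "((\<lambda>t. c * (t - t\<^sub>0) + K * (t - t\<^sub>0)\<^sup>2) has_real_derivative c) (at t\<^sub>0)"
      by (auto intro!: derivative_eq_intros)
    fix s :: real assume "t\<^sub>0 - t\<^sub>0 < s"
    then show "W (x\<^sub>0, s) - W (x\<^sub>0, t\<^sub>0) \<le> c * (s - t\<^sub>0) + K * (s - t\<^sub>0)\<^sup>2 - (c * (t\<^sub>0 - t\<^sub>0) + K * (t\<^sub>0 - t\<^sub>0)\<^sup>2)"
      using max[rule_format, of s x\<^sub>0] by (simp add: eq)
  qed
  moreover have "\<eta> * W2 t\<^sub>0 x\<^sub>0 \<le> \<eta> * F2 x\<^sub>0"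
  proof -
    have "W2 t\<^sub>0 x\<^sub>0 - F2 x\<^sub>0 \<le> 0"
    proof (rule second_deriv_nonpos_at_max(2)[where f = "\<lambda>x. W (x, t\<^sub>0) - F x" and r = 1])
      show "W (y, t\<^sub>0) - F y \<le> W (x\<^sub>0, t\<^sub>0) - F x\<^sub>0" for y using max[rule_format, of t\<^sub>0 y] t0 by simp
    qed (use C2W F in \<open>auto simp: C2_derivs_def intro!: DERIV_diff\<close>)
    then show ?thesis using \<eta> by (intro mult_left_mono) auto
  qed
  moreover have "nonlin \<alpha> \<delta> (\<lambda>y. W (y, t\<^sub>0)) x\<^sub>0 \<le> nonlin \<alpha> \<delta> ?A x\<^sub>0"
  proof (rule nonlin_mono[OF \<delta> _ quad_touchD(1)[OF q]])
    show "(\<lambda>y. W (y, t\<^sub>0)) \<in> borel_measurable borel"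
      by (rule borel_measurable_continuous_onI[OF C2_derivs_continuous(1)[OF C2W]])
    show "\<bar>W (y, t\<^sub>0)\<bar> \<le> M" for y using W t0 by (simp add: approx_flow_def)
    show "\<bar>?A y\<bar> \<le> \<bar>?A x\<^sub>0\<bar> + B" for y using quad_touchD(3)[OF q, of "y - x\<^sub>0"] by simp
    show "W (x\<^sub>0 + z, t\<^sub>0) - W (x\<^sub>0, t\<^sub>0) \<le> ?A (x\<^sub>0 + z) - ?A x\<^sub>0" for z
      using max[rule_format, of t\<^sub>0 "x\<^sub>0 + z"] t0 by (simp add: eq)
  qed
  moreover have "nonlin \<alpha> \<delta> ?A x\<^sub>0 \<le> \<bar>F1 x\<^sub>0\<bar> * levy_op \<alpha> ?A x\<^sub>0 + e'"
    using cons[OF q R] by (simp add: abs_le_iff)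
  ultimately show "c \<le> \<eta> * F2 x\<^sub>0 + \<bar>F1 x\<^sub>0\<bar> * levy_op \<alpha> ?A x\<^sub>0 + (e + e')" by linarith
qed

end

section \<open>Comparison\<close>

lemma abs_le_one_plus_square: "\<bar>r\<bar> \<le> 1 + r\<^sup>2" for r :: real
proof -
  have "0 \<le> (\<bar>r\<bar> - 1)\<^sup>2" by simp
  then have "2 * \<bar>r\<bar> \<le> 1 + r\<^sup>2" by (simp add: power2_diff)
  then show ?thesis by linarith
qed

text \<open>A near-maximiser before doubling time is chosen first, and the small penalty is centred
  at its space coordinate \<open>x1\<close>. Leaving the unit interval around \<open>x1\<close>
  costs k/2, more than the k/4 missing to the supremum plus the k/8 that doubling time can gain;
  hence a maximum over a compact box is global.\<close>

lemma doubling_max_exists: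
  fixes u W :: "real \<times> real \<Rightarrow> real"
  assumes cu: "continuous_on closed_domain u" and cW: "continuous_on closed_domain W"
    and Mu: "\<And>x t. 0 \<le> t \<Longrightarrow> \<bar>u (x, t)\<bar> \<le> M" and MW: "\<And>x t. 0 \<le> t \<Longrightarrow> \<bar>W (x, t)\<bar> \<le> M"
    and L: "\<And>x s t. 0 \<le> s \<Longrightarrow> 0 \<le> t \<Longrightarrow> \<bar>W (x, t) - W (x, s)\<bar> \<le> L * \<bar>t - s\<bar>"
    and a: "0 < a" and \<theta>: "0 < \<theta>" and k: "0 < k" "2 * k \<le> \<rho>"
    and init: "\<And>x y. u (x, 0) - W (y, 0) - a * (x - y)\<^sup>2 \<le> \<rho> / 2"
    and big: "0 \<le> t'" "\<rho> < u (x', t') - W (x', t') - \<theta> * t'"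
  obtains g x1 xb yb tb sb where "0 < g" "0 < tb" "0 < sb" "a * (xb - yb)\<^sup>2 \<le> 2 * M"
    "\<forall>x y t s. 0 \<le> t \<longrightarrow> 0 \<le> s \<longrightarrow>
       u (x, t) - W (y, s) - a * (x - y)\<^sup>2 - g * (t - s)\<^sup>2 - \<theta> * t - k * bump (x - x1)
       \<le> u (xb, tb) - W (yb, sb) - a * (xb - yb)\<^sup>2 - g * (tb - sb)\<^sup>2 - \<theta> * tb - k * bump (xb - x1)"
proof -
  have M0: "0 \<le> M" using order_trans[OF abs_ge_zero Mu[of 0 0]] by simp
  define \<Psi> where "\<Psi> x y t = u (x, t) - W (y, t) - a * (x - y)\<^sup>2 - \<theta> * t" for x y t
  define V where "V = {\<Psi> x y t |x y t. 0 \<le> t}"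
  have \<Psi>M: "\<Psi> x y t \<le> 2 * M" if "0 \<le> t" for x y t
  proof -
    have "0 \<le> a * (x - y)\<^sup>2" "0 \<le> \<theta> * t" using a \<theta> that by simp_all
    then show ?thesis using Mu[OF that, of x] MW[OF that, of y] unfolding \<Psi>_def by linarith
  qed
  have V: "V \<noteq> {}" "bdd_above V" using \<Psi>M unfolding V_def by (auto intro!: bdd_aboveI[of _ "2 * M"])
  define S where "S = Sup V"
  have \<Psi>S: "\<Psi> x y t \<le> S" if "0 \<le> t" for x y t
    unfolding S_def using that V by (intro cSup_upper) (auto simp: V_def)
  have S\<rho>: "\<rho> < S" using \<Psi>S[OF big(1), of x' x'] big(2) by (simp add: \<Psi>_def)
  have "S - k / 4 < Sup V" using k by (simp add: S_def)
  then obtain x1 y1 t1 where p1: "0 \<le> t1" "S - k / 4 < \<Psi> x1 y1 t1"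
    using less_cSup_iff[OF V, of "S - k / 4"] unfolding V_def by auto
  have "compact ({x1 - 1..x1 + 1} \<times> {0..1::real})" by (intro compact_Times compact_Icc)
  moreover have "continuous_on ({x1 - 1..x1 + 1} \<times> {0..1}) u"
    by (rule continuous_on_subset[OF cu]) (auto simp: closed_domain_def)
  ultimately have uc: "uniformly_continuous_on ({x1 - 1..x1 + 1} \<times> {0..1}) u" by (intro compact_uniformly_continuous)
  have "0 < k / 4" using k by simp
  from uc[unfolded uniformly_continuous_on_def, rule_format, OF this]
  obtain d where d: "0 < d" "\<And>p q. p \<in> {x1 - 1..x1 + 1} \<times> {0..1} \<Longrightarrow> q \<in> {x1 - 1..x1 + 1} \<times> {0..1} \<Longrightarrow> dist q p < d \<Longrightarrow> dist (u q) (u p) < k / 4"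
    by blast
  \<comment> \<open>Up to time tc the function u stays within k/4 of its initial values on the strip
    around \<open>x1\<close>.\<close>
  define tc where "tc = min 1 (d / 2)"
  have tc: "0 < tc" "tc \<le> 1" "tc < d" using d(1) by (auto simp: tc_def)
  \<comment> \<open>The first term forces tb <= tc when sb = 0, the second absorbs the Lipschitz
    constant of W, the third gives positivity.\<close>
  define g where "g = 2 * M / tc\<^sup>2 + 2 * L\<^sup>2 / k + 1"
  have g1: "0 < g" using M0 k by (simp add: g_def add_nonneg_pos)
  have g2: "2 * M \<le> g * tc\<^sup>2"
  proof -
    have "2 * M = 2 * M / tc\<^sup>2 * tc\<^sup>2" using tc by simp
    also have "\<dots> \<le> g * tc\<^sup>2" using M0 k by (intro mult_right_mono) (auto simp: g_def)
    finally show ?thesis .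
  qed
  have g3: "L * r - g * r\<^sup>2 \<le> k / 8" for r
  proof -
    have "2 * L\<^sup>2 / k * r\<^sup>2 \<le> g * r\<^sup>2" using M0 by (intro mult_right_mono) (auto simp: g_def)
    \<comment> \<open>Completing the square shows that the gain from doubling time is at most
      k/8.\<close>
    moreover have "L * r - 2 * L\<^sup>2 / k * r\<^sup>2 = k / 8 - 2 / k * (L * r - k / 4)\<^sup>2"
      using k by (simp add: power2_eq_square field_simps)
    moreover have "0 \<le> 2 / k * (L * r - k / 4)\<^sup>2" using k by simp
    ultimately show ?thesis by linarith
  qed
  define \<Phi> where "\<Phi> x y t s = u (x, t) - W (y, s) - a * (x - y)\<^sup>2 - g * (t - s)\<^sup>2 - \<theta> * t - k * bump (x - x1)" for x y t s
  have \<Phi>\<Psi>: "\<Phi> x y t s \<le> \<Psi> x y t + k / 8 - k * bump (x - x1)" if "0 \<le> t" "0 \<le> s" for x y t s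
    using abs_le_D1[OF L[OF that(2,1), of y]] g3[of "\<bar>t - s\<bar>", unfolded power2_abs] unfolding \<Phi>_def \<Psi>_def by linarith
  have kb: "0 \<le> k * bump z" for z using k bump_nonneg by simp
  have nn: "0 \<le> a * (x - y)\<^sup>2" "0 \<le> g * (x - y)\<^sup>2" for x y using a g1 by simp_all
  have \<Phi>parts: "a * (x - y)\<^sup>2 + g * (t - s)\<^sup>2 + \<theta> * t \<le> 2 * M" if "0 \<le> \<Phi> x y t s" "0 \<le> t" "0 \<le> s" for x y t s
    using that Mu[OF that(2), of x] MW[OF that(3), of y] kb[of "x - x1"] unfolding \<Phi>_def by linarith
  define Y where "Y = 2 * M / a + 1"
  define T where "T = 2 * M / \<theta>"
  define T' where "T' = T + (2 * M / g + 1)"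
  have root: "\<bar>r\<bar> \<le> 2 * M / b + 1" if "b * r\<^sup>2 \<le> 2 * M" "0 < b" for r b
  proof -
    have "r\<^sup>2 \<le> 2 * M / b" using that by (simp add: field_simps)
    then show ?thesis using abs_le_one_plus_square[of r] by linarith
  qed
  define K where "K = {x1 - 1..x1 + 1} \<times> {x1 - 1 - Y..x1 + 1 + Y} \<times> {0..T} \<times> {0..T'}"
  have inK: "(x, y, t, s) \<in> K" if "0 \<le> \<Phi> x y t s" "0 \<le> t" "0 \<le> s" "\<bar>x - x1\<bar> \<le> 1" for x y t s
  proof -
    note P = \<Phi>parts[OF that(1-3)]
    have \<theta>t: "0 \<le> \<theta> * t" using \<theta> that by simp
    have "\<bar>x - y\<bar> \<le> Y" unfolding Y_def using P nn[of t s] \<theta>t by (intro root a) linarith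
    moreover have "\<bar>t - s\<bar> \<le> 2 * M / g + 1" using P nn[of x y] \<theta>t by (intro root g1) linarith
    moreover have "\<theta> * t \<le> 2 * M" using P nn[of x y] nn[of t s] by linarith
    then have "t \<le> T" unfolding T_def using \<theta> by (simp add: field_simps)
    ultimately show ?thesis using that(2-4) unfolding K_def T'_def by (auto simp: abs_le_iff)
  qed
  have \<Phi>1: "S - k / 4 < \<Phi> x1 y1 t1 t1" using p1 by (simp add: \<Phi>_def \<Psi>_def)
  have Spos: "0 < S - k / 4" using S\<rho> k by linarith
  have K1: "(x1, y1, t1, t1) \<in> K" using \<Phi>1 Spos p1 by (intro inK) auto
  have contu: "continuous_on K (\<lambda>p. u (fst p, fst (snd (snd p))))"
    by (rule continuous_on_compose2[OF cu]) (auto intro!: continuous_intros simp: K_def closed_domain_def)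
  have contW: "continuous_on K (\<lambda>p. W (fst (snd p), snd (snd (snd p))))"
    by (rule continuous_on_compose2[OF cW]) (auto intro!: continuous_intros simp: K_def closed_domain_def)
  have contb: "continuous_on K (\<lambda>p. bump (fst p - x1))"
    by (rule continuous_on_compose2[OF bump_continuous(1)[of UNIV]]) (auto intro!: continuous_intros)
  have "continuous_on K (\<lambda>p. \<Phi> (fst p) (fst (snd p)) (fst (snd (snd p))) (snd (snd (snd p))))"
    unfolding \<Phi>_def by (intro continuous_intros contu contW contb)
  moreover have "compact K" unfolding K_def by (intro compact_Times compact_Icc)
  ultimately obtain pb where pb: "pb \<in> K" "\<forall>p\<in>K. \<Phi> (fst p) (fst (snd p)) (fst (snd (snd p))) (snd (snd (snd p)))
      \<le> \<Phi> (fst pb) (fst (snd pb)) (fst (snd (snd pb))) (snd (snd (snd pb)))"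
    using K1 continuous_attains_sup[of K] by blast
  obtain xb yb tb sb where pbe: "pb = (xb, yb, tb, sb)" by (cases pb) auto
  have b: "\<bar>xb - x1\<bar> \<le> 1" "0 \<le> tb" "0 \<le> sb" using pb(1) unfolding pbe K_def by auto
  have \<Phi>K: "\<Phi> x y t s \<le> \<Phi> xb yb tb sb" if "(x, y, t, s) \<in> K" for x y t s
    using pb(2) that unfolding pbe by force
  have \<Phi>b: "S - k / 4 < \<Phi> xb yb tb sb" using \<Phi>1 \<Phi>K[OF K1] by linarith
  have max: "\<Phi> x y t s \<le> \<Phi> xb yb tb sb" if "0 \<le> t" "0 \<le> s" for x y t s
  proof (cases "\<bar>x - x1\<bar> \<le> 1")
    case True
    show ?thesis
    proof (cases "0 \<le> \<Phi> x y t s")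
      case pos: True
      show ?thesis by (rule \<Phi>K[OF inK[OF pos that True]])
    qed (use \<Phi>b Spos in linarith)
  next
    case False
    then have "k * (1 / 2) \<le> k * bump (x - x1)" using k by (intro mult_left_mono bump_ge_half) auto
    then show ?thesis using \<Phi>\<Psi>[OF that, of x y] \<Psi>S[OF that(1), of x y] \<Phi>b k by linarith
  qed
  have Pb: "a * (xb - yb)\<^sup>2 + g * (tb - sb)\<^sup>2 + \<theta> * tb \<le> 2 * M" using \<Phi>b Spos b by (intro \<Phi>parts) auto
  have \<theta>tb: "0 \<le> \<theta> * tb" using \<theta> b by simp
  \<comment> \<open>A contact at time 0 would leave at most \<rho>/2 plus a small multiple of k,
    less than the value \<rho> - k/4 exceeded at the maximum. For sb = 0 the time penalty first
    brings tb below tc.\<close>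
  have tb: "tb \<noteq> 0"
  proof
    assume "tb = 0"
    then have "\<Phi> xb yb tb sb \<le> \<rho> / 2 + k / 8"
      using \<Phi>\<Psi>[OF b(2,3), of xb yb] kb[of "xb - x1"] init[of xb yb] by (simp add: \<Psi>_def)
    then show False using \<Phi>b S\<rho> k by linarith
  qed
  have sb: "sb \<noteq> 0"
  proof
    assume s0: "sb = 0"
    have "g * (tb - 0)\<^sup>2 \<le> g * tc\<^sup>2" using Pb[unfolded s0] nn(1)[of xb yb] \<theta>tb g2 by linarith
    then have "g * tb\<^sup>2 \<le> g * tc\<^sup>2" by (simp only: diff_zero)
    then have "tb\<^sup>2 \<le> tc\<^sup>2" using g1 by (rule mult_left_le_imp_le)
    then have "tb \<le> tc" using less_imp_le[OF tc(1)] by (rule power2_le_imp_le)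
    then have "dist (u (xb, tb)) (u (xb, 0)) < k / 4"
      using b tc by (intro d(2)) (auto simp: dist_Pair_Pair dist_real_def abs_le_iff)
    then have "u (xb, tb) \<le> u (xb, 0) + k / 4" unfolding dist_real_def by linarith
    then have "\<Phi> xb yb tb sb \<le> \<rho> / 2 + k / 4"
      using init[of xb yb] kb[of "xb - x1"] nn(2)[of tb sb] \<theta>tb unfolding \<Phi>_def s0 by linarith
    then show False using \<Phi>b S\<rho> k by linarith
  qed
  show ?thesis
  proof (rule that[of g tb sb xb yb x1])
    show "a * (xb - yb)\<^sup>2 \<le> 2 * M" using Pb nn(2)[of tb sb] \<theta>tb by linarith
    show "\<forall>x y t s. 0 \<le> t \<longrightarrow> 0 \<le> s \<longrightarrow>
       u (x, t) - W (y, s) - a * (x - y)\<^sup>2 - g * (t - s)\<^sup>2 - \<theta> * t - k * bump (x - x1)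
       \<le> u (xb, tb) - W (yb, sb) - a * (xb - yb)\<^sup>2 - g * (tb - sb)\<^sup>2 - \<theta> * tb - k * bump (xb - x1)"
      using max unfolding \<Phi>_def by blast
  qed (use g1 tb sb b in auto)
qed

section \<open>The inequality at a maximum point of the doubled function\<close>

lemma quad_touch_mono:
  assumes "quad_touch A x p Q M" "Q \<le> Q'" "M \<le> M'" shows "quad_touch A x p Q' M'"
  using assms(1) mult_right_mono[OF assms(2) zero_le_power2] order_trans[OF _ assms(3)]
  unfolding quad_touch_def by (meson order_trans)

lemma quad_touch_bump: "quad_touch (\<lambda>x. bump (x - a)) x (bump1 (x - a)) 3 1"
  unfolding quad_touch_def
proof (intro conjI allI)
  show "(\<lambda>x. bump (x - a)) \<in> borel_measurable borel"
    by (intro borel_measurable_continuous_onI continuous_on_compose2[OF bump_continuous(1)[of UNIV]]) (auto intro!: continuous_intros)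
  show "\<bar>bump (x + z - a) - bump (x - a) - bump1 (x - a) * z\<bar> \<le> 3 * z\<^sup>2" for z
    using bump_taylor[of "x - a" z] by (simp add: algebra_simps)
  show "\<bar>bump (x + z - a) - bump (x - a)\<bar> \<le> 1" for z
    using bump_nonneg[of "x + z - a"] bump_le_1[of "x + z - a"] bump_nonneg[of "x - a"] bump_le_1[of "x - a"] by linarith
qed

lemma levy_op_translate: "levy_op \<alpha> (\<lambda>y. A (y + h)) x = levy_op \<alpha> A (x + h)"
proof -
  have "A (x + z + h) = A (x + h + z)" "A (x - z + h) = A (x + h - z)" for z by (simp_all add: algebra_simps)
  then show ?thesis unfolding levy_op_def by (simp only:)
qed

context levy_exponent begin

lemma weak_subsolD:
  assumes "weak_subsol \<eta> Q R B e u" "0 < t\<^sub>0" "C2_derivs F F1 F2" "C2_derivs G G1 G2" "bounded (range F)"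
    "\<And>x. g \<le> G x" "F x\<^sub>0 = G x\<^sub>0" "quad_touch (\<lambda>x. min (F x) (G x)) x\<^sub>0 (F1 x\<^sub>0) Q B" "\<bar>F1 x\<^sub>0\<bar> \<le> R"
    "\<And>x t. 0 \<le> t \<Longrightarrow> u (x, t) \<le> u (x\<^sub>0, t\<^sub>0) + (min (F x) (G x) - F x\<^sub>0) + c * (t - t\<^sub>0) + K * (t - t\<^sub>0)\<^sup>2"
  shows "c \<le> \<eta> * F2 x\<^sub>0 + \<bar>F1 x\<^sub>0\<bar> * levy_op \<alpha> (\<lambda>x. min (F x) (G x)) x\<^sub>0 + e"
  using assms(1)[unfolded weak_subsol_def, rule_format, of t\<^sub>0 F F1 F2 G G1 G2 g x\<^sub>0 c K] assms(2-) by simp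

text \<open>When the inequalities for u and W are subtracted, the time slopes and the second
  derivative of W cancel, and the nonlocal terms differ only through the penalty. Everything
  proportional to k therefore comes from \<open>bump\<close>.\<close>

lemma doubling_max_inequality:
  assumes \<eta>: "0 \<le> \<eta>" and \<delta>: "0 < \<delta>"
    and Mu: "\<And>x t. 0 \<le> t \<Longrightarrow> \<bar>u (x, t)\<bar> \<le> M"
    and W: "approx_flow \<alpha> \<eta> \<delta> M E W"
    and u: "weak_subsol \<eta> (a + 3) (2 + 8 * a * M) (2 * M + 2) E u"
    and cons: "\<And>A x p. quad_touch A x p (a + 3) (2 * M + 2) \<Longrightarrow> \<bar>p\<bar> \<le> 2 + 8 * a * M \<Longrightarrow>
      \<bar>nonlin \<alpha> \<delta> A x - \<bar>p\<bar> * levy_op \<alpha> A x\<bar> \<le> E"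
    and pos: "0 < a" "0 < k" "k \<le> 1" "0 < g" "0 < tb" "0 < sb"
    and close: "a * (xb - yb)\<^sup>2 \<le> 2 * M"
    and max: "\<And>x y t s. 0 \<le> t \<Longrightarrow> 0 \<le> s \<Longrightarrow>
       u (x, t) - W (y, s) - a * (x - y)\<^sup>2 - g * (t - s)\<^sup>2 - \<theta> * t - k * bump (x - x1)
       \<le> u (xb, tb) - W (yb, sb) - a * (xb - yb)\<^sup>2 - g * (tb - sb)\<^sup>2 - \<theta> * tb - k * bump (xb - x1)"
  shows "\<theta> \<le> 3 * E + k * (6 * \<eta> + levy_const \<alpha> * (a + 2 * M + 5) * levy_mass \<alpha>
           + (2 + 8 * a * M) * (levy_const \<alpha> * 4 * levy_mass \<alpha>))"
proof -
  have M0: "0 \<le> M" using order_trans[OF abs_ge_zero Mu[of 0 0]] by simp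
  have MW: "\<bar>W (x, t)\<bar> \<le> M" if "0 \<le> t" for x t using W that unfolding approx_flow_def by blast
  obtain W1 W2 where C2W: "\<forall>t\<ge>0. C2_derivs (\<lambda>y. W (y, t)) (W1 t) (W2 t)" and res: "residual_le \<alpha> \<eta> \<delta> E W W2"
    using W by (rule approx_flowE)
  define f where "f y = W (y, sb)" for y
  have f: "C2_derivs f (W1 sb) (W2 sb)" unfolding f_def using C2W pos by simp
  define h where "h = xb - yb"
  define p where "p = 2 * a * h"
  \<comment> \<open>From p^2 = 4 a (a h^2) <= 8 a M; using |p| <= 1 + p^2 avoids square
    roots.\<close>
  have p_bound: "\<bar>p\<bar> \<le> 1 + 8 * a * M"
  proof -
    have "\<bar>p\<bar> \<le> 1 + p\<^sup>2" by (rule abs_le_one_plus_square)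
    also have "p\<^sup>2 = 4 * a * (a * h\<^sup>2)" by (simp add: p_def power2_eq_square)
    also have "\<dots> \<le> 4 * a * (2 * M)" using close pos by (intro mult_left_mono) (auto simp: h_def)
    finally show ?thesis by simp
  qed
  define b where "b x = bump (x - x1)" for x
  \<comment> \<open>F is W translated by h, G is the parabola obtained with y frozen at yb, and both
    carry the penalty. \<open>D\<close> is their minimum without the penalty, moved to the base
    point of W.\<close>
  define F where "F x = f (x + - h) + k * bump (x - x1)" for x
  define G where "G x = f yb + p * (x - xb) + a * (x - xb)\<^sup>2 + k * bump (x - x1)" for x
  define D where "D y = min (f y) (f yb + p * (y - yb) + a * (y - yb)\<^sup>2)" for y
  define A where "A x = min (F x) (G x)" for x
  have A_D: "A x = D (x + - h) + k * b x" for x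
    by (simp add: A_def D_def F_def G_def h_def b_def min_add_distrib_left)
  have xh: "xb + - h = yb" by (simp add: h_def)
  have Db: "D yb = f yb" by (simp add: D_def)
  have u_upper: "u (x, t) \<le> u (xb, tb) + (A x - F xb) + (2 * g * (tb - sb) + \<theta>) * (t - tb) + g * (t - tb)\<^sup>2" if t: "0 \<le> t" for x t
  proof -
    have g: "g * (t - sb)\<^sup>2 = g * (t - tb)\<^sup>2 + 2 * g * (tb - sb) * (t - tb) + g * (tb - sb)\<^sup>2"
      by (simp add: power2_eq_square algebra_simps)
    have 1: "u (x, t) \<le> u (xb, tb) + (F x - F xb) + (2 * g * (tb - sb) + \<theta>) * (t - tb) + g * (t - tb)\<^sup>2"
    proof -
      have "x - (x + - h) = xb - yb" by (simp add: h_def)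
      then have "u (x, t) - W (x + - h, sb) - a * (xb - yb)\<^sup>2 - g * (t - sb)\<^sup>2 - \<theta> * t - k * bump (x - x1)
       \<le> u (xb, tb) - W (yb, sb) - a * (xb - yb)\<^sup>2 - g * (tb - sb)\<^sup>2 - \<theta> * tb - k * bump (xb - x1)"
        using max[of t sb x "x + - h"] t pos by simp
      then show ?thesis unfolding F_def xh f_def g by (simp add: algebra_simps)
    qed
    have 2: "u (x, t) \<le> u (xb, tb) + (G x - F xb) + (2 * g * (tb - sb) + \<theta>) * (t - tb) + g * (t - tb)\<^sup>2"
    proof -
      have "a * (x - yb)\<^sup>2 = a * (x - xb)\<^sup>2 + p * (x - xb) + a * (xb - yb)\<^sup>2"
        by (simp add: p_def h_def power2_eq_square algebra_simps)
      then show ?thesis using max[of t sb x yb] t pos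
        unfolding F_def G_def xh f_def g by (simp add: algebra_simps)
    qed
    show ?thesis using 1 2 unfolding A_def min_def by (simp split: if_split)
  qed
  \<comment> \<open>Moving y alone gives a parabola below W at yb. It bounds \<open>D\<close> from
    below and identifies the slope of W as p.\<close>
  have lower: "f yb + p * z - a * z\<^sup>2 \<le> f (yb + z)" for z
  proof -
    have "a * (xb - (yb + z))\<^sup>2 = a * z\<^sup>2 - p * z + a * (xb - yb)\<^sup>2"
      by (simp add: p_def h_def power2_eq_square algebra_simps)
    then show ?thesis using max[of tb sb xb "yb + z"] pos unfolding f_def by simp
  qed
  have W1p: "W1 sb yb = p"
  proof -
    let ?m = "\<lambda>y. f y - (f yb + p * (y - yb) - a * (y - yb)\<^sup>2)"
    have "(?m has_real_derivative W1 sb yb - p) (at yb)"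
      using f unfolding C2_derivs_def by (auto intro!: derivative_eq_intros)
    moreover have "\<forall>y. \<bar>yb - y\<bar> < 1 \<longrightarrow> ?m yb \<le> ?m y"
    proof (intro allI impI)
      fix y show "?m yb \<le> ?m y" using lower[of "y - yb"] by simp
    qed
    ultimately have "W1 sb yb - p = 0" by (rule DERIV_local_min[OF _ zero_less_one])
    then show ?thesis by simp
  qed
  have b01: "0 \<le> b x" "b x \<le> 1" for x using bump_nonneg bump_le_1 by (simp_all add: b_def)
  have kb: "\<bar>k * (b x - b y)\<bar> \<le> k" for x y
    using b01[of x] b01[of y] pos(2) mult_left_mono[of "\<bar>b x - b y\<bar>" 1 k] by (simp add: abs_mult)
  have fM: "\<bar>f y\<bar> \<le> M" for y unfolding f_def using MW pos by simp
  have qD: "quad_touch D yb p a (2 * M + k)"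
    unfolding quad_touch_def
  proof (intro conjI allI)
    show "D \<in> borel_measurable borel"
      unfolding D_def[abs_def]
      by (intro borel_measurable_continuous_onI continuous_intros C2_derivs_continuous(1)[OF f])
    fix z
    have az: "0 \<le> a * z\<^sup>2" using pos by simp
    show "\<bar>D (yb + z) - D yb - p * z\<bar> \<le> a * z\<^sup>2"
      using lower[of z] az unfolding Db unfolding D_def min_def by (auto simp: abs_le_iff)
    \<comment> \<open>The lower bound for \<open>D\<close> passes through u: up to a constant
      \<open>A\<close> lies above u at time tb, and u varies by at most 2 M.\<close>
    have "A (xb + z) - F xb = D (yb + z) - D yb + k * (b (xb + z) - b xb)"
      unfolding A_D F_def xh Db by (simp add: h_def b_def algebra_simps)
    moreover have "u (xb + z, tb) \<le> u (xb, tb) + (A (xb + z) - F xb)" using u_upper[of tb "xb + z"] pos by simp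
    ultimately have "- (2 * M + k) \<le> D (yb + z) - D yb"
      using Mu[OF less_imp_le[OF pos(5)], of "xb + z"] Mu[OF less_imp_le[OF pos(5)], of xb] kb[of "xb + z" xb]
      by linarith
    moreover have "D (yb + z) \<le> f (yb + z)" by (simp add: D_def)
    ultimately show "\<bar>D (yb + z) - D yb\<bar> \<le> 2 * M + k"
      using fM[of "yb + z"] fM[of yb] pos unfolding Db abs_le_iff by linarith
  qed
  have qb: "quad_touch b xb (bump1 (xb - x1)) 3 1"
    unfolding b_def[abs_def] by (rule quad_touch_bump)
  define q where "q = p + k * bump1 (xb - x1)"
  have kb1: "\<bar>k * bump1 (xb - x1)\<bar> \<le> k" using bump1_bound[of "xb - x1"] pos mult_left_mono[of "\<bar>bump1 (xb - x1)\<bar>" 1 k] by (simp add: abs_mult)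
  have qD': "quad_touch (\<lambda>x. D (x + - h)) xb p a (2 * M + k)"
    using qD unfolding quad_touch_def by (auto simp: h_def algebra_simps)
  have qA: "quad_touch A xb q (a + 3) (2 * M + 2)"
    unfolding quad_touch_def
  proof (intro conjI allI)
    have [measurable]: "D \<in> borel_measurable borel" "b \<in> borel_measurable borel" using quad_touchD(1) qD qb by blast+
    show "A \<in> borel_measurable borel" unfolding A_D[abs_def] by measurable
    fix z
    have e1: "\<bar>D (xb + z + - h) - D (xb + - h) - p * z\<bar> \<le> a * z\<^sup>2" "\<bar>D (xb + z + - h) - D (xb + - h)\<bar> \<le> 2 * M + k"
      by (rule quad_touchD(2,3)[OF qD'])+
    have e2: "\<bar>k * (b (xb + z) - b xb - bump1 (xb - x1) * z)\<bar> \<le> 3 * z\<^sup>2"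
    proof -
      have "\<bar>k * (b (xb + z) - b xb - bump1 (xb - x1) * z)\<bar> \<le> k * (3 * z\<^sup>2)"
        using quad_touchD(2)[OF qb, of z] pos by (simp add: abs_mult mult_left_mono)
      also have "\<dots> \<le> 1 * (3 * z\<^sup>2)" using pos by (intro mult_right_mono) auto
      finally show ?thesis by simp
    qed
    have "A (xb + z) - A xb - q * z = (D (xb + z + - h) - D (xb + - h) - p * z) + k * (b (xb + z) - b xb - bump1 (xb - x1) * z)"
      unfolding A_D q_def by (simp add: algebra_simps)
    then show "\<bar>A (xb + z) - A xb - q * z\<bar> \<le> (a + 3) * z\<^sup>2"
      using order_trans[OF abs_triangle_ineq add_mono[OF e1(1) e2]] by (simp only: distrib_right)
    have "A (xb + z) - A xb = (D (xb + z + - h) - D (xb + - h)) + k * (b (xb + z) - b xb)"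
      unfolding A_D by (simp add: algebra_simps)
    then have "\<bar>A (xb + z) - A xb\<bar> \<le> (2 * M + k) + k"
      using order_trans[OF abs_triangle_ineq add_mono[OF e1(2) kb]] by (simp only:)
    then show "\<bar>A (xb + z) - A xb\<bar> \<le> 2 * M + 2" using pos(3) by linarith
  qed
  have Fd: "C2_derivs F (\<lambda>x. W1 sb (x + - h) + k * bump1 (x - x1)) (\<lambda>x. W2 sb (x + - h) + k * bump2 (x - x1))"
    unfolding F_def[abs_def] by (intro C2_derivs_add C2_derivs_translate[OF f] C2_derivs_bump)
  have Gd: "C2_derivs G (\<lambda>x. (p + 2 * a * (x - xb)) + k * bump1 (x - x1)) (\<lambda>x. 2 * a + k * bump2 (x - x1))"
    unfolding G_def[abs_def]
    by (intro C2_derivs_add C2_derivs_bump) (auto simp: C2_derivs_def intro!: derivative_eq_intros)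
  have Fb: "bounded (range F)"
  proof -
    have "\<bar>F x\<bar> \<le> M + k" for x
      using fM[of "x + - h"] kb[of x x1] b01[of x] by (simp add: F_def b_def[symmetric]) (use kb[of x x1] in \<open>simp add: b_def\<close>)
    then show ?thesis unfolding bounded_iff by auto
  qed
  have Gb: "\<forall>x. f yb - p\<^sup>2 / (4 * a) \<le> G x"
  proof
    fix x
    have "p * (x - xb) + a * (x - xb)\<^sup>2 = a * ((x - xb) + p / (2 * a))\<^sup>2 - p\<^sup>2 / (4 * a)"
      using pos(1) by (simp add: power2_eq_square field_simps)
    moreover have "0 \<le> a * ((x - xb) + p / (2 * a))\<^sup>2" "0 \<le> k * bump (x - x1)" using pos bump_nonneg by simp_all
    ultimately show "f yb - p\<^sup>2 / (4 * a) \<le> G x" unfolding G_def by linarith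
  qed
  have q_bound: "\<bar>q\<bar> \<le> 2 + 8 * a * M" using p_bound kb1 pos unfolding q_def by linarith
  have FG: "F xb = G xb" unfolding F_def G_def xh by simp
  have main: "2 * g * (tb - sb) + \<theta> \<le> \<eta> * (W2 sb yb + k * bump2 (xb - x1)) + \<bar>q\<bar> * levy_op \<alpha> A xb + E"
    using weak_subsolD[OF u pos(5) Fd Gd Fb Gb[rule_format] FG, unfolded xh W1p q_def[symmetric] A_def[symmetric], OF qA q_bound u_upper]
    by simp
  have lA: "levy_op \<alpha> A xb = levy_op \<alpha> D yb + k * levy_op \<alpha> b xb"
    using levy_op_add[OF qD' qb, of k] unfolding levy_op_translate xh A_D[abs_def, symmetric] by simp
  \<comment> \<open>With x, y and t frozen, W is touched from below in s by a parabola with the same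
    slope 2 g (tb - sb) that enters the inequality for u.\<close>
  have flow: "\<eta> * W2 sb yb + nonlin \<alpha> \<delta> f yb - E \<le> 2 * g * (tb - sb)"
    unfolding f_def
  proof (rule residual_lower[OF res pos(6), of "\<lambda>s. - (g * (tb - s)\<^sup>2)"])
    show "((\<lambda>s. - (g * (tb - s)\<^sup>2)) has_real_derivative 2 * g * (tb - sb)) (at sb)"
      by (auto intro!: derivative_eq_intros simp: algebra_simps)
    fix s :: real assume "0 \<le> s"
    then show "- (g * (tb - s)\<^sup>2) - - (g * (tb - sb)\<^sup>2) \<le> W (yb, s) - W (yb, sb)"
      using max[of tb s xb yb] pos by simp
  qed
  have "nonlin \<alpha> \<delta> D yb \<le> nonlin \<alpha> \<delta> f yb"
  proof (rule nonlin_mono[OF \<delta> quad_touchD(1)[OF qD]])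
    show "f \<in> borel_measurable borel" by (rule borel_measurable_continuous_onI[OF C2_derivs_continuous(1)[OF f]])
    show "\<bar>f y\<bar> \<le> M" for y by (rule fM)
    show "\<bar>D y\<bar> \<le> \<bar>D yb\<bar> + (2 * M + k)" for y using quad_touchD(3)[OF qD, of "y - yb"] by simp
    show "D (yb + z) - D yb \<le> f (yb + z) - f yb" for z unfolding Db by (simp add: D_def)
  qed
  moreover have qD2: "quad_touch D yb p (a + 3) (2 * M + 2)" using pos by (intro quad_touch_mono[OF qD]) auto
  then have "\<bar>p\<bar> * levy_op \<alpha> D yb - E \<le> nonlin \<alpha> \<delta> D yb"
    using cons[OF qD2] p_bound by (simp add: abs_le_iff)
  ultimately have flow': "\<eta> * W2 sb yb + \<bar>p\<bar> * levy_op \<alpha> D yb - 2 * E \<le> 2 * g * (tb - sb)" using flow by linarith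
  define LD where "LD = levy_op \<alpha> D yb"
  define Lb where "Lb = levy_op \<alpha> b xb"
  \<comment> \<open>The constants a + 2 M + 5 and 4 are the sums (a + 3) + (2 M + 2) and 3 + 1 from
    the bounds for \<open>D\<close> and \<open>b\<close>.\<close>
  have LD: "\<bar>LD\<bar> \<le> levy_const \<alpha> * (a + 2 * M + 5) * levy_mass \<alpha>"
    using levy_op_bound[OF qD2] unfolding LD_def by (simp add: algebra_simps)
  have Lb: "\<bar>Lb\<bar> \<le> levy_const \<alpha> * 4 * levy_mass \<alpha>" using levy_op_bound[OF qb] unfolding Lb_def by simp
  \<comment> \<open>Here \<open>2 * g * (tb - sb)\<close> and \<open>\<eta> * W2 sb yb\<close>
    cancel. One E comes from u, one from the residual of W and one from consistency.\<close>
  have "\<theta> \<le> \<eta> * (k * bump2 (xb - x1)) + (\<bar>q\<bar> - \<bar>p\<bar>) * LD + \<bar>q\<bar> * (k * Lb) + 3 * E"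
    using main flow' unfolding lA LD_def[symmetric] Lb_def[symmetric] by (simp add: algebra_simps)
  moreover have "\<eta> * (k * bump2 (xb - x1)) \<le> k * (6 * \<eta>)"
  proof -
    have "(\<eta> * k) * bump2 (xb - x1) \<le> (\<eta> * k) * 6"
      using bump2_bound[of "xb - x1"] \<eta> pos by (intro mult_left_mono) auto
    then show ?thesis by (simp add: mult_ac)
  qed
  moreover have "(\<bar>q\<bar> - \<bar>p\<bar>) * LD \<le> k * (levy_const \<alpha> * (a + 2 * M + 5) * levy_mass \<alpha>)"
  proof -
    have "\<bar>\<bar>q\<bar> - \<bar>p\<bar>\<bar> \<le> k" using kb1 unfolding q_def by linarith
    then have "\<bar>(\<bar>q\<bar> - \<bar>p\<bar>) * LD\<bar> \<le> k * (levy_const \<alpha> * (a + 2 * M + 5) * levy_mass \<alpha>)"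
      unfolding abs_mult using LD pos by (intro mult_mono) auto
    then show ?thesis by linarith
  qed
  moreover have "\<bar>q\<bar> * (k * Lb) \<le> k * ((2 + 8 * a * M) * (levy_const \<alpha> * 4 * levy_mass \<alpha>))"
  proof -
    have "\<bar>q\<bar> * \<bar>Lb\<bar> \<le> (2 + 8 * a * M) * (levy_const \<alpha> * 4 * levy_mass \<alpha>)"
      using q_bound Lb pos M0 by (intro mult_mono) auto
    then have "k * (\<bar>q\<bar> * \<bar>Lb\<bar>) \<le> k * ((2 + 8 * a * M) * (levy_const \<alpha> * 4 * levy_mass \<alpha>))"
      using pos by (intro mult_left_mono) auto
    moreover have "\<bar>q\<bar> * (k * Lb) \<le> k * (\<bar>q\<bar> * \<bar>Lb\<bar>)"
    proof -
      have "(k * \<bar>q\<bar>) * Lb \<le> (k * \<bar>q\<bar>) * \<bar>Lb\<bar>" using pos by (intro mult_left_mono) auto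
      then show ?thesis by (simp add: mult_ac)
    qed
    ultimately show ?thesis by linarith
  qed
  ultimately show ?thesis unfolding distrib_left[of k] by linarith
qed


text \<open>All constants precede u, \<delta> and W. The term \<rho> absorbs the error at time 0,
  while \<theta> t makes the inequality strict: a violation would force \<theta> <= 5
  \<theta>/8.\<close>

lemma comparison:
  assumes \<eta>: "0 \<le> \<eta>" and M: "\<And>x. \<bar>u\<^sub>0 x\<bar> \<le> M"
    and uc: "\<And>c. 0 < c \<Longrightarrow> \<exists>d>0. \<forall>h. \<bar>h\<bar> \<le> d \<longrightarrow> (\<forall>x. \<bar>u\<^sub>0 (x + h) - u\<^sub>0 x\<bar> \<le> c)"
    and \<rho>: "0 < \<rho>" and \<theta>: "0 < \<theta>"
  obtains Q R B E \<delta>\<^sub>0 where "0 < E" "0 < \<delta>\<^sub>0"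
    "\<forall>u \<delta> W. weak_subsol \<eta> Q R B E u \<and> continuous_on closed_domain u \<and> (\<forall>x t. 0 \<le> t \<longrightarrow> \<bar>u (x, t)\<bar> \<le> M) \<and>
       (\<forall>x. u (x, 0) \<le> u\<^sub>0 x + E) \<and> 0 < \<delta> \<and> \<delta> \<le> \<delta>\<^sub>0 \<and> approx_flow \<alpha> \<eta> \<delta> M E W \<and> (\<forall>x. \<bar>W (x, 0) - u\<^sub>0 x\<bar> \<le> E) \<longrightarrow>
       (\<forall>x t. 0 \<le> t \<longrightarrow> u (x, t) \<le> W (x, t) + \<rho> + \<theta> * t)"
proof -
  have M0: "0 \<le> M" using order_trans[OF abs_ge_zero M] .
  obtain d where d: "0 < d" "\<And>h x. \<bar>h\<bar> \<le> d \<Longrightarrow> \<bar>u\<^sub>0 (x + h) - u\<^sub>0 x\<bar> \<le> \<rho> / 8" using uc[of "\<rho> / 8"] \<rho> by auto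
  \<comment> \<open>Beyond distance d the penalty exceeds 2 M, hence the oscillation of
    \<open>u\<^sub>0\<close>; closer points are covered by its modulus.\<close>
  define a where "a = 2 * M / d\<^sup>2 + 1"
  have a: "0 < a" using M0 by (simp add: a_def add_nonneg_pos)
  \<comment> \<open>2 E <= \<rho>/8 is the error at time 0, and 3 E <= 3 \<theta>/8 leaves room for
    k Z <= \<theta>/4.\<close>
  define E where "E = min (\<theta> / 8) (\<rho> / 16)"
  have E: "0 < E" "E \<le> \<theta> / 8" "E \<le> \<rho> / 16" using \<rho> \<theta> by (auto simp: E_def)
  obtain \<delta>\<^sub>0 where \<delta>0: "0 < \<delta>\<^sub>0" and cons: "\<forall>\<delta> A x p. 0 < \<delta> \<and> \<delta> \<le> \<delta>\<^sub>0 \<and> quad_touch A x p (a + 3) (2 * M + 2) \<and> \<bar>p\<bar> \<le> 2 + 8 * a * M \<longrightarrow>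
    \<bar>nonlin \<alpha> \<delta> A x - \<bar>p\<bar> * levy_op \<alpha> A x\<bar> \<le> E"
    by (rule nonlin_consistent[OF E(1)])
  define Z where "Z = 6 * \<eta> + levy_const \<alpha> * (a + 2 * M + 5) * levy_mass \<alpha>
           + (2 + 8 * a * M) * (levy_const \<alpha> * 4 * levy_mass \<alpha>)"
  have Z: "0 \<le> Z" using \<eta> a M0 levy_const_pos levy_mass_nonneg by (simp add: Z_def)
  define k where "k = min 1 (min (\<rho> / 2) (\<theta> / (4 * (Z + 1))))"
  have k: "0 < k" "k \<le> 1" "2 * k \<le> \<rho>" "k * Z \<le> \<theta> / 4"
  proof -
    show "0 < k" "k \<le> 1" "2 * k \<le> \<rho>" using \<rho> \<theta> Z by (auto simp: k_def)
    have "k * (Z + 1) \<le> \<theta> / (4 * (Z + 1)) * (Z + 1)" using Z by (intro mult_right_mono) (auto simp: k_def)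
    also have "\<dots> = \<theta> / 4" using Z by (simp add: field_simps)
    finally show "k * Z \<le> \<theta> / 4" using \<open>0 < k\<close> by (simp add: distrib_left)
  qed
  show ?thesis
  proof (rule that[OF E(1) \<delta>0, of "a + 3" "2 + 8 * a * M" "2 * M + 2"], intro allI impI, elim conjE, rule ccontr)
    fix u \<delta> W x' and t' :: real
    assume u: "weak_subsol \<eta> (a + 3) (2 + 8 * a * M) (2 * M + 2) E u" "continuous_on closed_domain u"
      "\<forall>x t. 0 \<le> t \<longrightarrow> \<bar>u (x, t)\<bar> \<le> M" "\<forall>x. u (x, 0) \<le> u\<^sub>0 x + E"
      and \<delta>: "0 < \<delta>" "\<delta> \<le> \<delta>\<^sub>0" and W: "approx_flow \<alpha> \<eta> \<delta> M E W" "\<forall>x. \<bar>W (x, 0) - u\<^sub>0 x\<bar> \<le> E"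
      and t': "0 \<le> t'" and "\<not> u (x', t') \<le> W (x', t') + \<rho> + \<theta> * t'"
    then have big: "\<rho> < u (x', t') - W (x', t') - \<theta> * t'" by linarith
    obtain L where WM: "\<forall>x. \<forall>t\<ge>0. \<bar>W (x, t)\<bar> \<le> M" and Wc: "continuous_on closed_domain W"
      and L: "\<forall>x. \<forall>s\<ge>0. \<forall>t\<ge>0. \<bar>W (x, t) - W (x, s)\<bar> \<le> L * \<bar>t - s\<bar>"
      using W(1) by (rule approx_flowE)
    have init: "u (x, 0) - W (y, 0) - a * (x - y)\<^sup>2 \<le> \<rho> / 2" for x y
    proof -
      have 1: "u (x, 0) - W (y, 0) \<le> u\<^sub>0 x - u\<^sub>0 y + \<rho> / 8"
        using u(4)[rule_format, of x] W(2)[rule_format, of y] E(3) by linarith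
      have 2: "0 \<le> a * (x - y)\<^sup>2" using a by simp
      show ?thesis
      proof (cases "\<bar>x - y\<bar> \<le> d")
        case True
        then have "\<bar>u\<^sub>0 (y + (x - y)) - u\<^sub>0 y\<bar> \<le> \<rho> / 8" by (rule d(2))
        then have "\<bar>u\<^sub>0 x - u\<^sub>0 y\<bar> \<le> \<rho> / 8" by simp
        then show ?thesis using 1 2 \<rho> by linarith
      next
        case False
        then have "d\<^sup>2 \<le> (x - y)\<^sup>2" using d(1) abs_le_square_iff[of d "x - y"] by simp
        then have "a * d\<^sup>2 \<le> a * (x - y)\<^sup>2" using a by (intro mult_left_mono) auto
        moreover have "2 * M \<le> a * d\<^sup>2"
        proof -
          have "2 * M = 2 * M / d\<^sup>2 * d\<^sup>2" using d by simp
          also have "\<dots> \<le> a * d\<^sup>2" by (intro mult_right_mono) (auto simp: a_def)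
          finally show ?thesis .
        qed
        ultimately show ?thesis using 1 M[of x] M[of y] \<rho> by linarith
      qed
    qed
    obtain g x1 xb yb tb sb where max: "0 < g" "0 < tb" "0 < sb" "a * (xb - yb)\<^sup>2 \<le> 2 * M"
    "\<forall>x y t s. 0 \<le> t \<longrightarrow> 0 \<le> s \<longrightarrow>
       u (x, t) - W (y, s) - a * (x - y)\<^sup>2 - g * (t - s)\<^sup>2 - \<theta> * t - k * bump (x - x1)
       \<le> u (xb, tb) - W (yb, sb) - a * (xb - yb)\<^sup>2 - g * (tb - sb)\<^sup>2 - \<theta> * tb - k * bump (xb - x1)"
      using doubling_max_exists[OF u(2) Wc u(3)[rule_format] WM[rule_format] L[rule_format] a \<theta> k(1,3) init t' big] by metis
    have "\<theta> \<le> 3 * E + k * Z"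
      unfolding Z_def
      by (rule doubling_max_inequality[OF \<eta> \<delta>(1) u(3)[rule_format] W(1) u(1) _ a k(1,2) max(1-4) max(5)[rule_format]]) (use cons \<delta> in auto)
    then show False using E k \<theta> by linarith
  qed
qed

end

section \<open>Stability\<close>

lemma quad_touch_add_cmult:
  assumes A: "quad_touch A x p Q M" and B: "quad_touch B x p' Q' M'" and "0 \<le> k"
  shows "quad_touch (\<lambda>y. A y + k * B y) x (p + k * p') (Q + k * Q') (M + k * M')"
  unfolding quad_touch_def
proof (intro conjI allI)
  show "(\<lambda>y. A y + k * B y) \<in> borel_measurable borel"
    using quad_touchD(1)[OF A] quad_touchD(1)[OF B] by measurable
  have k: "\<bar>k * b\<bar> \<le> k * c" if "\<bar>b\<bar> \<le> c" for b c using that \<open>0 \<le> k\<close> by (simp add: abs_mult mult_left_mono)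
  fix z
  have "A (x + z) + k * B (x + z) - (A x + k * B x) - (p + k * p') * z = (A (x + z) - A x - p * z) + k * (B (x + z) - B x - p' * z)"
    by (simp add: algebra_simps)
  then show "\<bar>A (x + z) + k * B (x + z) - (A x + k * B x) - (p + k * p') * z\<bar> \<le> (Q + k * Q') * z\<^sup>2"
    using order_trans[OF abs_triangle_ineq add_mono[OF quad_touchD(2)[OF A] k[OF quad_touchD(2)[OF B]]]]
    by (simp only: distrib_right mult.assoc)
  have "A (x + z) + k * B (x + z) - (A x + k * B x) = (A (x + z) - A x) + k * (B (x + z) - B x)"
    by (simp add: algebra_simps)
  then show "\<bar>A (x + z) + k * B (x + z) - (A x + k * B x)\<bar> \<le> M + k * M'"
    using order_trans[OF abs_triangle_ineq add_mono[OF quad_touchD(3)[OF A] k[OF quad_touchD(3)[OF B]]]]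
    by (simp only:)
qed

lemma C2_on_partials:
  assumes "C2_on open_domain \<phi>"
  obtains p1 p2 q where
    "\<forall>x t. 0 < t \<longrightarrow> ((\<lambda>y. \<phi> (y, t)) has_real_derivative p1 (x, t)) (at x)"
    "\<forall>x t. 0 < t \<longrightarrow> ((\<lambda>y. p1 (y, t)) has_real_derivative p2 (x, t)) (at x)"
    "\<forall>x t. 0 < t \<longrightarrow> ((\<lambda>s. \<phi> (x, s)) has_real_derivative q (x, t)) (at t)"
    "continuous_on open_domain \<phi>" "continuous_on open_domain p1" "continuous_on open_domain p2" "continuous_on open_domain q"
proof -
  obtain f' f'' where f': "\<And>p. p \<in> open_domain \<Longrightarrow> (\<phi> has_derivative blinfun_apply (f' p)) (at p)"
    and f'': "\<And>p. p \<in> open_domain \<Longrightarrow> (f' has_derivative blinfun_apply (f'' p)) (at p)" and c: "continuous_on open_domain f''"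
    using assms unfolding C2_on_def by blast
  have cf': "continuous_on open_domain f'"
    using f'' by (meson has_derivative_at_withinI has_derivative_continuous_on)
  have hx: "((\<lambda>y. (y, t)) has_derivative (\<lambda>h. (h, 0))) (at x)" for x t :: real
    by (auto intro!: derivative_eq_intros)
  have ht: "((\<lambda>s. (x, s)) has_derivative (\<lambda>h. (0, h))) (at t)" for x t :: real
    by (auto intro!: derivative_eq_intros)
  have sc: "blinfun_apply L (h, 0) = blinfun_apply L (1, 0) * h" "blinfun_apply L (0, h) = blinfun_apply L (0, 1) * h"
    for L :: "(real \<times> real) \<Rightarrow>\<^sub>L real" and h
    using blinfun.scaleR_right[of L h "(1, 0)"] blinfun.scaleR_right[of L h "(0, 1)"] by (simp_all add: mult.commute)
  have sc2: "blinfun_apply L (h, 0) = h *\<^sub>R blinfun_apply L (1, 0)"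
    for L :: "(real \<times> real) \<Rightarrow>\<^sub>L (real \<times> real) \<Rightarrow>\<^sub>L real" and h
    using blinfun.scaleR_right[of L h "(1, 0)"] by simp
  have sc_fun: "(\<lambda>h. blinfun_apply L (h, 0)) = (*) (blinfun_apply L (1, 0))" "(\<lambda>h. blinfun_apply L (0, h)) = (*) (blinfun_apply L (0, 1))"
    for L :: "(real \<times> real) \<Rightarrow>\<^sub>L real"
    by (rule ext, rule sc)+
  have sc2_fun: "(\<lambda>h. blinfun_apply (blinfun_apply L (h, 0)) (1, 0)) = (*) (blinfun_apply (blinfun_apply L (1, 0)) (1, 0))"
    for L :: "(real \<times> real) \<Rightarrow>\<^sub>L (real \<times> real) \<Rightarrow>\<^sub>L real"
  proof
    fix h :: real
    show "blinfun_apply (blinfun_apply L (h, 0)) (1, 0) = blinfun_apply (blinfun_apply L (1, 0)) (1, 0) * h"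
      by (subst sc2) (simp only: blinfun.scaleR_left real_scaleR_def mult.commute)
  qed
  show ?thesis
  proof (rule that[of "\<lambda>p. f' p (1, 0)" "\<lambda>p. f'' p (1, 0) (1, 0)" "\<lambda>p. f' p (0, 1)"])
    show "\<forall>x t. 0 < t \<longrightarrow> ((\<lambda>y. \<phi> (y, t)) has_real_derivative f' (x, t) (1, 0)) (at x)"
    proof (intro allI impI)
      fix x t :: real assume "0 < t"
      then have "((\<lambda>y. \<phi> (y, t)) has_derivative (\<lambda>h. f' (x, t) (h, 0))) (at x)"
        using has_derivative_compose[OF hx f'] by (simp add: open_domain_def)
      then show "((\<lambda>y. \<phi> (y, t)) has_real_derivative f' (x, t) (1, 0)) (at x)"
        by (simp only: sc_fun has_field_derivative_def)
    qed
    show "\<forall>x t. 0 < t \<longrightarrow> ((\<lambda>s. \<phi> (x, s)) has_real_derivative f' (x, t) (0, 1)) (at t)"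
    proof (intro allI impI)
      fix x t :: real assume "0 < t"
      then have "((\<lambda>s. \<phi> (x, s)) has_derivative (\<lambda>h. f' (x, t) (0, h))) (at t)"
        using has_derivative_compose[OF ht f'] by (simp add: open_domain_def)
      then show "((\<lambda>s. \<phi> (x, s)) has_real_derivative f' (x, t) (0, 1)) (at t)"
        by (simp only: sc_fun has_field_derivative_def)
    qed
    show "\<forall>x t. 0 < t \<longrightarrow> ((\<lambda>y. f' (y, t) (1, 0)) has_real_derivative f'' (x, t) (1, 0) (1, 0)) (at x)"
    proof (intro allI impI)
      fix x t :: real assume "0 < t"
      then have "((\<lambda>y. f' (y, t)) has_derivative (\<lambda>h. f'' (x, t) (h, 0))) (at x)"
        using has_derivative_compose[OF hx f''] by (simp add: open_domain_def)
      then have "((\<lambda>y. f' (y, t) (1, 0)) has_derivative (\<lambda>h. f'' (x, t) (h, 0) (1, 0))) (at x)"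
        by (rule bounded_linear.has_derivative[OF blinfun.bounded_linear_left])
      then show "((\<lambda>y. f' (y, t) (1, 0)) has_real_derivative f'' (x, t) (1, 0) (1, 0)) (at x)"
        by (simp only: sc2_fun has_field_derivative_def)
    qed
    show "continuous_on open_domain \<phi>"
      using f' by (meson has_derivative_at_withinI has_derivative_continuous_on)
  qed (intro continuous_intros cf' c)+
qed

text \<open>The envelope filter retains p itself, so it is proper at every p in S and both limits
  equal u p.\<close>

lemma continuous_env:
  assumes "continuous_on S u" "p \<in> S"
  shows "upper_env S u p = u p" "lower_env S u p = u p"
proof -
  let ?F = "inf (nhds p) (principal S)"
  have "(u \<longlongrightarrow> u p) ?F"
  proof (rule topological_tendstoI)
    fix U assume "open U" "u p \<in> U"
    then have "\<forall>\<^sub>F q in at p within S. u q \<in> U"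
      using assms unfolding continuous_on_def by (blast dest: topological_tendstoD)
    then show "\<forall>\<^sub>F q in ?F. u q \<in> U"
      unfolding eventually_at_filter eventually_inf_principal
      by (rule eventually_mono) (use \<open>u p \<in> U\<close> in auto)
  qed
  then have lim: "((\<lambda>q. ereal (u q)) \<longlongrightarrow> ereal (u p)) ?F" by (rule tendsto_ereal)
  have nb: "?F \<noteq> bot"
  proof
    assume "?F = bot"
    then have "\<forall>\<^sub>F q in nhds p. q \<notin> S"
      using eventually_inf_principal[of "\<lambda>_. False" "nhds p" S] by simp
    then show False using eventually_nhds_x_imp_x assms(2) by fastforce
  qed
  show "upper_env S u p = u p" "lower_env S u p = u p"
    unfolding upper_env_def lower_env_def
    using lim_imp_Limsup[OF nb lim] lim_imp_Liminf[OF nb lim] by simp_all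
qed

section \<open>Congruence, and reduction of supersolutions to subsolutions\<close>

lemma usc_on_cong:
  assumes "usc_on S u" "\<And>p. p \<in> S \<Longrightarrow> u p = v p"
  shows "usc_on S v"
  unfolding usc_on_def
proof (intro ballI allI impI)
  fix p a assume p: "p \<in> S" "v p < a"
  then have "\<forall>\<^sub>F q in at p within S. u q < a" using assms unfolding usc_on_def by auto
  then show "\<forall>\<^sub>F q in at p within S. v q < a"
    unfolding eventually_at_filter by (rule eventually_mono) (use assms(2) in auto)
qed

text \<open>The condition \<open>\<tau> < t\<^sub>0\<close> keeps the whole time window in positive
  times, where u and v agree.\<close>

lemma visc_subsolution_cong:
  assumes u: "visc_subsolution \<alpha> \<eta> u" and eq: "\<And>p. p \<in> closed_domain \<Longrightarrow> u p = v p"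
  shows "visc_subsolution \<alpha> \<eta> v"
  unfolding visc_subsolution_def
proof (intro conjI allI impI, goal_cases)
  case 1
  have "v ` closed_domain = u ` closed_domain" using eq by auto
  then show ?case using u by (simp add: visc_subsolution_def)
next
  case 2
  have "usc_on closed_domain u" using u by (simp add: visc_subsolution_def)
  then show ?case by (rule usc_on_cong) (rule eq)
next
  case (3 x\<^sub>0 t\<^sub>0 \<tau> \<phi>)
  have "u (x, t) = v (x, t)" if "0 \<le> t" for x t using eq that by (simp add: closed_domain_def)
  then have "\<forall>x. \<forall>t\<in>{t\<^sub>0 - \<tau><..<t\<^sub>0 + \<tau>}. u (x, t) - \<phi> (x, t) \<le> u (x\<^sub>0, t\<^sub>0) - \<phi> (x\<^sub>0, t\<^sub>0)" using 3 by auto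
  then show ?case using u 3 unfolding visc_subsolution_def by blast
qed

lemma blinfun_apply_uminus: "blinfun_apply (- L) = (\<lambda>h. - blinfun_apply L h)"
  by (rule ext) (rule blinfun.minus_left)

lemma C2_on_uminus:
  assumes "C2_on S f" shows "C2_on S (\<lambda>p. - f p)"
proof -
  obtain f' f'' where f: "\<forall>p\<in>S. (f has_derivative blinfun_apply (f' p)) (at p)"
    "\<forall>p\<in>S. (f' has_derivative blinfun_apply (f'' p)) (at p)" "continuous_on S f''"
    using assms unfolding C2_on_def by blast
  have "\<forall>p\<in>S. ((\<lambda>p. - f p) has_derivative blinfun_apply (- f' p)) (at p)"
    "\<forall>p\<in>S. ((\<lambda>p. - f' p) has_derivative blinfun_apply (- f'' p)) (at p)"
    unfolding blinfun_apply_uminus using f(1,2) has_derivative_minus by blast+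
  then show ?thesis
    unfolding C2_on_def using continuous_on_minus[OF f(3)]
    by (intro exI[of _ "\<lambda>p. - f' p"] exI[of _ "\<lambda>p. - f'' p"] conjI)
qed

lemma visc_op_uminus:
  assumes "C2_on open_domain \<phi>" "0 < t"
  shows "visc_op \<alpha> \<eta> (\<lambda>p. - \<phi> p) x t = - visc_op \<alpha> \<eta> \<phi> x t"
proof -
  obtain p1 p2 q where p: "\<forall>x t. 0 < t \<longrightarrow> ((\<lambda>y. \<phi> (y, t)) has_real_derivative p1 (x, t)) (at x)"
    "\<forall>x t. 0 < t \<longrightarrow> ((\<lambda>y. p1 (y, t)) has_real_derivative p2 (x, t)) (at x)"
    "\<forall>x t. 0 < t \<longrightarrow> ((\<lambda>s. \<phi> (x, s)) has_real_derivative q (x, t)) (at t)"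
    by (rule C2_on_partials[OF assms(1)])
  have 1: "deriv (\<lambda>y. \<phi> (y, t)) = (\<lambda>y. p1 (y, t))" "deriv (\<lambda>y. - \<phi> (y, t)) = (\<lambda>y. - p1 (y, t))"
    using p(1) assms(2) by (auto intro!: DERIV_imp_deriv DERIV_minus)
  have 2: "deriv (\<lambda>y. p1 (y, t)) x = p2 (x, t)" "deriv (\<lambda>y. - p1 (y, t)) x = - p2 (x, t)"
    using p(2) assms(2) by (auto intro!: DERIV_imp_deriv DERIV_minus)
  have 3: "deriv (\<lambda>s. \<phi> (x, s)) t = q (x, t)" "deriv (\<lambda>s. - \<phi> (x, s)) t = - q (x, t)"
    using p(3) assms(2) by (auto intro!: DERIV_imp_deriv DERIV_minus)
  have "(- a - - b - z * - c * i) / w = - ((a - b - z * c * i) / w)" for a b c z i w :: real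
    by (simp only: minus_divide_left) simp
  then have "levy_integral \<alpha> (\<lambda>y. - \<phi> (y, t)) x = - levy_integral \<alpha> (\<lambda>y. \<phi> (y, t)) x"
    unfolding levy_integral_def 1 by simp
  then show ?thesis by (simp add: visc_op_def frac_lap_def 1 2 3 algebra_simps)
qed

lemma test_function_uminus:
  assumes "test_function \<phi>" shows "test_function (\<lambda>p. - \<phi> p)"
proof -
  have "(\<lambda>p. - \<phi> p) ` open_domain = uminus ` (\<phi> ` open_domain)" by (simp add: image_image)
  then show ?thesis using assms C2_on_uminus[of open_domain \<phi>] by (simp add: test_function_def bounded_uminus)
qed

text \<open>Negating u together with the test function exchanges minima with maxima and changes the
  sign of \<open>visc_op\<close>.\<close>

lemma visc_supersolution_iff: "visc_supersolution \<alpha> \<eta> u \<longleftrightarrow> visc_subsolution \<alpha> \<eta> (\<lambda>p. - u p)"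
proof -
  have "(\<lambda>p. - u p) ` closed_domain = uminus ` (u ` closed_domain)" by (simp add: image_image)
  then have 1: "bounded ((\<lambda>p. - u p) ` closed_domain) = bounded (u ` closed_domain)" by (simp add: bounded_uminus)
  have 2: "usc_on closed_domain (\<lambda>p. - u p) = lsc_on closed_domain u"
    unfolding usc_on_def lsc_on_def
  proof (intro ball_cong refl iffI allI impI)
    fix p a assume *: "\<forall>a>- u p. \<forall>\<^sub>F q in at p within closed_domain. - u q < a" "a < u p"
    have "\<forall>\<^sub>F q in at p within closed_domain. - u q < - a" by (rule *(1)[rule_format]) (use *(2) in simp)
    then show "\<forall>\<^sub>F q in at p within closed_domain. a < u q" by simp
  next
    fix p a assume *: "\<forall>a<u p. \<forall>\<^sub>F q in at p within closed_domain. a < u q" "- u p < a"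
    have "\<forall>\<^sub>F q in at p within closed_domain. - a < u q" by (rule *(1)[rule_format]) (use *(2) in simp)
    then show "\<forall>\<^sub>F q in at p within closed_domain. - u q < a" by (rule eventually_mono) simp
  qed
  have 3: "visc_op \<alpha> \<eta> (\<lambda>p. - \<phi> p) x t = - visc_op \<alpha> \<eta> \<phi> x t" if "test_function \<phi>" "0 < \<tau>" "\<tau> < t" for \<phi> x t \<tau>
    using that visc_op_uminus[of \<phi> t] by (simp add: test_function_def)
  have 4: "- a - b \<le> - c - d \<longleftrightarrow> c - - d \<le> a - - b" "a - - b \<le> c - - d \<longleftrightarrow> - c - d \<le> - a - b" for a b c d :: real
    by auto
  show ?thesis
    unfolding visc_supersolution_def visc_subsolution_def 1 2
  proof (intro conj_cong refl iffI allI impI; elim conjE)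
    fix x\<^sub>0 t\<^sub>0 \<tau> \<phi>
    assume H: "\<forall>x\<^sub>0 t\<^sub>0 \<tau> \<phi>. 0 < \<tau> \<and> \<tau> < t\<^sub>0 \<and> test_function \<phi> \<and>
        (\<forall>x. \<forall>t\<in>{t\<^sub>0 - \<tau><..<t\<^sub>0 + \<tau>}. u (x\<^sub>0, t\<^sub>0) - \<phi> (x\<^sub>0, t\<^sub>0) \<le> u (x, t) - \<phi> (x, t)) \<longrightarrow> 0 \<le> visc_op \<alpha> \<eta> \<phi> x\<^sub>0 t\<^sub>0"
      and a: "0 < \<tau>" "\<tau> < t\<^sub>0" "test_function \<phi>"
        "\<forall>x. \<forall>t\<in>{t\<^sub>0 - \<tau><..<t\<^sub>0 + \<tau>}. - u (x, t) - \<phi> (x, t) \<le> - u (x\<^sub>0, t\<^sub>0) - \<phi> (x\<^sub>0, t\<^sub>0)"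
    show "visc_op \<alpha> \<eta> \<phi> x\<^sub>0 t\<^sub>0 \<le> 0"
      using H[rule_format, of \<tau> t\<^sub>0 "\<lambda>p. - \<phi> p" x\<^sub>0] a(1,2) test_function_uminus[OF a(3)] a(4)[unfolded 4(1)]
      by (simp add: 3[OF a(3,1,2)])
  next
    fix x\<^sub>0 t\<^sub>0 \<tau> \<phi>
    assume H: "\<forall>x\<^sub>0 t\<^sub>0 \<tau> \<phi>. 0 < \<tau> \<and> \<tau> < t\<^sub>0 \<and> test_function \<phi> \<and>
        (\<forall>x. \<forall>t\<in>{t\<^sub>0 - \<tau><..<t\<^sub>0 + \<tau>}. - u (x, t) - \<phi> (x, t) \<le> - u (x\<^sub>0, t\<^sub>0) - \<phi> (x\<^sub>0, t\<^sub>0)) \<longrightarrow> visc_op \<alpha> \<eta> \<phi> x\<^sub>0 t\<^sub>0 \<le> 0"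
      and a: "0 < \<tau>" "\<tau> < t\<^sub>0" "test_function \<phi>"
        "\<forall>x. \<forall>t\<in>{t\<^sub>0 - \<tau><..<t\<^sub>0 + \<tau>}. u (x\<^sub>0, t\<^sub>0) - \<phi> (x\<^sub>0, t\<^sub>0) \<le> u (x, t) - \<phi> (x, t)"
    have "\<forall>x. \<forall>t\<in>{t\<^sub>0 - \<tau><..<t\<^sub>0 + \<tau>}. - u (x, t) - - \<phi> (x, t) \<le> - u (x\<^sub>0, t\<^sub>0) - - \<phi> (x\<^sub>0, t\<^sub>0)"
      using a(4) by (simp add: algebra_simps)
    then show "0 \<le> visc_op \<alpha> \<eta> \<phi> x\<^sub>0 t\<^sub>0"
      using H[rule_format, of \<tau> t\<^sub>0 "\<lambda>p. - \<phi> p" x\<^sub>0] a(1,2) test_function_uminus[OF a(3)]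
      by (simp add: 3[OF a(3,1,2)])
  qed
qed

section \<open>Limits of approximate flows\<close>

context levy_exponent begin

text \<open>The given maximum need not be strict, and space is unbounded. Adding k times a bump in
  space and in time makes it strict and confines near-maximisers, so the maximum points of the
  perturbed problems converge to the contact point. Here k stays fixed; it is removed
  afterwards.\<close>

lemma approx_flow_limit_inequality:
  assumes \<eta>: "0 \<le> \<eta>" and W: "\<And>n. approx_flow \<alpha> \<eta> (\<delta> n) M (e n) (W n)"
    and \<delta>: "\<And>n. 0 < \<delta> n" "\<delta> \<longlonglongrightarrow> 0" and e: "e \<longlonglongrightarrow> 0"
    and lim: "\<And>\<rho>. 0 < \<rho> \<Longrightarrow> \<exists>N. \<forall>n\<ge>N. \<forall>x t. 0 \<le> t \<longrightarrow> \<bar>W n (x, t) - u (x, t)\<bar> \<le> \<rho> * (1 + t)"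
    and p: "\<forall>x t. 0 < t \<longrightarrow> ((\<lambda>y. \<phi> (y, t)) has_real_derivative p1 (x, t)) (at x)"
      "\<forall>x t. 0 < t \<longrightarrow> ((\<lambda>y. p1 (y, t)) has_real_derivative p2 (x, t)) (at x)"
      "\<forall>x t. 0 < t \<longrightarrow> ((\<lambda>s. \<phi> (x, s)) has_real_derivative q (x, t)) (at t)"
    and c: "continuous_on open_domain \<phi>" "continuous_on open_domain p1" "continuous_on open_domain p2" "continuous_on open_domain q"
    and B: "\<And>x t. 0 < t \<Longrightarrow> \<bar>\<phi> (x, t)\<bar> \<le> B"
    and \<tau>: "0 < \<tau>" "\<tau> < t\<^sub>0"
    and max: "\<forall>x. \<forall>t\<in>{t\<^sub>0 - \<tau><..<t\<^sub>0 + \<tau>}. u (x, t) - \<phi> (x, t) \<le> u (x\<^sub>0, t\<^sub>0) - \<phi> (x\<^sub>0, t\<^sub>0)"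
    and k: "0 < k" "k \<le> 1"
  shows "q (x\<^sub>0, t\<^sub>0) \<le> \<eta> * (p2 (x\<^sub>0, t\<^sub>0) + k * 2)
     + \<bar>p1 (x\<^sub>0, t\<^sub>0)\<bar> * (levy_op \<alpha> (\<lambda>y. \<phi> (y, t\<^sub>0)) x\<^sub>0 + k * levy_op \<alpha> (\<lambda>x. bump (x - x\<^sub>0)) x\<^sub>0) + k"
proof -
  \<comment> \<open>Half of \<tau> keeps the closed window inside the given one; at most 1 makes the
    quadratic lower bound on \<open>bump\<close> available.\<close>
  define r where "r = min (\<tau> / 2) 1"
  have r: "0 < r" "r < \<tau>" "r \<le> 1" "r < t\<^sub>0" using \<tau> by (auto simp: r_def)
  define K where "K = {x\<^sub>0 - 1..x\<^sub>0 + 1} \<times> {t\<^sub>0 - r..t\<^sub>0 + r}"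
  have K: "compact K" "(x\<^sub>0, t\<^sub>0) \<in> K" "K \<subseteq> open_domain" "K \<subseteq> closed_domain"
    using r unfolding K_def open_domain_def closed_domain_def by (auto intro: compact_Times)
  define \<psi> where "\<psi> x t = \<phi> (x, t) + k * bump (x - x\<^sub>0) + k * bump (t - t\<^sub>0)" for x t
  have "\<exists>P\<in>K. \<forall>P'\<in>K. W n P' - \<psi> (fst P') (snd P') \<le> W n P - \<psi> (fst P) (snd P)" for n
  proof (rule continuous_attains_sup[OF K(1)])
    show "K \<noteq> {}" using K by auto
    have "continuous_on closed_domain (W n)" using W[of n] by (rule approx_flowE)
    then have "continuous_on K (W n)" using K(4) by (rule continuous_on_subset)
    moreover have "continuous_on K \<phi>" using c(1) K(3) by (rule continuous_on_subset)
    moreover have "continuous_on K (\<lambda>P. bump (fst P - x\<^sub>0))" "continuous_on K (\<lambda>P. bump (snd P - t\<^sub>0))"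
      by (rule continuous_on_compose2[OF bump_continuous(1)[of UNIV]]; auto intro!: continuous_intros)+
    ultimately show "continuous_on K (\<lambda>P. W n P - \<psi> (fst P) (snd P))"
      unfolding \<psi>_def prod.collapse by (intro continuous_intros)
  qed
  then obtain P where P: "\<And>n. P n \<in> K" "\<And>n P'. P' \<in> K \<Longrightarrow> W n P' - \<psi> (fst P') (snd P') \<le> W n (P n) - \<psi> (fst (P n)) (snd (P n))"
    by metis
  define X where "X n = fst (P n)" for n
  define T where "T n = snd (P n)" for n
  have PXT: "P n = (X n, T n)" for n by (simp add: X_def T_def)
  have XT: "\<bar>X n - x\<^sub>0\<bar> \<le> 1" "\<bar>T n - t\<^sub>0\<bar> \<le> r" "0 < T n" for n
    using P(1)[of n] r unfolding PXT K_def by auto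
  have Pmax: "W n (x, t) - \<psi> x t \<le> W n (X n, T n) - \<psi> (X n) (T n)" if "(x, t) \<in> K" for n x t
    using P(2)[OF that, of n] by (simp add: PXT)
  have close: "\<forall>\<^sub>F n in sequentially. \<forall>x t. 0 \<le> t \<and> t \<le> t\<^sub>0 + 1 \<longrightarrow> \<bar>W n (x, t) - u (x, t)\<bar> \<le> e'" if "0 < e'" for e'
  proof -
    have t2: "0 < 2 + t\<^sub>0" using \<tau> by linarith
    with that have "0 < e' / (2 + t\<^sub>0)" by simp
    from lim[OF this] obtain N where N: "\<forall>n\<ge>N. \<forall>x t. 0 \<le> t \<longrightarrow> \<bar>W n (x, t) - u (x, t)\<bar> \<le> e' / (2 + t\<^sub>0) * (1 + t)"
      by blast
    show ?thesis
      unfolding eventually_sequentially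
    proof (intro exI[of _ N] allI impI)
      fix n x t assume n: "N \<le> n" and t: "0 \<le> t \<and> t \<le> t\<^sub>0 + 1"
      have "\<bar>W n (x, t) - u (x, t)\<bar> \<le> e' / (2 + t\<^sub>0) * (1 + t)" using N n t by blast
      also have "\<dots> \<le> e' / (2 + t\<^sub>0) * (2 + t\<^sub>0)" using t t2 that by (intro mult_left_mono) auto
      finally show "\<bar>W n (x, t) - u (x, t)\<bar> \<le> e'" using t2 by simp
    qed
  qed
  have kb: "0 \<le> k * bump z" for z using k bump_nonneg by simp
  define m where "m = u (x\<^sub>0, t\<^sub>0) - \<phi> (x\<^sub>0, t\<^sub>0)"
  have um: "u (x, t) - \<phi> (x, t) \<le> m" if "\<bar>t - t\<^sub>0\<bar> \<le> r" for x t
    using max that r unfolding m_def by (auto simp: abs_le_iff)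
  have ubound: "W n (x, t) - \<psi> x t \<le> m + e' - k * bump (x - x\<^sub>0) - k * bump (t - t\<^sub>0)"
    if "\<forall>x t. 0 \<le> t \<and> t \<le> t\<^sub>0 + 1 \<longrightarrow> \<bar>W n (x, t) - u (x, t)\<bar> \<le> e'" "\<bar>t - t\<^sub>0\<bar> \<le> r" for n x t e'
  proof -
    have "0 \<le> t" "t \<le> t\<^sub>0 + 1" using that(2) r by (auto simp: abs_le_iff)
    then have "\<bar>W n (x, t) - u (x, t)\<bar> \<le> e'" using that(1) by blast
    then show ?thesis using um[OF that(2), of x] unfolding \<psi>_def by linarith
  qed
  have lbound: "m - e' \<le> W n (X n, T n) - \<psi> (X n) (T n)"
    if "\<forall>x t. 0 \<le> t \<and> t \<le> t\<^sub>0 + 1 \<longrightarrow> \<bar>W n (x, t) - u (x, t)\<bar> \<le> e'" for n e'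
  proof -
    have "\<bar>W n (x\<^sub>0, t\<^sub>0) - u (x\<^sub>0, t\<^sub>0)\<bar> \<le> e'" using that \<tau> by simp
    then have "m - e' \<le> W n (x\<^sub>0, t\<^sub>0) - \<psi> x\<^sub>0 t\<^sub>0" unfolding m_def \<psi>_def by simp
    then show ?thesis using Pmax[OF K(2), of n] by linarith
  qed
  \<comment> \<open>Comparison with the contact point bounds the two bumps at (X n, T n) by 2 e'/k
    together, and near 0 each bump is at least half a square.\<close>
  have sq: "\<forall>\<^sub>F n in sequentially. (X n - x\<^sub>0)\<^sup>2 + (T n - t\<^sub>0)\<^sup>2 < r'\<^sup>2" if "0 < r'" for r'
  proof -
    have "0 < k * r'\<^sup>2 / 8" using k that by simp
    from close[OF this] show ?thesis
    proof eventually_elim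
      case (elim n)
      have "k * bump (X n - x\<^sub>0) + k * bump (T n - t\<^sub>0) \<le> 2 * (k * r'\<^sup>2 / 8)"
        using ubound[OF elim XT(2)[of n], of "X n"] lbound[OF elim] by linarith
      moreover have "k * ((X n - x\<^sub>0)\<^sup>2 / 2) \<le> k * bump (X n - x\<^sub>0)" "k * ((T n - t\<^sub>0)\<^sup>2 / 2) \<le> k * bump (T n - t\<^sub>0)"
        using k XT(1,2)[of n] r by (intro mult_left_mono bump_ge_quadratic; simp)+
      ultimately have "k * ((X n - x\<^sub>0)\<^sup>2 + (T n - t\<^sub>0)\<^sup>2) \<le> k * (r'\<^sup>2 / 2)"
        unfolding distrib_left by simp
      then have "(X n - x\<^sub>0)\<^sup>2 + (T n - t\<^sub>0)\<^sup>2 \<le> r'\<^sup>2 / 2" using k by (simp add: mult_le_cancel_left_pos)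
      also have "\<dots> < r'\<^sup>2" using that by simp
      finally show ?case .
    qed
  qed
  have Xlim: "X \<longlonglongrightarrow> x\<^sub>0" and Tlim: "T \<longlonglongrightarrow> t\<^sub>0"
  proof -
    have *: "dist a b < r'" if "(a - b)\<^sup>2 < r'\<^sup>2" "0 < r'" for a b r' :: real
      unfolding dist_real_def using that power2_less_imp_less[of "\<bar>a - b\<bar>" r'] by simp
    show "X \<longlonglongrightarrow> x\<^sub>0"
    proof (rule tendstoI)
      fix r' :: real assume "0 < r'"
      from sq[OF this] show "\<forall>\<^sub>F n in sequentially. dist (X n) x\<^sub>0 < r'"
      proof eventually_elim
        case (elim n)
        have "0 \<le> (T n - t\<^sub>0)\<^sup>2" by simp
        then have "(X n - x\<^sub>0)\<^sup>2 < r'\<^sup>2" using elim by linarith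
        then show ?case by (rule *[OF _ \<open>0 < r'\<close>])
      qed
    qed
    show "T \<longlonglongrightarrow> t\<^sub>0"
    proof (rule tendstoI)
      fix r' :: real assume "0 < r'"
      from sq[OF this] show "\<forall>\<^sub>F n in sequentially. dist (T n) t\<^sub>0 < r'"
      proof eventually_elim
        case (elim n)
        have "0 \<le> (X n - x\<^sub>0)\<^sup>2" by simp
        then have "(T n - t\<^sub>0)\<^sup>2 < r'\<^sup>2" using elim by linarith
        then show ?case by (rule *[OF _ \<open>0 < r'\<close>])
      qed
    qed
  qed
  have Plim: "P \<longlonglongrightarrow> (x\<^sub>0, t\<^sub>0)" unfolding PXT[abs_def] by (rule tendsto_Pair[OF Xlim Tlim])
  have Pod: "P n \<in> open_domain" for n using XT(3) by (simp add: PXT open_domain_def)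
  have p0: "(x\<^sub>0, t\<^sub>0) \<in> open_domain" using \<tau> by (simp add: open_domain_def)
  have limc: "(\<lambda>n. f (P n)) \<longlonglongrightarrow> f (x\<^sub>0, t\<^sub>0)" if "continuous_on open_domain f" for f :: "real \<times> real \<Rightarrow> real"
    using continuous_on_tendsto_compose[OF that Plim p0] Pod by simp
  have limb: "(\<lambda>n. f (Y n - y)) \<longlonglongrightarrow> f 0" if "continuous_on UNIV f" "Y \<longlonglongrightarrow> y" for f :: "real \<Rightarrow> real" and Y y
  proof -
    have "(\<lambda>n. Y n - y) \<longlonglongrightarrow> y - y" by (intro tendsto_intros that)
    then show ?thesis using continuous_on_tendsto_compose[OF that(1), of "\<lambda>n. Y n - y" 0] by simp
  qed
  have C2phi: "C2_derivs (\<lambda>y. \<phi> (y, t)) (\<lambda>y. p1 (y, t)) (\<lambda>y. p2 (y, t))" if "0 < t" for t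
    unfolding C2_derivs_def
  proof (intro conjI)
    show "continuous_on UNIV (\<lambda>y. p2 (y, t))"
      by (rule continuous_on_compose2[OF c(3)]) (use that in \<open>auto intro!: continuous_intros simp: open_domain_def\<close>)
  qed (use p(1,2) that in auto)
  \<comment> \<open>One unit wider in space than \<open>K\<close>, since the parabola bound at X n
    uses derivatives within distance 1.\<close>
  define K2 where "K2 = {x\<^sub>0 - 2..x\<^sub>0 + 2} \<times> {t\<^sub>0 - r..t\<^sub>0 + r}"
  have K2: "compact K2" "K2 \<subseteq> open_domain" using r unfolding K2_def open_domain_def by (auto intro: compact_Times)
  have bnd: "\<exists>C. \<forall>P\<in>K2. \<bar>f P\<bar> \<le> C" if "continuous_on open_domain f" for f :: "real \<times> real \<Rightarrow> real"
  proof -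
    have "bounded (f ` K2)"
      using that K2 by (intro compact_imp_bounded compact_continuous_image) (auto intro: continuous_on_subset)
    then show ?thesis unfolding bounded_iff by auto
  qed
  obtain C1 where C1: "\<forall>P\<in>K2. \<bar>p1 P\<bar> \<le> C1" using bnd[OF c(2)] by blast
  obtain C2 where C2: "\<forall>P\<in>K2. \<bar>p2 P\<bar> \<le> C2" using bnd[OF c(3)] by blast
  define A where "A n y = \<phi> (y, T n) + k * bump (y - x\<^sub>0)" for n y
  define Q where "Q = (C2 / 2 + 2 * B + C1) + k * 3"
  define M' where "M' = 2 * B + k * 1"
  define pn where "pn n = p1 (P n) + k * bump1 (X n - x\<^sub>0)" for n
  have inK2: "(y, T n) \<in> K2" if "\<bar>y - X n\<bar> \<le> 1" for y n
    using that XT[of n] unfolding K2_def by (auto simp: abs_le_iff)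
  have C1X: "\<bar>p1 (X n, T n)\<bar> \<le> C1" for n using C1 inK2[of "X n" n] by simp
  have quadphi: "quad_touch (\<lambda>y. \<phi> (y, T n)) (X n) (p1 (X n, T n)) (C2 / 2 + 2 * B + C1) (2 * B)" for n
    using C2phi[OF XT(3)[of n]] XT(3)[of n] B C1X C2 inK2[of _ n]
    by (intro C2_derivs_quad_touch_bound[where ?f1.0 = "\<lambda>y. p1 (y, T n)" and ?f2.0 = "\<lambda>y. p2 (y, T n)"]) auto
  have qA: "quad_touch (A n) (X n) (pn n) Q M'" for n
    unfolding A_def[abs_def] pn_def Q_def M'_def PXT
    by (rule quad_touch_add_cmult[OF quadphi quad_touch_bump]) (use k in simp)
  have pnR: "\<bar>pn n\<bar> \<le> C1 + k" for n
  proof -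
    have "\<bar>k * bump1 (X n - x\<^sub>0)\<bar> \<le> k"
      using k bump1_bound[of "X n - x\<^sub>0"] mult_left_mono[of "\<bar>bump1 (X n - x\<^sub>0)\<bar>" 1 k] by (simp add: abs_mult)
    then show ?thesis using C1X[of n] unfolding pn_def PXT by linarith
  qed
  \<comment> \<open>One half of k is for the consistency error, the other for the residual e
    n.\<close>
  have k2: "0 < k / 2" using k by simp
  obtain \<delta>\<^sub>0 where \<delta>0: "0 < \<delta>\<^sub>0" and cons: "\<forall>\<delta> A x p. 0 < \<delta> \<and> \<delta> \<le> \<delta>\<^sub>0 \<and> quad_touch A x p Q M' \<and> \<bar>p\<bar> \<le> C1 + k \<longrightarrow>
    \<bar>nonlin \<alpha> \<delta> A x - \<bar>p\<bar> * levy_op \<alpha> A x\<bar> \<le> k / 2"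
    by (rule nonlin_consistent[OF k2])
  have ineq: "\<forall>\<^sub>F n in sequentially. q (P n) + k * bump1 (T n - t\<^sub>0) \<le>
      \<eta> * (p2 (P n) + k * bump2 (X n - x\<^sub>0)) + \<bar>pn n\<bar> * levy_op \<alpha> (A n) (X n) + k"
  proof -
    have k8: "0 < k / 8" using k by simp
    have "\<forall>\<^sub>F n in sequentially. \<delta> n < \<delta>\<^sub>0" "\<forall>\<^sub>F n in sequentially. e n < k / 2"
      by (rule order_tendstoD(2)[OF \<delta>(2) \<delta>0], rule order_tendstoD(2)[OF e k2])
    moreover have "\<forall>\<^sub>F n in sequentially. t\<^sub>0 - r < T n" using Tlim r by (intro order_tendstoD) auto
    ultimately show ?thesis using close[OF k8]
    proof eventually_elim
      case (elim n)
      \<comment> \<open>The maximum was taken over a box. Outside it the space bump costs k/2, more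
        than the 2 (k/8) lost by uniform closeness, so it is a maximum over all x.\<close>
      have gmax: "W n (x, t) - \<psi> x t \<le> W n (X n, T n) - \<psi> (X n) (T n)" if t: "\<bar>t - t\<^sub>0\<bar> \<le> r" for x t
      proof (cases "\<bar>x - x\<^sub>0\<bar> \<le> 1")
        case True
        then show ?thesis using t by (intro Pmax) (auto simp: K_def abs_le_iff)
      next
        case False
        then have "k * (1 / 2) \<le> k * bump (x - x\<^sub>0)" using k by (intro mult_left_mono bump_ge_half) auto
        then show ?thesis using ubound[OF elim(4) t, of x] lbound[OF elim(4)] kb[of "t - t\<^sub>0"] k by linarith
      qed
      obtain W1 W2 where C2W: "\<forall>t\<ge>0. C2_derivs (\<lambda>y. W n (y, t)) (W1 t) (W2 t)"
        and res: "residual_le \<alpha> \<eta> (\<delta> n) (e n) (W n) W2"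
        using W[of n] by (rule approx_flowE)
      have fC2: "C2_derivs (\<lambda>y. W n (y, T n)) (W1 (T n)) (W2 (T n))" using C2W XT(3)[of n] by simp
      have 1: "q (P n) + k * bump1 (T n - t\<^sub>0) \<le> \<eta> * W2 (T n) (X n) + nonlin \<alpha> (\<delta> n) (\<lambda>y. W n (y, T n)) (X n) + e n"
      proof (rule residual_upper[OF res XT(3)[of n], of "T n - (t\<^sub>0 - r)" "\<lambda>s. \<phi> (X n, s) + k * bump (s - t\<^sub>0)"])
        show "0 < T n - (t\<^sub>0 - r)" "T n - (t\<^sub>0 - r) \<le> T n" using elim(3) r by simp_all
        have "((\<lambda>s. k * bump (s - t\<^sub>0)) has_real_derivative k * bump1 (T n - t\<^sub>0)) (at (T n))"
          using C2_derivs_bump[of k t\<^sub>0] by (simp add: C2_derivs_def)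
        then show "((\<lambda>s. \<phi> (X n, s) + k * bump (s - t\<^sub>0)) has_real_derivative q (P n) + k * bump1 (T n - t\<^sub>0)) (at (T n))"
          using p(3) XT(3)[of n] unfolding PXT by (intro DERIV_add) auto
        fix s assume "T n - (T n - (t\<^sub>0 - r)) < s" "s < T n"
        then have "\<bar>s - t\<^sub>0\<bar> \<le> r" using XT(2)[of n] by (simp add: abs_le_iff)
        from gmax[OF this, of "X n"]
        show "W n (X n, s) - W n (X n, T n) \<le> \<phi> (X n, s) + k * bump (s - t\<^sub>0) - (\<phi> (X n, T n) + k * bump (T n - t\<^sub>0))"
          unfolding \<psi>_def by linarith
      qed
      have xmax: "W n (y, T n) - A n y \<le> W n (X n, T n) - A n (X n)" for y
        using gmax[OF XT(2)[of n], of y] unfolding \<psi>_def A_def by linarith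
      have 2: "W2 (T n) (X n) - (p2 (P n) + k * bump2 (X n - x\<^sub>0)) \<le> 0"
      proof (rule second_deriv_nonpos_at_max(2)[where f = "\<lambda>y. W n (y, T n) - A n y" and r = 1])
        have bd: "((\<lambda>y. k * bump (y - x\<^sub>0)) has_real_derivative k * bump1 (y - x\<^sub>0)) (at y)"
          "((\<lambda>y. k * bump1 (y - x\<^sub>0)) has_real_derivative k * bump2 (y - x\<^sub>0)) (at y)" for y
          using C2_derivs_bump[of k x\<^sub>0] by (simp_all add: C2_derivs_def)
        show "((\<lambda>y. W n (y, T n) - A n y) has_real_derivative (W1 (T n) y - (p1 (y, T n) + k * bump1 (y - x\<^sub>0)))) (at y)" for y
          unfolding A_def using fC2 p(1) XT(3)[of n] unfolding C2_derivs_def by (intro DERIV_diff DERIV_add bd) auto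
        show "((\<lambda>y. W1 (T n) y - (p1 (y, T n) + k * bump1 (y - x\<^sub>0))) has_real_derivative
            W2 (T n) (X n) - (p2 (P n) + k * bump2 (X n - x\<^sub>0))) (at (X n))"
          unfolding PXT using fC2 p(2) XT(3)[of n] unfolding C2_derivs_def by (intro DERIV_diff DERIV_add bd) auto
      qed (use xmax in auto)
      have "\<eta> * W2 (T n) (X n) \<le> \<eta> * (p2 (P n) + k * bump2 (X n - x\<^sub>0))"
        using 2 \<eta> by (intro mult_left_mono) auto
      moreover have "nonlin \<alpha> (\<delta> n) (\<lambda>y. W n (y, T n)) (X n) \<le> nonlin \<alpha> (\<delta> n) (A n) (X n)"
      proof (rule nonlin_mono[OF \<delta>(1) _ quad_touchD(1)[OF qA]])
        show "(\<lambda>y. W n (y, T n)) \<in> borel_measurable borel"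
          by (rule borel_measurable_continuous_onI[OF C2_derivs_continuous(1)[OF fC2]])
        show "\<bar>W n (y, T n)\<bar> \<le> M" for y using W[of n] XT(3)[of n] by (simp add: approx_flow_def)
        show "\<bar>A n y\<bar> \<le> \<bar>A n (X n)\<bar> + M'" for y using quad_touchD(3)[OF qA[of n], of "y - X n"] by simp
        show "W n (X n + z, T n) - W n (X n, T n) \<le> A n (X n + z) - A n (X n)" for z
          using xmax[of "X n + z"] by linarith
      qed
      moreover have "nonlin \<alpha> (\<delta> n) (A n) (X n) \<le> \<bar>pn n\<bar> * levy_op \<alpha> (A n) (X n) + k / 2"
        using abs_le_D1[OF cons[rule_format, OF conjI[OF \<delta>(1) conjI[OF less_imp_le[OF elim(1)] conjI[OF qA[of n] pnR[of n]]]]]] by linarith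
      ultimately show ?case using 1 elim(2) by linarith
    qed
  qed
  define A0 where "A0 y = \<phi> (y, t\<^sub>0) + k * bump (y - x\<^sub>0)" for y
  have quad0: "\<exists>Q M. quad_touch (\<lambda>y. \<phi> (y, t\<^sub>0)) x\<^sub>0 (p1 (x\<^sub>0, t\<^sub>0)) Q M"
  proof -
    have t: "0 < t\<^sub>0" using \<tau> by linarith
    obtain Q M where "quad_touch (\<lambda>y. \<phi> (y, t\<^sub>0)) x\<^sub>0 (p1 (x\<^sub>0, t\<^sub>0)) Q M"
      by (rule C2_derivs_quad_touch[OF C2phi[OF t] B[OF t]])
    then show ?thesis by blast
  qed
  have levylim: "(\<lambda>n. levy_op \<alpha> (A n) (X n)) \<longlonglongrightarrow> levy_op \<alpha> A0 x\<^sub>0"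
  proof (rule levy_op_tendsto[OF qA])
    show "A0 \<in> borel_measurable borel"
    proof -
      have [measurable]: "(\<lambda>y. \<phi> (y, t\<^sub>0)) \<in> borel_measurable borel" using quad0 quad_touchD(1) by blast
      have [measurable]: "(\<lambda>y. bump (y - x\<^sub>0)) \<in> borel_measurable borel" using quad_touchD(1)[OF quad_touch_bump] .
      show ?thesis unfolding A0_def[abs_def] by measurable
    qed
    fix z
    have "(\<lambda>n. (X n + z, T n)) \<longlonglongrightarrow> (x\<^sub>0 + z, t\<^sub>0)" by (intro tendsto_intros Xlim Tlim)
    then have "(\<lambda>n. \<phi> (X n + z, T n)) \<longlonglongrightarrow> \<phi> (x\<^sub>0 + z, t\<^sub>0)"
      by (rule continuous_on_tendsto_compose[OF c(1)]) (use \<tau> XT(3) in \<open>auto simp: open_domain_def\<close>)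
    moreover have "(\<lambda>n. bump (X n + z - x\<^sub>0)) \<longlonglongrightarrow> bump (x\<^sub>0 + z - x\<^sub>0)"
      by (rule continuous_on_tendsto_compose[OF bump_continuous(1)[of UNIV] tendsto_diff[OF tendsto_add[OF Xlim tendsto_const] tendsto_const]]) auto
    ultimately show "(\<lambda>n. A n (X n + z)) \<longlonglongrightarrow> A0 (x\<^sub>0 + z)"
      unfolding A_def A0_def by (intro tendsto_intros)
  qed
  have b0: "bump1 0 = 0" "bump2 0 = 2" by (simp_all add: bump1_def bump2_def)
  have pnlim: "pn \<longlonglongrightarrow> p1 (x\<^sub>0, t\<^sub>0) + k * bump1 0"
    unfolding pn_def by (intro tendsto_intros limc c limb bump_continuous Xlim)
  have "(\<lambda>n. \<eta> * (p2 (P n) + k * bump2 (X n - x\<^sub>0)) + \<bar>pn n\<bar> * levy_op \<alpha> (A n) (X n) + k) \<longlonglongrightarrow>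
      \<eta> * (p2 (x\<^sub>0, t\<^sub>0) + k * bump2 0) + \<bar>p1 (x\<^sub>0, t\<^sub>0) + k * bump1 0\<bar> * levy_op \<alpha> A0 x\<^sub>0 + k"
    by (intro tendsto_intros limc c limb bump_continuous Xlim pnlim levylim)
  moreover have "(\<lambda>n. q (P n) + k * bump1 (T n - t\<^sub>0)) \<longlonglongrightarrow> q (x\<^sub>0, t\<^sub>0) + k * bump1 0"
    by (intro tendsto_intros limc c limb bump_continuous Tlim)
  ultimately have "q (x\<^sub>0, t\<^sub>0) + k * bump1 0 \<le>
      \<eta> * (p2 (x\<^sub>0, t\<^sub>0) + k * bump2 0) + \<bar>p1 (x\<^sub>0, t\<^sub>0) + k * bump1 0\<bar> * levy_op \<alpha> A0 x\<^sub>0 + k"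
    by (rule tendsto_le[OF sequentially_bot _ _ ineq])
  moreover have "levy_op \<alpha> A0 x\<^sub>0 = levy_op \<alpha> (\<lambda>y. \<phi> (y, t\<^sub>0)) x\<^sub>0 + k * levy_op \<alpha> (\<lambda>x. bump (x - x\<^sub>0)) x\<^sub>0"
    using quad0 levy_op_add[OF _ quad_touch_bump, of "\<lambda>y. \<phi> (y, t\<^sub>0)" x\<^sub>0] unfolding A0_def[abs_def] by blast
  ultimately show ?thesis by (simp add: b0)
qed

text \<open>The perturbation of the test function contributes k times a constant, which disappears
  as k decreases to 0.\<close>

lemma approx_flow_limit_subsolution:
  assumes \<eta>: "0 \<le> \<eta>" and W: "\<And>n. approx_flow \<alpha> \<eta> (\<delta> n) M (e n) (W n)"
    and \<delta>: "\<And>n. 0 < \<delta> n" "\<delta> \<longlonglongrightarrow> 0" and e: "e \<longlonglongrightarrow> 0"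
    and lim: "\<And>\<rho>. 0 < \<rho> \<Longrightarrow> \<exists>N. \<forall>n\<ge>N. \<forall>x t. 0 \<le> t \<longrightarrow> \<bar>W n (x, t) - u (x, t)\<bar> \<le> \<rho> * (1 + t)"
    and u: "continuous_on closed_domain u" "bounded (u ` closed_domain)"
  shows "visc_subsolution \<alpha> \<eta> u"
  unfolding visc_subsolution_def
proof (intro conjI allI impI, goal_cases)
  case 1
  show ?case by (rule u(2))
next
  case 2
  show ?case
    unfolding usc_on_def using u(1) by (auto simp: continuous_on_def intro: order_tendstoD)
next
  case (3 x\<^sub>0 t\<^sub>0 \<tau> \<phi>)
  then have \<tau>: "0 < \<tau>" "\<tau> < t\<^sub>0" and tf: "test_function \<phi>"
    and max: "\<forall>x. \<forall>t\<in>{t\<^sub>0 - \<tau><..<t\<^sub>0 + \<tau>}. u (x, t) - \<phi> (x, t) \<le> u (x\<^sub>0, t\<^sub>0) - \<phi> (x\<^sub>0, t\<^sub>0)" by auto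
  have C2: "C2_on open_domain \<phi>" using tf by (simp add: test_function_def)
  obtain B where "\<forall>v\<in>\<phi> ` open_domain. \<bar>v\<bar> \<le> B" using tf unfolding test_function_def bounded_iff by auto
  then have B: "\<bar>\<phi> (x, t)\<bar> \<le> B" if "0 < t" for x t using that by (auto simp: open_domain_def)
  obtain p1 p2 q where p: "\<forall>x t. 0 < t \<longrightarrow> ((\<lambda>y. \<phi> (y, t)) has_real_derivative p1 (x, t)) (at x)"
      "\<forall>x t. 0 < t \<longrightarrow> ((\<lambda>y. p1 (y, t)) has_real_derivative p2 (x, t)) (at x)"
      "\<forall>x t. 0 < t \<longrightarrow> ((\<lambda>s. \<phi> (x, s)) has_real_derivative q (x, t)) (at t)"
    and c: "continuous_on open_domain \<phi>" "continuous_on open_domain p1" "continuous_on open_domain p2" "continuous_on open_domain q"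
    by (rule C2_on_partials[OF C2])
  have t0: "0 < t\<^sub>0" using \<tau> by linarith
  have d: "deriv (\<lambda>y. \<phi> (y, t\<^sub>0)) = (\<lambda>y. p1 (y, t\<^sub>0))" "deriv (\<lambda>y. p1 (y, t\<^sub>0)) x\<^sub>0 = p2 (x\<^sub>0, t\<^sub>0)"
    "deriv (\<lambda>s. \<phi> (x\<^sub>0, s)) t\<^sub>0 = q (x\<^sub>0, t\<^sub>0)"
    using p t0 by (auto intro!: DERIV_imp_deriv)
  have cp2: "continuous_on UNIV (\<lambda>y. p2 (y, t\<^sub>0))"
    by (rule continuous_on_compose2[OF c(3)]) (use t0 in \<open>auto intro!: continuous_intros simp: open_domain_def\<close>)
  have "C2_derivs (\<lambda>y. \<phi> (y, t\<^sub>0)) (\<lambda>y. p1 (y, t\<^sub>0)) (\<lambda>y. p2 (y, t\<^sub>0))"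
    using p(1,2) t0 cp2 by (simp add: C2_derivs_def)
  then obtain Q M' where "quad_touch (\<lambda>y. \<phi> (y, t\<^sub>0)) x\<^sub>0 (p1 (x\<^sub>0, t\<^sub>0)) Q M'"
    by (rule C2_derivs_quad_touch[OF _ B[OF t0]])
  then have fl: "frac_lap \<alpha> (\<lambda>y. \<phi> (y, t\<^sub>0)) x\<^sub>0 = - levy_op \<alpha> (\<lambda>y. \<phi> (y, t\<^sub>0)) x\<^sub>0"
    by (rule frac_lap_eq_levy_op) (simp add: d)
  define Y where "Y = \<eta> * p2 (x\<^sub>0, t\<^sub>0) + \<bar>p1 (x\<^sub>0, t\<^sub>0)\<bar> * levy_op \<alpha> (\<lambda>y. \<phi> (y, t\<^sub>0)) x\<^sub>0"
  define Z where "Z = \<eta> * 2 + \<bar>p1 (x\<^sub>0, t\<^sub>0)\<bar> * levy_op \<alpha> (\<lambda>x. bump (x - x\<^sub>0)) x\<^sub>0 + 1"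
  have ineq: "q (x\<^sub>0, t\<^sub>0) \<le> Y + k * Z" if "0 < k" "k \<le> 1" for k
    using approx_flow_limit_inequality[OF \<eta> W \<delta> e lim p c B \<tau> max that]
    unfolding Y_def Z_def by (simp add: algebra_simps)
  have "((\<lambda>k. Y + k * Z) \<longlongrightarrow> Y + 0 * Z) (at_right 0)" by (intro tendsto_intros)
  moreover have "\<forall>\<^sub>F k in at_right 0. q (x\<^sub>0, t\<^sub>0) \<le> Y + k * Z"
    unfolding eventually_at_right_field by (intro exI[of _ 1]) (auto intro: ineq)
  ultimately have "q (x\<^sub>0, t\<^sub>0) \<le> Y + 0 * Z" by (rule tendsto_lowerbound) simp
  then show ?case unfolding visc_op_def d fl Y_def by simp
qed

end

section \<open>Existence and uniqueness\<close>

text \<open>The estimate is one-sided but holds for all pairs, so exchanging n and m makes it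
  two-sided; the second part keeps the same \<rho> in the limit.\<close>

lemma convergent_if_oscillation_small:
  fixes f :: "nat \<Rightarrow> real"
  assumes "\<And>\<rho>. 0 < \<rho> \<Longrightarrow> \<exists>N. \<forall>n\<ge>N. \<forall>m\<ge>N. f n \<le> f m + \<rho> * c" "0 < c"
  shows "convergent f" "\<And>\<rho> N n. (\<And>n m. N \<le> n \<Longrightarrow> N \<le> m \<Longrightarrow> f n \<le> f m + \<rho> * c) \<Longrightarrow> N \<le> n \<Longrightarrow> \<bar>f n - lim f\<bar> \<le> \<rho> * c"
proof -
  have "Cauchy f"
  proof (rule metric_CauchyI)
    fix e :: real assume "0 < e"
    then have "0 < e / (2 * c)" using assms(2) by simp
    from assms(1)[OF this] obtain N where N: "\<forall>n\<ge>N. \<forall>m\<ge>N. f n \<le> f m + e / 2" using assms(2) by auto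
    have "dist (f m) (f n) < e" if "N \<le> m" "N \<le> n" for m n
    proof -
      have "f n \<le> f m + e / 2" "f m \<le> f n + e / 2" using N that by blast+
      then show ?thesis using \<open>0 < e\<close> unfolding dist_real_def by linarith
    qed
    then show "\<exists>M. \<forall>m\<ge>M. \<forall>n\<ge>M. dist (f m) (f n) < e" by blast
  qed
  then show conv: "convergent f" by (simp add: Cauchy_convergent_iff)
  fix \<rho> N n assume *: "\<And>n m. N \<le> n \<Longrightarrow> N \<le> m \<Longrightarrow> f n \<le> f m + \<rho> * c" and n: "N \<le> n"
  have l: "f \<longlonglongrightarrow> lim f" using conv by (simp add: convergent_LIMSEQ_iff)
  have "lim f \<le> f n + \<rho> * c" by (rule LIMSEQ_le_const2[OF l]) (use * n in blast)
  moreover have "f n - \<rho> * c \<le> lim f"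
  proof (rule LIMSEQ_le_const[OF l], intro exI[of _ N] allI impI)
    fix m assume "N \<le> m"
    then show "f n - \<rho> * c \<le> f m" using *[OF n, of m] by linarith
  qed
  ultimately show "\<bar>f n - lim f\<bar> \<le> \<rho> * c" by (simp add: abs_le_iff)
qed

context levy_exponent begin

lemma weak_subsol_mono:
  assumes "weak_subsol \<eta> Q R B e u" "e \<le> e'" shows "weak_subsol \<eta> Q R B e' u"
  unfolding weak_subsol_def
proof (intro allI impI, goal_cases)
  case (1 x\<^sub>0 t\<^sub>0 c K F F1 F2 G G1 G2 g)
  then have "c \<le> \<eta> * F2 x\<^sub>0 + \<bar>F1 x\<^sub>0\<bar> * levy_op \<alpha> (\<lambda>x. min (F x) (G x)) x\<^sub>0 + e"
    by (intro weak_subsolD[OF assms(1), of t\<^sub>0 F F1 F2 G G1 G2 g x\<^sub>0 c K]) auto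
  then show ?case using assms(2) by linarith
qed

text \<open>One use of \<open>comparison\<close> with \<theta> = \<rho> serves twice: a viscosity
  subsolution enters with error 0 and an approximation with error e n + E/2, both below E. The same
  N works for all v because the constants precede v.\<close>

lemma visc_subsolution_le_approx_flow:
  assumes \<eta>: "0 \<le> \<eta>" and M: "\<And>x. \<bar>u\<^sub>0 x\<bar> \<le> M"
    and uc: "\<And>c. 0 < c \<Longrightarrow> \<exists>d>0. \<forall>h. \<bar>h\<bar> \<le> d \<longrightarrow> (\<forall>x. \<bar>u\<^sub>0 (x + h) - u\<^sub>0 x\<bar> \<le> c)"
    and W: "\<And>n. approx_flow \<alpha> \<eta> (\<delta> n) M (e n) (W n)" "\<And>n x. \<bar>W n (x, 0) - u\<^sub>0 x\<bar> \<le> e n"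
    and \<delta>: "\<And>n. 0 < \<delta> n" "\<delta> \<longlonglongrightarrow> 0" and e: "e \<longlonglongrightarrow> 0" and \<rho>: "0 < \<rho>"
  obtains N where "\<forall>v. visc_subsolution \<alpha> \<eta> v \<and> continuous_on closed_domain v \<and> (\<forall>x t. 0 \<le> t \<longrightarrow> \<bar>v (x, t)\<bar> \<le> M) \<and> (\<forall>x. v (x, 0) \<le> u\<^sub>0 x)
      \<longrightarrow> (\<forall>n\<ge>N. \<forall>x t. 0 \<le> t \<longrightarrow> v (x, t) \<le> W n (x, t) + \<rho> * (1 + t))"
    "\<forall>n\<ge>N. \<forall>m\<ge>N. \<forall>x t. 0 \<le> t \<longrightarrow> W n (x, t) \<le> W m (x, t) + \<rho> * (1 + t)"
proof -
  obtain Q R B E \<delta>\<^sub>0 where E: "0 < E" "0 < \<delta>\<^sub>0" and cmp: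
    "\<forall>u \<delta> W. weak_subsol \<eta> Q R B E u \<and> continuous_on closed_domain u \<and> (\<forall>x t. 0 \<le> t \<longrightarrow> \<bar>u (x, t)\<bar> \<le> M) \<and>
       (\<forall>x. u (x, 0) \<le> u\<^sub>0 x + E) \<and> 0 < \<delta> \<and> \<delta> \<le> \<delta>\<^sub>0 \<and> approx_flow \<alpha> \<eta> \<delta> M E W \<and> (\<forall>x. \<bar>W (x, 0) - u\<^sub>0 x\<bar> \<le> E) \<longrightarrow>
       (\<forall>x t. 0 \<le> t \<longrightarrow> u (x, t) \<le> W (x, t) + \<rho> + \<rho> * t)"
    by (rule comparison[OF \<eta> M uc \<rho> \<rho>])
  have E2: "0 < E / 2" using E by simp
  obtain \<delta>\<^sub>1 where \<delta>1: "0 < \<delta>\<^sub>1" and cons: "\<forall>\<delta> A x p. 0 < \<delta> \<and> \<delta> \<le> \<delta>\<^sub>1 \<and> quad_touch A x p Q B \<and> \<bar>p\<bar> \<le> R \<longrightarrow>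
    \<bar>nonlin \<alpha> \<delta> A x - \<bar>p\<bar> * levy_op \<alpha> A x\<bar> \<le> E / 2"
    by (rule nonlin_consistent[OF E2])
  have "\<forall>\<^sub>F n in sequentially. \<delta> n < \<delta>\<^sub>0 \<and> \<delta> n < \<delta>\<^sub>1 \<and> e n < E / 2"
    using \<delta>(2) e E(2) \<delta>1 E2 by (intro eventually_conj order_tendstoD)
  then obtain N where N: "\<And>n. N \<le> n \<Longrightarrow> \<delta> n < \<delta>\<^sub>0 \<and> \<delta> n < \<delta>\<^sub>1 \<and> e n < E / 2" unfolding eventually_sequentially by blast
  have WE: "approx_flow \<alpha> \<eta> (\<delta> n) M E (W n)" "\<bar>W n (x, 0) - u\<^sub>0 x\<bar> \<le> E" if "N \<le> n" for n x
  proof -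
    have "e n \<le> E" using N[OF that] E by linarith
    then show "approx_flow \<alpha> \<eta> (\<delta> n) M E (W n)" "\<bar>W n (x, 0) - u\<^sub>0 x\<bar> \<le> E"
      using approx_flow_mono[OF W(1) order_refl] W(2)[of n x] by auto
  qed
  have cmp': "v (x, t) \<le> W m (x, t) + \<rho> * (1 + t)"
    if "weak_subsol \<eta> Q R B E v" "continuous_on closed_domain v" "\<forall>x t. 0 \<le> t \<longrightarrow> \<bar>v (x, t)\<bar> \<le> M"
      "\<forall>x. v (x, 0) \<le> u\<^sub>0 x + E" "N \<le> m" "0 \<le> t" for v m x t
  proof -
    have "v (x, t) \<le> W m (x, t) + \<rho> + \<rho> * t"
      using cmp[rule_format, of v "\<delta> m" "W m" t x] that WE[OF that(5)] \<delta>(1)[of m] N[OF that(5)] by simp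
    then show ?thesis by (simp add: distrib_left)
  qed
  show ?thesis
  proof (rule that[of N]; intro allI impI)
    fix v n x and t :: real
    assume v: "visc_subsolution \<alpha> \<eta> v \<and> continuous_on closed_domain v \<and> (\<forall>x t. 0 \<le> t \<longrightarrow> \<bar>v (x, t)\<bar> \<le> M) \<and> (\<forall>x. v (x, 0) \<le> u\<^sub>0 x)"
      and "N \<le> n" "0 \<le> t"
    have "weak_subsol \<eta> Q R B E v"
      using weak_subsol_mono[OF visc_subsolution_imp_weak_subsol] v E by auto
    moreover have "\<forall>x. v (x, 0) \<le> u\<^sub>0 x + E" using v E by (meson add_increasing2 less_imp_le)
    ultimately show "v (x, t) \<le> W n (x, t) + \<rho> * (1 + t)" using v \<open>N \<le> n\<close> \<open>0 \<le> t\<close> by (intro cmp') auto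
  next
    fix n m x and t :: real assume nm: "N \<le> n" "N \<le> m" and t: "0 \<le> t"
    have "weak_subsol \<eta> Q R B (e n + E / 2) (W n)"
      using N[OF nm(1)] \<delta>(1)[of n] by (intro approx_flow_imp_weak_subsol[OF \<eta> _ W(1)] cons[rule_format]) auto
    then have "weak_subsol \<eta> Q R B E (W n)"
      by (rule weak_subsol_mono) (use N[OF nm(1)] in linarith)
    moreover have "continuous_on closed_domain (W n)" using W(1)[of n] by (rule approx_flowE)
    moreover have "\<forall>x t. 0 \<le> t \<longrightarrow> \<bar>W n (x, t)\<bar> \<le> M" using W(1)[of n] by (auto elim: approx_flowE)
    moreover have "\<forall>x. W n (x, 0) \<le> u\<^sub>0 x + E"
    proof
      fix x show "W n (x, 0) \<le> u\<^sub>0 x + E" using WE(2)[OF nm(1), of x] by (simp add: abs_le_iff)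
    qed
    ultimately show "W n (x, t) \<le> W m (x, t) + \<rho> * (1 + t)" using nm t by (intro cmp')
  qed
qed

lemma bounded_cont_solutionD:
  assumes "bounded_cont_solution \<alpha> \<eta> u\<^sub>0 v" "continuous_on UNIV u\<^sub>0"
  shows "bounded (v ` closed_domain)" "continuous_on closed_domain v"
    "visc_subsolution \<alpha> \<eta> v" "visc_subsolution \<alpha> \<eta> (\<lambda>p. - v p)" "v (x, 0) = u\<^sub>0 x"
proof -
  show b: "bounded (v ` closed_domain)" and c: "continuous_on closed_domain v"
    using assms(1) by (auto simp: bounded_cont_solution_def)
  note env = continuous_env[OF c] and env0 = continuous_env[OF assms(2) UNIV_I]
  have sub: "ivp_subsolution \<alpha> \<eta> u\<^sub>0 (upper_env closed_domain v)" and super: "ivp_supersolution \<alpha> \<eta> u\<^sub>0 (lower_env closed_domain v)"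
    using assms(1) by (auto simp: bounded_cont_solution_def ivp_solution_def)
  show "visc_subsolution \<alpha> \<eta> v"
    by (rule visc_subsolution_cong[of _ _ "upper_env closed_domain v"]) (use sub env in \<open>auto simp: ivp_subsolution_def\<close>)
  show "visc_subsolution \<alpha> \<eta> (\<lambda>p. - v p)"
    by (rule visc_subsolution_cong[OF visc_supersolution_iff[THEN iffD1], of _ _ "lower_env closed_domain v"])
      (use super env in \<open>auto simp: ivp_supersolution_def\<close>)
  have x0: "(x, 0) \<in> closed_domain" by (simp add: closed_domain_def)
  show "v (x, 0) = u\<^sub>0 x"
  proof (rule antisym)
    show "v (x, 0) \<le> u\<^sub>0 x" using sub by (simp add: ivp_subsolution_def env0) (metis env(1)[OF x0])
    show "u\<^sub>0 x \<le> v (x, 0)" using super by (simp add: ivp_supersolution_def env0) (metis env(2)[OF x0])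
  qed
qed

lemma bounded_cont_solutionI:
  assumes "bounded (v ` closed_domain)" "continuous_on closed_domain v" "continuous_on UNIV u\<^sub>0"
    "visc_subsolution \<alpha> \<eta> v" "visc_subsolution \<alpha> \<eta> (\<lambda>p. - v p)" "\<And>x. v (x, 0) = u\<^sub>0 x"
  shows "bounded_cont_solution \<alpha> \<eta> u\<^sub>0 v"
proof -
  note env = continuous_env[OF assms(2)] and env0 = continuous_env[OF assms(3) UNIV_I]
  have x0: "(x, 0) \<in> closed_domain" for x by (simp add: closed_domain_def)
  have "visc_subsolution \<alpha> \<eta> (upper_env closed_domain v)"
    by (rule visc_subsolution_cong[OF assms(4)]) (simp add: env)
  moreover have "visc_supersolution \<alpha> \<eta> (lower_env closed_domain v)"
    unfolding visc_supersolution_iff by (rule visc_subsolution_cong[OF assms(5)]) (simp add: env)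
  ultimately show ?thesis
    using assms(1,2,6) by (simp add: bounded_cont_solution_def ivp_solution_def ivp_subsolution_def ivp_supersolution_def env[OF x0] env0)
qed

lemma bounded_cont_solution_exists_unique:
  assumes \<eta>: "0 \<le> \<eta>" and u0: "u\<^sub>0 \<in> BUC"
  shows "\<exists>u. bounded_cont_solution \<alpha> \<eta> u\<^sub>0 u \<and>
           (\<forall>v. bounded_cont_solution \<alpha> \<eta> u\<^sub>0 v \<longrightarrow> (\<forall>p\<in>closed_domain. v p = u p))"
proof -
  obtain M where M: "\<And>x. \<bar>u\<^sub>0 x\<bar> \<le> M" using u0 unfolding BUC_def bounded_iff by auto
  have M': "\<bar>- u\<^sub>0 x\<bar> \<le> M" for x using M by simp
  have uc: "\<exists>d>0. \<forall>h. \<bar>h\<bar> \<le> d \<longrightarrow> (\<forall>x. \<bar>u\<^sub>0 (x + h) - u\<^sub>0 x\<bar> \<le> c)" if "0 < c" for c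
  proof -
    have "uniformly_continuous_on UNIV u\<^sub>0" using u0 by (simp add: BUC_def)
    from this[unfolded uniformly_continuous_on_def, rule_format, OF that]
    obtain d where d: "0 < d" "\<forall>x x'. dist x' x < d \<longrightarrow> dist (u\<^sub>0 x') (u\<^sub>0 x) < c" by auto
    show ?thesis
    proof (intro exI[of _ "d / 2"] conjI allI impI)
      fix h x :: real assume "\<bar>h\<bar> \<le> d / 2"
      then have "dist (x + h) x < d" using d(1) by (simp add: dist_real_def)
      then have "dist (u\<^sub>0 (x + h)) (u\<^sub>0 x) < c" using d(2) by blast
      then show "\<bar>u\<^sub>0 (x + h) - u\<^sub>0 x\<bar> \<le> c" by (simp add: dist_real_def)
    qed (use d in simp)
  qed
  have uc': "\<exists>d>0. \<forall>h. \<bar>h\<bar> \<le> d \<longrightarrow> (\<forall>x. \<bar>- u\<^sub>0 (x + h) - - u\<^sub>0 x\<bar> \<le> c)" if "0 < c" for c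
    using uc[OF that] by (simp add: abs_minus_commute)
  have cu0: "continuous_on UNIV u\<^sub>0" using u0 by (simp add: BUC_def uniformly_continuous_imp_continuous)
  define e where "e n = 1 / real (Suc n)" for n
  have e: "0 < e n" "e \<longlonglongrightarrow> 0" for n
    using LIMSEQ_Suc[OF lim_1_over_n[where 'a = real]] by (simp_all add: e_def[abs_def])
  have "\<exists>W. approx_flow \<alpha> \<eta> (e n) M (e n) W \<and> (\<forall>x. \<bar>W (x, 0) - u\<^sub>0 x\<bar> \<le> e n)" for n
    using approx_flow_exists[OF \<eta> M uc e(1) e(1), of n n] by blast
  then obtain W where W: "\<And>n. approx_flow \<alpha> \<eta> (e n) M (e n) (W n)" "\<And>n x. \<bar>W n (x, 0) - u\<^sub>0 x\<bar> \<le> e n" by metis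
  have W': "approx_flow \<alpha> \<eta> (e n) M (e n) (\<lambda>p. - W n p)" "\<bar>- W n (x, 0) - - u\<^sub>0 x\<bar> \<le> e n" for n x
    using approx_flow_uminus[OF W(1)] W(2)[of n x] by (simp_all add: abs_minus_commute)
  define u where "u p = lim (\<lambda>n. W n p)" for p
  have cau: "\<exists>N. \<forall>n\<ge>N. \<forall>m\<ge>N. \<forall>x t. 0 \<le> t \<longrightarrow> W n (x, t) \<le> W m (x, t) + \<rho> * (1 + t)" if \<rho>: "0 < \<rho>" for \<rho>
  proof -
    obtain N where "\<forall>n\<ge>N. \<forall>m\<ge>N. \<forall>x t. 0 \<le> t \<longrightarrow> W n (x, t) \<le> W m (x, t) + \<rho> * (1 + t)"
      by (rule visc_subsolution_le_approx_flow[OF \<eta> M uc W e(1) e(2) e(2) \<rho>])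
    then show ?thesis by (rule exI)
  qed
  have lim: "\<exists>N. \<forall>n\<ge>N. \<forall>x t. 0 \<le> t \<longrightarrow> \<bar>W n (x, t) - u (x, t)\<bar> \<le> \<rho> * (1 + t)" if \<rho>: "0 < \<rho>" for \<rho>
  proof -
    obtain N where N: "\<forall>n\<ge>N. \<forall>m\<ge>N. \<forall>x t. 0 \<le> t \<longrightarrow> W n (x, t) \<le> W m (x, t) + \<rho> * (1 + t)" using cau[OF \<rho>] by blast
    show ?thesis
    proof (intro exI[of _ N] allI impI)
      fix n x and t :: real assume n: "N \<le> n" and t: "0 \<le> t"
      show "\<bar>W n (x, t) - u (x, t)\<bar> \<le> \<rho> * (1 + t)"
        unfolding u_def
      proof (rule convergent_if_oscillation_small(2)[where f = "\<lambda>n. W n (x, t)" and c = "1 + t" and N = N])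
        show "\<exists>N. \<forall>n\<ge>N. \<forall>m\<ge>N. W n (x, t) \<le> W m (x, t) + \<rho>' * (1 + t)" if "0 < \<rho>'" for \<rho>'
          using cau[OF that] t by blast
      qed (use N n t in auto)
    qed
  qed
  have ulim: "(\<lambda>n. W n (x, t)) \<longlonglongrightarrow> u (x, t)" if t: "0 \<le> t" for x t
  proof -
    have "convergent (\<lambda>n. W n (x, t))"
    proof (rule convergent_if_oscillation_small(1)[where c = "1 + t"])
      show "\<exists>N. \<forall>n\<ge>N. \<forall>m\<ge>N. W n (x, t) \<le> W m (x, t) + \<rho>' * (1 + t)" if "0 < \<rho>'" for \<rho>'
        using cau[OF that] t by blast
    qed (use t in simp)
    then show ?thesis unfolding u_def by (simp add: convergent_LIMSEQ_iff)
  qed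
  have WM: "\<bar>W n (x, t)\<bar> \<le> M" if "0 \<le> t" for n x t using W(1)[of n] that unfolding approx_flow_def by blast
  have uM: "\<bar>u (x, t)\<bar> \<le> M" if t: "0 \<le> t" for x t
    by (rule LIMSEQ_le_const2[OF tendsto_rabs[OF ulim[OF t]]]) (use WM[OF t] in blast)
  have ub: "bounded (u ` closed_domain)"
    unfolding bounded_iff by (intro exI[of _ M]) (auto simp: closed_domain_def uM)
  have Wc: "continuous_on closed_domain (W n)" for n using W(1)[of n] by (rule approx_flowE)
  have uc1: "continuous_on closed_domain u"
    unfolding continuous_on_iff
  proof (intro ballI allI impI)
    fix p and r :: real assume p: "p \<in> closed_domain" and r: "0 < r"
    obtain x t where xt: "p = (x, t)" "0 \<le> t" using p by (cases p) (auto simp: closed_domain_def)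
    \<comment> \<open>Convergence is uniform only on bounded time intervals; 2 + t bounds 1 + t' for
      all points within distance 1.\<close>
    define \<rho> where "\<rho> = r / (4 * (2 + t))"
    have \<rho>: "0 < \<rho>" "\<rho> * (2 + t) = r / 4" using r xt(2) by (auto simp: \<rho>_def field_simps)
    obtain n where n: "\<forall>x t. 0 \<le> t \<longrightarrow> \<bar>W n (x, t) - u (x, t)\<bar> \<le> \<rho> * (1 + t)" using lim[OF \<rho>(1)] by blast
    have "0 < r / 4" using r by simp
    from Wc[of n, unfolded continuous_on_iff, rule_format, OF p this]
    obtain d where d: "0 < d" "\<forall>p'\<in>closed_domain. dist p' p < d \<longrightarrow> dist (W n p') (W n p) < r / 4" by blast
    have "dist (u p') (u p) < r" if p': "p' \<in> closed_domain" "dist p' p < min d 1" for p'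
    proof -
      obtain x' t' where xt': "p' = (x', t')" "0 \<le> t'" using p' by (cases p') (auto simp: closed_domain_def)
      have "dist t' t \<le> dist p' p" using dist_snd_le[of p' p] by (simp add: xt xt')
      then have "t' \<le> t + 1" using p'(2) unfolding dist_real_def by linarith
      then have "\<rho> * (1 + t') \<le> \<rho> * (2 + t)" "\<rho> * (1 + t) \<le> \<rho> * (2 + t)" using \<rho>(1) by simp_all
      then have "\<bar>W n p' - u p'\<bar> \<le> r / 4" "\<bar>W n p - u p\<bar> \<le> r / 4"
        using n[rule_format, OF xt(2), of x] n[rule_format, OF xt'(2), of x'] \<rho>(2) unfolding xt(1) xt'(1) by linarith+
      moreover have "\<bar>W n p' - W n p\<bar> < r / 4" using d(2) p' by (simp add: dist_real_def)
      ultimately show ?thesis unfolding dist_real_def by linarith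
    qed
    then show "\<exists>d>0. \<forall>p'\<in>closed_domain. dist p' p < d \<longrightarrow> dist (u p') (u p) < r"
      using d(1) by (intro exI[of _ "min d 1"]) auto
  qed
  have u00: "u (x, 0) = u\<^sub>0 x" for x
  proof -
    have "(\<lambda>n. W n (x, 0) - u\<^sub>0 x) \<longlonglongrightarrow> 0"
      by (rule Lim_null_comparison[OF _ e(2)]) (use W(2) in simp)
    then have "(\<lambda>n. W n (x, 0)) \<longlonglongrightarrow> u\<^sub>0 x" by (simp add: LIM_zero_iff)
    then show ?thesis using ulim[of 0 x] LIMSEQ_unique by auto
  qed
  have sub: "visc_subsolution \<alpha> \<eta> u"
    by (rule approx_flow_limit_subsolution[OF \<eta> W(1) e(1,2) e(2) lim uc1 ub])
  have sub': "visc_subsolution \<alpha> \<eta> (\<lambda>p. - u p)"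
  proof (rule approx_flow_limit_subsolution[OF \<eta> W'(1) e(1,2) e(2)])
    show "\<exists>N. \<forall>n\<ge>N. \<forall>x t. 0 \<le> t \<longrightarrow> \<bar>- W n (x, t) - - u (x, t)\<bar> \<le> \<rho> * (1 + t)" if "0 < \<rho>" for \<rho>
      using lim[OF that] by (simp add: abs_minus_commute)
    show "continuous_on closed_domain (\<lambda>p. - u p)" using uc1 by (rule continuous_on_minus)
    have "(\<lambda>p. - u p) ` closed_domain = uminus ` (u ` closed_domain)" by (simp add: image_image)
    then show "bounded ((\<lambda>p. - u p) ` closed_domain)" using ub by (simp add: bounded_uminus)
  qed
  have sol: "bounded_cont_solution \<alpha> \<eta> u\<^sub>0 u"
    by (rule bounded_cont_solutionI[OF ub uc1 cu0 sub sub' u00])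
  moreover have "v p = u p" if v: "bounded_cont_solution \<alpha> \<eta> u\<^sub>0 v" and p: "p \<in> closed_domain" for v p
  proof -
    note vD = bounded_cont_solutionD[OF v cu0]
    obtain x t where xt: "p = (x, t)" "0 \<le> t" using p by (cases p) (auto simp: closed_domain_def)
    obtain Mv where Mv: "\<forall>y\<in>v ` closed_domain. \<bar>y\<bar> \<le> Mv" using vD(1) unfolding bounded_iff by auto
    \<comment> \<open>The comparison takes one bound for the datum, the solution and the
      approximations, so the flows are regarded with the larger bound.\<close>
    define B where "B = max M Mv"
    have vB: "\<bar>v (x, t)\<bar> \<le> B" if "0 \<le> t" for x t
    proof -
      have "(x, t) \<in> closed_domain" using that by (simp add: closed_domain_def)
      then have "\<bar>v (x, t)\<bar> \<le> Mv" using Mv by blast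
      then show ?thesis by (simp add: B_def)
    qed
    have u0B: "\<bar>u\<^sub>0 x\<bar> \<le> B" "\<bar>- u\<^sub>0 x\<bar> \<le> B" for x using M[of x] by (auto simp: B_def)
    have WB: "approx_flow \<alpha> \<eta> (e n) B (e n) (W n)" "approx_flow \<alpha> \<eta> (e n) B (e n) (\<lambda>p. - W n p)" for n
      using approx_flow_mono[OF W(1)] approx_flow_mono[OF W'(1)] by (simp_all add: B_def)
    have 1: "v (x, t) \<le> u (x, t) + \<rho> * (1 + t)" if \<rho>: "0 < \<rho>" for \<rho>
    proof -
      have v': "visc_subsolution \<alpha> \<eta> v \<and> continuous_on closed_domain v \<and> (\<forall>x t. 0 \<le> t \<longrightarrow> \<bar>v (x, t)\<bar> \<le> B) \<and> (\<forall>x. v (x, 0) \<le> u\<^sub>0 x)"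
        using vD(2,3,5) vB by simp
      obtain N where "\<forall>v. visc_subsolution \<alpha> \<eta> v \<and> continuous_on closed_domain v \<and> (\<forall>x t. 0 \<le> t \<longrightarrow> \<bar>v (x, t)\<bar> \<le> B) \<and> (\<forall>x. v (x, 0) \<le> u\<^sub>0 x)
        \<longrightarrow> (\<forall>n\<ge>N. \<forall>x t. 0 \<le> t \<longrightarrow> v (x, t) \<le> W n (x, t) + \<rho> * (1 + t))"
        by (rule visc_subsolution_le_approx_flow[OF \<eta> u0B(1) uc WB(1) W(2) e(1) e(2) e(2) \<rho>])
      from this[rule_format, OF v'] have N: "\<forall>n\<ge>N. \<forall>x t. 0 \<le> t \<longrightarrow> v (x, t) \<le> W n (x, t) + \<rho> * (1 + t)" by simp
      have "(\<lambda>n. W n (x, t) + \<rho> * (1 + t)) \<longlonglongrightarrow> u (x, t) + \<rho> * (1 + t)" by (intro tendsto_intros ulim xt(2))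
      then show ?thesis by (rule LIMSEQ_le_const) (use N xt(2) in blast)
    qed
    \<comment> \<open>The reverse inequality is the same statement for -v, with datum
      \<open>- u\<^sub>0\<close> and flows \<open>- W n\<close>.\<close>
    have 2: "- v (x, t) \<le> - u (x, t) + \<rho> * (1 + t)" if \<rho>: "0 < \<rho>" for \<rho>
    proof -
      have "continuous_on closed_domain (\<lambda>p. - v p)" using vD(2) by (rule continuous_on_minus)
      then have v': "visc_subsolution \<alpha> \<eta> (\<lambda>p. - v p) \<and> continuous_on closed_domain (\<lambda>p. - v p) \<and>
          (\<forall>x t. 0 \<le> t \<longrightarrow> \<bar>- v (x, t)\<bar> \<le> B) \<and> (\<forall>x. - v (x, 0) \<le> - u\<^sub>0 x)"
        using vD(4,5) vB by simp
      obtain N where "\<forall>v. visc_subsolution \<alpha> \<eta> v \<and> continuous_on closed_domain v \<and> (\<forall>x t. 0 \<le> t \<longrightarrow> \<bar>v (x, t)\<bar> \<le> B) \<and> (\<forall>x. v (x, 0) \<le> - u\<^sub>0 x)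
        \<longrightarrow> (\<forall>n\<ge>N. \<forall>x t. 0 \<le> t \<longrightarrow> v (x, t) \<le> - W n (x, t) + \<rho> * (1 + t))"
        by (rule visc_subsolution_le_approx_flow[OF \<eta> u0B(2) uc' WB(2) W'(2) e(1) e(2) e(2) \<rho>])
      from this[rule_format, OF v'] have N: "\<forall>n\<ge>N. \<forall>x t. 0 \<le> t \<longrightarrow> - v (x, t) \<le> - W n (x, t) + \<rho> * (1 + t)" by simp
      have "(\<lambda>n. - W n (x, t) + \<rho> * (1 + t)) \<longlonglongrightarrow> - u (x, t) + \<rho> * (1 + t)" by (intro tendsto_intros ulim xt(2))
      then show ?thesis by (rule LIMSEQ_le_const) (use N xt(2) in blast)
    qed
    have le: "a \<le> b" if "\<And>\<rho>. 0 < \<rho> \<Longrightarrow> a \<le> b + \<rho> * (1 + t)" for a b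
    proof (rule field_le_epsilon)
      fix r :: real assume "0 < r"
      then show "a \<le> b + r" using that[of "r / (1 + t)"] xt(2) by simp
    qed
    have "v (x, t) \<le> u (x, t)" by (rule le) (rule 1)
    moreover have "- v (x, t) \<le> - u (x, t)" by (rule le) (rule 2)
    ultimately show ?thesis using xt by simp
  qed
  ultimately show ?thesis by blast
qed

end

theorem theorem3p7:
  fixes \<alpha> \<eta> :: real and u\<^sub>0 :: "real \<Rightarrow> real"
  assumes "\<alpha> \<in> {0<..<2}" and "\<eta> \<ge> 0" and "u\<^sub>0 \<in> BUC"
  shows "\<exists>u. bounded_cont_solution \<alpha> \<eta> u\<^sub>0 u \<and>
           (\<forall>v. bounded_cont_solution \<alpha> \<eta> u\<^sub>0 v \<longrightarrow> (\<forall>p\<in>closed_domain. v p = u p))"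
proof -
  interpret levy_exponent \<alpha> using assms(1) by unfold_locales auto
  show ?thesis using assms(2,3) by (rule bounded_cont_solution_exists_unique)
qed

end
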